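(* Let $\mathfrak g$ be a finite-dimensional Lie bialgebra (super), encoded by a quadratic homological vector field $\hat Q=\frac12\xi^j\xi^iQ_{ij}^k\,\partial/\partial\xi^k$ on $\Pi\mathfrak g$ and an odd Hamiltonian $S=\frac12\xi^lS_l^{nm}\xi_m\xi_n$ on $T^*\Pi\mathfrak g$ defining a linear Schouten bracket on $\Pi\mathfrak g$, with $\hat Q$ a derivation of this bracket. Let $Q=\frac12\xi^j\xi^iQ_{ij}^k\xi_k$ and let $\hat Q_D=X_{Q+S}=\{Q+S,\ \}$, the homological vector field on $T^*\Pi\mathfrak g\cong\Pi(\mathfrak g\oplus\mathfrak g^* )$ corresponding to the Lie bracket of Drinfeld's double. Let $Q_D=p_{\hat Q_D}\in C^\infty(T^*T^*\Pi\mathfrak g)$ be the Hamiltonian corresponding to the vector field $\hat Q_D$, let $r=\pi_i\pi^i\in C^\infty(T^*T^*\Pi\mathfrak g)$, and put $$S_D:=\tfrac12\{Q_D,r\}\in C^\infty(T^*T^*\Pi\mathfrak g)$$ (canonical Poisson bracket of $T^*T^*\Pi\mathfrak g$). Then $S_D$ is a Schouten tensor for $T^*\Pi\mathfrak g$, and together with the field $\hat Q_D$ it gives a $QS$-structure on $T^*\Pi\mathfrak g$. The Schouten bracket specified by $S_D$ corresponds to the cobracket in Drinfeld's double $\mathfrak d=\mathfrak g\oplus\mathfrak g^*$.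
   Context: Everything is $\mathbb Z_2$-graded; tilde denotes parity; $\Pi$ is parity reversion. For a basis $e_i$ of $\mathfrak g$ with $\tilde e_i=\tilde\imath$, $\Pi\mathfrak g$ has linear coordinates $\xi^i$ of parity $\tilde\imath+1$; $\xi_i$ are the conjugate momenta on $T^*\Pi\mathfrak g$; $\pi_i,\pi^i$ are the momenta on $T^*T^*\Pi\mathfrak g$ conjugate to $\xi^i,\xi_i$ respectively. On $T^*M$ with coordinates $x^a$ (parity $\tilde a$) and momenta $p_a$, the canonical Poisson bracket is $\{f,g\}=(-1)^{\tilde a(\tilde f+1)}\frac{\partial f}{\partial p_a}\frac{\partial g}{\partial x^a}-(-1)^{\tilde a\tilde f}\frac{\partial f}{\partial x^a}\frac{\partial g}{\partial p_a}$. For a vector field $X=X^a\partial_a$, $p_X=X^ap_a$. A Schouten tensor for $M$ is an odd fiberwise quadratic function $S$ on $T^*M$ with $\{S,S\}=0$; it specifies the Schouten bracket $\{f,g\}_S=\{f,\{S,g\}\}$ on $M$. A homological vector field is an odd vector field of square zero; a $QS$-structure is a homological vector field together with a Schouten bracket of which it is a derivation. Correspondences: a quadratic homological field on $\Pi V$ corresponds to the Lie bracket on $V$ determined by $i_{[X,Y]}=[i_X,[\hat Q,i_Y]]$, $i_X=(-1)^{\tilde X}X^i\partial/\partial\xi^i$. A linear Schouten bracket on $\Pi V$ corresponds to a Lie bracket on $V^*$ (elements of $V^*$ being regarded, after parity shift, as linear functions on $\Pi V$), equivalently, by duality, to a cobracket $V\to\wedge^2V$. A Lie bialgebra is a Lie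 algebra $\mathfrak g$ with a Lie bracket on $\mathfrak g^*$ such that the map $\delta:\mathfrak g\to\wedge^2\mathfrak g$ dual to that bracket is a $1$-cocycle of $\mathfrak g$ w.r.t. $\wedge^2\mathrm{ad}$ (equivalently, a $QS$-structure on $\Pi\mathfrak g$ consisting of a quadratic homological vector field and a linear Schouten bracket). Drinfeld's double is the Lie bialgebra $\mathfrak d=\mathfrak g\oplus\mathfrak g^*$ uniquely described by: $\mathfrak g$ and $\mathfrak g^*$ are Lie subalgebras; the natural inner product is $\mathrm{ad}$-invariant; the cobracket is the coboundary of $e_i\wedge e^i\in\wedge^2(\mathfrak g\oplus\mathfrak g^* )$ ($e^i$ the dual basis). For purely even $\mathfrak g$, with structure constants $c_{ij}^k$ of $\mathfrak g$ and $b^{ij}_k$ of $\mathfrak g^*$, the cobracket is $\delta(e_i)=b_i^{jk}e_j\wedge e_k$, $\delta(e^i)=-c^i_{jk}e^j\wedge e^k$; through the natural inner product it gives rise to the second bracket on $\mathfrak d$: $[e_i,e_j]_{(2)}=-c_{ij}^ke_k$, $[e^i,e^j]_{(2)}=b^{ij}_ke^k$, $[e_i,e^j]_{(2)}=0$.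
   Formalization: With the duality implied by [e^i,e^j]_(2)=b^{ij}_k e^k, the Schouten bracket of S_D=½{Q_D,r} corresponds to minus the double's cobracket; the claim is stated with the opposite duality sign, (u⊗v)(a⊗b)=u(v(a)b), between brackets on V* and cobrackets on V. *)

theory Defs
  imports "HOL-Analysis.Analysis"
begin

section \<open>Functions on superdomains\<close>

text \<open>
  Parities are natural numbers read modulo 2. A superdomain is given by a finite index type of
  its coordinates and a parity function \<^term>\<open>p\<close> on it. The order on the index type only fixes
  the order of the factors in the monomials $\theta_A$ below.

  In \<^term>\<open>f = Sfun F\<close>, the function \<^term>\<open>F A\<close> is the coefficient of
  $\theta_A = \prod_{a \in A} x^a$ (factors in increasing order), \<^term>\<open>A\<close> a set of odd
  coordinates. The ring structure is put on all families of coefficients; the functions on the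
  superdomain are singled out by \<open>cinf\<close>.
\<close>

typedef ('c::finite) sfun = "UNIV :: ('c set \<Rightarrow> real ^ 'c \<Rightarrow> real) set"
  morphisms coef Sfun by simp

lemma coef_Sfun [simp]: "coef (Sfun F) = F"
  by (simp add: Sfun_inverse)

lemma sfun_eqI: "(\<And>A x. coef f A x = coef g A x) \<Longrightarrow> f = g"
  by (metis coef_inverse ext)

definition inversions :: "'c::linorder set \<Rightarrow> 'c set \<Rightarrow> nat" where
  "inversions A B = card {(a, b). a \<in> A \<and> b \<in> B \<and> b < a}"

lemma inversions_Un_left:
  fixes A B C :: "'c::{finite,linorder} set"
  assumes "A \<inter> B = {}"
  shows "inversions (A \<union> B) C = inversions A C + inversions B C"
proof -
  have "{(a, b). a \<in> A \<union> B \<and> b \<in> C \<and> b < a} =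
      {(a, b). a \<in> A \<and> b \<in> C \<and> b < a} \<union> {(a, b). a \<in> B \<and> b \<in> C \<and> b < a}"
    by auto
  then show ?thesis
    unfolding inversions_def using assms by (simp add: card_Un_disjoint disjoint_iff)
qed

lemma inversions_Un_right:
  fixes A B C :: "'c::{finite,linorder} set"
  assumes "B \<inter> C = {}"
  shows "inversions A (B \<union> C) = inversions A B + inversions A C"
proof -
  have "{(a, b). a \<in> A \<and> b \<in> B \<union> C \<and> b < a} =
      {(a, b). a \<in> A \<and> b \<in> B \<and> b < a} \<union> {(a, b). a \<in> A \<and> b \<in> C \<and> b < a}"
    by auto
  then show ?thesis
    unfolding inversions_def using assms by (simp add: card_Un_disjoint disjoint_iff)
qed

lemma inversions_empty [simp]: "inversions {} B = 0" "inversions A {} = 0"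
  by (simp_all add: inversions_def)

instantiation sfun :: ("{finite,linorder}") real_algebra_1
begin

definition "0 = Sfun (\<lambda>A x. 0)"

definition "1 = Sfun (\<lambda>A x. if A = {} then 1 else 0)"

definition "f + g = Sfun (\<lambda>A x. coef f A x + coef g A x)"

definition "- f = Sfun (\<lambda>A x. - coef f A x)"

definition "f - g = Sfun (\<lambda>A x. coef f A x - coef g A x)"

definition "c *\<^sub>R f = Sfun (\<lambda>A x. c * coef f A x)"

definition "f * g = Sfun (\<lambda>A x.
  \<Sum>B\<in>Pow A. (-1) ^ inversions B (A - B) * coef f B x * coef g (A - B) x)"

lemma sfun_mult_assoc: "(f * g) * h = f * (g * h)" for f g h :: "'a sfun"
proof (rule sfun_eqI)
  fix A :: "'a set" and x
  let ?s = "\<lambda>B C. (-1 :: real) ^ inversions B C"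
  have "coef ((f * g) * h) A x =
      (\<Sum>(C, B)\<in>Sigma (Pow A) Pow. ?s C (A - C) * ?s B (C - B) *
        coef f B x * coef g (C - B) x * coef h (A - C) x)"
    by (simp add: times_sfun_def sum_distrib_left sum_distrib_right sum.Sigma mult.assoc)
  also have "\<dots> = (\<Sum>(B, D)\<in>Sigma (Pow A) (\<lambda>B. Pow (A - B)). ?s B (A - B) * ?s D (A - B - D) *
        coef f B x * coef g D x * coef h (A - B - D) x)"
  proof (rule sum.reindex_bij_witness[where i = "\<lambda>(B, D). (B \<union> D, B)"
        and j = "\<lambda>(C, B). (B, C - B)"], goal_cases)
    case (5 a)
    then obtain C B where a: "a = (C, B)" and sub: "B \<subseteq> C" "C \<subseteq> A" by auto
    have "inversions C (A - C) = inversions B (A - C) + inversions (C - B) (A - C)"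
      using inversions_Un_left[of B "C - B" "A - C"] sub by (simp add: Un_absorb1)
    moreover have "inversions B (A - B) = inversions B (C - B) + inversions B (A - C)"
    proof -
      have "A - B = (C - B) \<union> (A - C)" using sub by auto
      then show ?thesis using inversions_Un_right[of "C - B" "A - C" B]
        by (simp add: disjoint_iff)
    qed
    moreover have "A - B - (C - B) = A - C" using sub by auto
    ultimately show ?case by (simp add: a power_add)
  qed auto
  also have "\<dots> = coef (f * (g * h)) A x"
    by (simp add: times_sfun_def sum_distrib_left sum.Sigma mult_ac)
  finally show "coef ((f * g) * h) A x = coef (f * (g * h)) A x" .
qed

lemma sfun_mult_1_left: "1 * f = f" for f :: "'a sfun"
proof (rule sfun_eqI)
  fix A :: "'a set" and x
  have "coef (1 * f) A x = (\<Sum>B\<in>Pow A. if B = {} then coef f A x else 0)"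
    unfolding times_sfun_def one_sfun_def coef_Sfun by (rule sum.cong) auto
  then show "coef (1 * f) A x = coef f A x" by simp
qed

lemma sfun_mult_1_right: "f * 1 = f" for f :: "'a sfun"
proof (rule sfun_eqI)
  fix A :: "'a set" and x
  have "coef (f * 1) A x = (\<Sum>B\<in>Pow A. if B = A then coef f A x else 0)"
    unfolding times_sfun_def one_sfun_def coef_Sfun
    by (rule sum.cong) (auto simp: Diff_eq_empty_iff)
  then show "coef (f * 1) A x = coef f A x" by simp
qed

instance
proof
  fix f g h :: "'a sfun"
  show "f * g * h = f * (g * h)" by (rule sfun_mult_assoc)
  show "1 * f = f" by (rule sfun_mult_1_left)
  show "f * 1 = f" by (rule sfun_mult_1_right)
  have "coef (0 :: 'a sfun) {} 0 \<noteq> coef 1 {} 0" by (simp add: zero_sfun_def one_sfun_def)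
  then show "(0 :: 'a sfun) \<noteq> 1" by metis
qed (rule sfun_eqI; simp add: zero_sfun_def plus_sfun_def uminus_sfun_def minus_sfun_def
       scaleR_sfun_def times_sfun_def algebra_simps sum_distrib_left sum.distrib)+

end

coinductive smooth :: "(real ^ 'c \<Rightarrow> real) \<Rightarrow> bool" where
  "(\<forall>x. \<phi> differentiable at x) \<Longrightarrow>
   (\<forall>a. smooth (\<lambda>x. frechet_derivative \<phi> (at x) (axis a 1))) \<Longrightarrow> smooth \<phi>"

definition cinf :: "('c::{finite,linorder} \<Rightarrow> nat) \<Rightarrow> 'c sfun set" where
  "cinf p = {f. \<forall>A. smooth (coef f A)
     \<and> (\<forall>x. coef f A x \<noteq> 0 \<longrightarrow> A \<subseteq> {a. odd (p a)})
     \<and> (\<forall>x y. (\<forall>a. even (p a) \<longrightarrow> x $ a = y $ a) \<longrightarrow> coef f A x = coef f A y)}"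

definition crd :: "('c::{finite,linorder} \<Rightarrow> nat) \<Rightarrow> 'c \<Rightarrow> 'c sfun" where
  "crd p a = Sfun (\<lambda>A x. if odd (p a) then (if A = {a} then 1 else 0)
                            else (if A = {} then x $ a else 0))"

definition has_parity :: "nat \<Rightarrow> 'c::{finite,linorder} sfun \<Rightarrow> bool" where
  "has_parity e f \<longleftrightarrow> (\<forall>A x. coef f A x \<noteq> 0 \<longrightarrow> even (card A + e))"

definition parity_part :: "nat \<Rightarrow> 'c::{finite,linorder} sfun \<Rightarrow> 'c sfun" where
  "parity_part e f = Sfun (\<lambda>A x. if even (card A + e) then coef f A x else 0)"

text \<open>Left partial derivatives.\<close>

definition pd :: "('c::{finite,linorder} \<Rightarrow> nat) \<Rightarrow> 'c \<Rightarrow> 'c sfun \<Rightarrow> 'c sfun" where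
  "pd p a f = Sfun (\<lambda>A x.
     if odd (p a) then (if a \<in> A then 0 else (-1) ^ card {b \<in> A. b < a} * coef f (insert a A) x)
     else frechet_derivative (coef f A) (at x) (axis a 1))"


section \<open>Vector fields\<close>

text \<open>The vector field $X = X^a \partial_a$ is given by its components $X^a$.\<close>

definition vact :: "('c::{finite,linorder} \<Rightarrow> nat) \<Rightarrow> ('c \<Rightarrow> 'c sfun) \<Rightarrow> 'c sfun \<Rightarrow> 'c sfun" where
  "vact p X f = (\<Sum>a\<in>UNIV. X a * pd p a f)"

definition vector_field :: "('c::{finite,linorder} \<Rightarrow> nat) \<Rightarrow> nat \<Rightarrow> ('c \<Rightarrow> 'c sfun) \<Rightarrow> bool" where
  "vector_field p e X \<longleftrightarrow> (\<forall>a. X a \<in> cinf p \<and> has_parity (e + p a) (X a))"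

text \<open>Graded commutator of vector fields of parities \<^term>\<open>e\<close> and \<^term>\<open>e'\<close>.\<close>

definition vcomm :: "('c::{finite,linorder} \<Rightarrow> nat) \<Rightarrow>
    nat \<Rightarrow> ('c \<Rightarrow> 'c sfun) \<Rightarrow> nat \<Rightarrow> ('c \<Rightarrow> 'c sfun) \<Rightarrow> 'c \<Rightarrow> 'c sfun" where
  "vcomm p e X e' Y = (\<lambda>a. vact p X (Y a) - (-1) ^ (e * e') *\<^sub>R vact p Y (X a))"

definition homological :: "('c::{finite,linorder} \<Rightarrow> nat) \<Rightarrow> ('c \<Rightarrow> 'c sfun) \<Rightarrow> bool" where
  "homological p X \<longleftrightarrow> vector_field p 1 X \<and> (\<forall>f\<in>cinf p. vact p X (vact p X f) = 0)"


section \<open>Cotangent bundles\<close>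

text \<open>On $T^*M$ the coordinate $x^a$ has index \<^term>\<open>Inl a\<close>, its momentum $p_a$ has index
  \<^term>\<open>Inr a\<close>. The order makes pullback from \<open>M\<close> compatible with the monomials $\theta_A$.\<close>

instantiation sum :: (linorder, linorder) linorder
begin

definition
  "s \<le> t \<longleftrightarrow> (case s of
     Inl a \<Rightarrow> (case t of Inl a' \<Rightarrow> a \<le> a' | Inr _ \<Rightarrow> True)
   | Inr b \<Rightarrow> (case t of Inl _ \<Rightarrow> False | Inr b' \<Rightarrow> b \<le> b'))"

definition
  "s < t \<longleftrightarrow> s \<le> t \<and> \<not> t \<le> s" for s t :: "'a + 'b"

instance
  by standard (auto simp: less_eq_sum_def less_sum_def split: sum.splits)

end

definition ct :: "('c \<Rightarrow> nat) \<Rightarrow> 'c + 'c \<Rightarrow> nat" where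
  "ct p = case_sum p p"

abbreviation pos :: "('c::{finite,linorder} \<Rightarrow> nat) \<Rightarrow> 'c \<Rightarrow> ('c + 'c) sfun" where
  "pos p a \<equiv> crd (ct p) (Inl a)"

abbreviation mom :: "('c::{finite,linorder} \<Rightarrow> nat) \<Rightarrow> 'c \<Rightarrow> ('c + 'c) sfun" where
  "mom p a \<equiv> crd (ct p) (Inr a)"

definition pull :: "'c::{finite,linorder} sfun \<Rightarrow> ('c + 'c) sfun" where
  "pull f = Sfun (\<lambda>A x. if A \<subseteq> range Inl then coef f (Inl -` A) (\<chi> a. x $ Inl a) else 0)"

definition zero_section :: "('c::{finite,linorder} + 'c) sfun \<Rightarrow> 'c sfun" where
  "zero_section h = Sfun (\<lambda>A x. coef h (Inl ` A) (\<chi> c. case_sum (\<lambda>a. x $ a) (\<lambda>_. 0) c))"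

text \<open>The formula for $\{f,g\}$ involves the parity of \<^term>\<open>f\<close>; it is extended by linearity
  to inhomogeneous \<^term>\<open>f\<close>.\<close>

definition poisson :: "('c::{finite,linorder} \<Rightarrow> nat) \<Rightarrow>
    ('c + 'c) sfun \<Rightarrow> ('c + 'c) sfun \<Rightarrow> ('c + 'c) sfun" where
  "poisson p f g = (\<Sum>e\<in>{0, 1}. \<Sum>a\<in>UNIV.
      (-1) ^ (p a * (e + 1)) *\<^sub>R
        (pd (ct p) (Inr a) (parity_part e f) * pd (ct p) (Inl a) g)
    - (-1) ^ (p a * e) *\<^sub>R
        (pd (ct p) (Inl a) (parity_part e f) * pd (ct p) (Inr a) g))"

text \<open>The function $p_X$ of a vector field \<open>X\<close> on \<open>M\<close>, and the vector field
  $X_H = \{H, \cdot\}$ of a function \<open>H\<close> on $T^*M$.\<close>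

definition ham :: "('c::{finite,linorder} \<Rightarrow> nat) \<Rightarrow> ('c \<Rightarrow> 'c sfun) \<Rightarrow> ('c + 'c) sfun" where
  "ham p X = (\<Sum>a\<in>UNIV. pull (X a) * mom p a)"

definition ham_field :: "('c::{finite,linorder} \<Rightarrow> nat) \<Rightarrow>
    ('c + 'c) sfun \<Rightarrow> 'c + 'c \<Rightarrow> ('c + 'c) sfun" where
  "ham_field p H = (\<lambda>c. poisson p H (crd (ct p) c))"

definition fiberwise_quadratic ::
    "('c::{finite,linorder} \<Rightarrow> nat) \<Rightarrow> ('c + 'c) sfun \<Rightarrow> bool" where
  "fiberwise_quadratic p S \<longleftrightarrow> (\<exists>s. (\<forall>a b. s a b \<in> cinf p)
     \<and> S = (\<Sum>a\<in>UNIV. \<Sum>b\<in>UNIV. pull (s a b) * mom p a * mom p b))"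

definition schouten_tensor :: "('c::{finite,linorder} \<Rightarrow> nat) \<Rightarrow> ('c + 'c) sfun \<Rightarrow> bool" where
  "schouten_tensor p S \<longleftrightarrow> S \<in> cinf (ct p) \<and> has_parity 1 S \<and> fiberwise_quadratic p S
     \<and> poisson p S S = 0"

text \<open>For fiberwise quadratic \<open>S\<close> the function $\{f, \{S, g\}\}$ is independent of the momenta;
  restricting it to the zero section gives the function on \<open>M\<close> whose pullback it is.\<close>

definition schouten_bracket :: "('c::{finite,linorder} \<Rightarrow> nat) \<Rightarrow>
    ('c + 'c) sfun \<Rightarrow> 'c sfun \<Rightarrow> 'c sfun \<Rightarrow> 'c sfun" where
  "schouten_bracket p S f g = zero_section (poisson p (pull f) (poisson p S (pull g)))"

text \<open>The bracket \<open>{f,g}\<^sub>S\<close> is odd, so an odd derivation passes \<open>f\<close> with the sign of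
  the shifted parity of \<open>f\<close>.\<close>

definition odd_derivation :: "('c::{finite,linorder} \<Rightarrow> nat) \<Rightarrow>
    ('c \<Rightarrow> 'c sfun) \<Rightarrow> ('c + 'c) sfun \<Rightarrow> bool" where
  "odd_derivation p X S \<longleftrightarrow> (\<forall>e. \<forall>f\<in>cinf p. \<forall>g\<in>cinf p. has_parity e f \<longrightarrow>
     vact p X (schouten_bracket p S f g) =
       schouten_bracket p S (vact p X f) g
       + (-1) ^ (e + 1) *\<^sub>R schouten_bracket p S f (vact p X g))"

definition qs_structure :: "('c::{finite,linorder} \<Rightarrow> nat) \<Rightarrow>
    ('c \<Rightarrow> 'c sfun) \<Rightarrow> ('c + 'c) sfun \<Rightarrow> bool" where
  "qs_structure p X S \<longleftrightarrow> homological p X \<and> schouten_tensor p S \<and> odd_derivation p X S"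


section \<open>Lie superalgebras and Lie bialgebras\<close>

text \<open>A super vector space with basis $e_i$ of parity \<^term>\<open>p i\<close> is \<^typ>\<open>real ^ 'c\<close>. Elements
  of its dual are also given by vectors, with respect to the dual basis $e^i(e_j) = \delta^i_j$.\<close>

definition vec_parity :: "('c::finite \<Rightarrow> nat) \<Rightarrow> nat \<Rightarrow> real ^ 'c \<Rightarrow> bool" where
  "vec_parity p e X \<longleftrightarrow> (\<forall>i. X $ i \<noteq> 0 \<longrightarrow> even (p i + e))"

definition lie_super :: "('c::finite \<Rightarrow> nat) \<Rightarrow> (real ^ 'c \<Rightarrow> real ^ 'c \<Rightarrow> real ^ 'c) \<Rightarrow> bool" where
  "lie_super p br \<longleftrightarrow> bilinear br
     \<and> (\<forall>a b X Y. vec_parity p a X \<and> vec_parity p b Y \<longrightarrow>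
          vec_parity p (a + b) (br X Y) \<and> br X Y = - ((-1) ^ (a * b) *\<^sub>R br Y X))
     \<and> (\<forall>a b c X Y Z. vec_parity p a X \<and> vec_parity p b Y \<and> vec_parity p c Z \<longrightarrow>
          br X (br Y Z) = br (br X Y) Z + (-1) ^ (a * b) *\<^sub>R br Y (br X Z))"

definition tensor :: "real ^ 'c \<Rightarrow> real ^ 'c \<Rightarrow> real ^ 'c ^ 'c" where
  "tensor X Y = (\<chi> i j. X $ i * Y $ j)"

definition ad_tensor :: "('c::finite \<Rightarrow> nat) \<Rightarrow> (real ^ 'c \<Rightarrow> real ^ 'c \<Rightarrow> real ^ 'c) \<Rightarrow>
    real ^ 'c \<Rightarrow> real ^ 'c ^ 'c \<Rightarrow> real ^ 'c ^ 'c" where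
  "ad_tensor p br X t = (\<Sum>a\<in>UNIV. \<Sum>i\<in>UNIV. \<Sum>j\<in>UNIV. (X $ a * t $ i $ j) *\<^sub>R
     (tensor (br (axis a 1) (axis i 1)) (axis j 1)
      + (-1) ^ (p a * p i) *\<^sub>R tensor (axis i 1) (br (axis a 1) (axis j 1))))"

text \<open>
  The cobracket $\delta : V \to \wedge^2 V \subset V \otimes V$ dual to a bracket on $V^*$:
  $[u,v](X) = (u \otimes v)(\delta X)$, where adjacent factors are contracted,
  $(u \otimes v)(a \otimes b) = u(v(a)\,b)$, so that no signs occur. Equivalently, the Schouten
  tensor $\frac12 \xi^l S_l^{nm} \xi_m \xi_n$ has the cobracket
  $e_l \mapsto S_l^{nm}\, e_m \wedge e_n$ when all \<open>e\<^sub>i\<close> are even, with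
  $a \wedge b = \frac12 (a \otimes b - b \otimes a)$.
  This dictionary also takes $\pi_i \pi^i$ to $e_i \wedge e^i$ for the double. Contracting in
  the other order changes the sign of $\delta$.
\<close>

definition dual_cobracket :: "(real ^ 'c \<Rightarrow> real ^ 'c \<Rightarrow> real ^ 'c) \<Rightarrow>
    real ^ 'c \<Rightarrow> real ^ 'c ^ 'c" where
  "dual_cobracket brs X = (\<chi> i j. brs (axis j 1) (axis i 1) \<bullet> X)"

text \<open>\<^term>\<open>br\<close> is the bracket on \<open>V\<close>, \<^term>\<open>brs\<close> the bracket on the dual of \<open>V\<close>.\<close>

definition lie_bialgebra :: "('c::finite \<Rightarrow> nat) \<Rightarrow>
    (real ^ 'c \<Rightarrow> real ^ 'c \<Rightarrow> real ^ 'c) \<Rightarrow> (real ^ 'c \<Rightarrow> real ^ 'c \<Rightarrow> real ^ 'c) \<Rightarrow> bool" where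
  "lie_bialgebra p br brs \<longleftrightarrow> lie_super p br \<and> lie_super p brs
     \<and> (\<forall>a b X Y. vec_parity p a X \<and> vec_parity p b Y \<longrightarrow>
          dual_cobracket brs (br X Y) =
            ad_tensor p br X (dual_cobracket brs Y)
            - (-1) ^ (a * b) *\<^sub>R ad_tensor p br Y (dual_cobracket brs X))"


section \<open>Lie brackets as functions and vector fields on the parity shift\<close>

definition shift :: "('c \<Rightarrow> nat) \<Rightarrow> 'c \<Rightarrow> nat" where
  "shift p = (\<lambda>i. p i + 1)"

text \<open>
  In the following definitions a superdomain with coordinates $x^i$ of parity
  \<^term>\<open>shift p i\<close> is identified with $\Pi V$ by means of signs \<^term>\<open>t i\<close>: the linear
  coordinate on $\Pi V$ given by the element $e^i$ of the dual basis is \<open>t i\<close> times $x^i$.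
\<close>

definition contraction ::
    "('c::{finite,linorder} \<Rightarrow> real) \<Rightarrow> nat \<Rightarrow> (real, 'c) vec \<Rightarrow> 'c \<Rightarrow> 'c sfun" where
  "contraction t e X = (\<lambda>i. ((-1) ^ e * X $ i / t i) *\<^sub>R 1)"

definition field_gives_lie :: "('c::{finite,linorder} \<Rightarrow> nat) \<Rightarrow> ('c \<Rightarrow> real) \<Rightarrow>
    ('c \<Rightarrow> 'c sfun) \<Rightarrow> ((real, 'c) vec \<Rightarrow> (real, 'c) vec \<Rightarrow> (real, 'c) vec) \<Rightarrow> bool" where
  "field_gives_lie p t Q br \<longleftrightarrow> bilinear br
     \<and> (\<forall>a b X Y. vec_parity p a X \<and> vec_parity p b Y \<longrightarrow>
          contraction t (a + b) (br X Y) =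
            vcomm (shift p) (a + 1) (contraction t a X)
              b (vcomm (shift p) 1 Q (b + 1) (contraction t b Y)))"

definition linear_function :: "('c::{finite,linorder} \<Rightarrow> nat) \<Rightarrow> ('c \<Rightarrow> real) \<Rightarrow>
    (real, 'c) vec \<Rightarrow> 'c sfun" where
  "linear_function p t u = (\<Sum>i\<in>UNIV. (u $ i * t i) *\<^sub>R crd (shift p) i)"

definition schouten_gives_lie :: "('c::{finite,linorder} \<Rightarrow> nat) \<Rightarrow> ('c \<Rightarrow> real) \<Rightarrow>
    ('c + 'c) sfun \<Rightarrow> ((real, 'c) vec \<Rightarrow> (real, 'c) vec \<Rightarrow> (real, 'c) vec) \<Rightarrow> bool" where
  "schouten_gives_lie p t S brs \<longleftrightarrow> bilinear brs
     \<and> (\<forall>u v. schouten_bracket (shift p) S (linear_function p t u) (linear_function p t v)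
              = linear_function p t (brs u v))"


section \<open>Drinfeld's double\<close>

text \<open>In \<open>d = g \<oplus> g*\<close> the basis vector $e_i$ has index \<^term>\<open>Inl i\<close>, and $e^i$ has index
  \<^term>\<open>Inr i\<close>; the parities are \<^term>\<open>ct p\<close>.\<close>

definition incl :: "real ^ 'i \<Rightarrow> real ^ ('i + 'i)" where
  "incl X = (\<chi> c. case_sum (\<lambda>i. X $ i) (\<lambda>_. 0) c)"

definition incl_dual :: "real ^ 'i \<Rightarrow> real ^ ('i + 'i)" where
  "incl_dual u = (\<chi> c. case_sum (\<lambda>_. 0) (\<lambda>i. u $ i) c)"

text \<open>The supersymmetric pairing with $\langle e^i, e_j\rangle = \delta^i_j$.\<close>

definition double_inner ::
    "('i::finite \<Rightarrow> nat) \<Rightarrow> real ^ ('i + 'i) \<Rightarrow> real ^ ('i + 'i) \<Rightarrow> real" where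
  "double_inner p X Y =
     (\<Sum>i\<in>UNIV. X $ Inr i * Y $ Inl i + (-1) ^ (p i * p i) * (X $ Inl i * Y $ Inr i))"

text \<open>$e_i \wedge e^i$\<close>

definition double_r :: "('i::finite \<Rightarrow> nat) \<Rightarrow> real ^ ('i + 'i) ^ ('i + 'i)" where
  "double_r p = (\<Sum>i\<in>UNIV. (1/2) *\<^sub>R
     (tensor (axis (Inl i) 1) (axis (Inr i) 1)
      - (-1) ^ (p i * p i) *\<^sub>R tensor (axis (Inr i) 1) (axis (Inl i) 1)))"

definition drinfeld_double :: "('i::finite \<Rightarrow> nat) \<Rightarrow>
    (real ^ 'i \<Rightarrow> real ^ 'i \<Rightarrow> real ^ 'i) \<Rightarrow> (real ^ 'i \<Rightarrow> real ^ 'i \<Rightarrow> real ^ 'i) \<Rightarrow>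
    (real ^ ('i + 'i) \<Rightarrow> real ^ ('i + 'i) \<Rightarrow> real ^ ('i + 'i)) \<Rightarrow>
    (real ^ ('i + 'i) \<Rightarrow> real ^ ('i + 'i) \<Rightarrow> real ^ ('i + 'i)) \<Rightarrow> bool" where
  "drinfeld_double p br brs brD brDs \<longleftrightarrow>
     lie_bialgebra (ct p) brD brDs
     \<and> (\<forall>X Y. brD (incl X) (incl Y) = incl (br X Y))
     \<and> (\<forall>u v. brD (incl_dual u) (incl_dual v) = incl_dual (brs u v))
     \<and> (\<forall>a b X Y Z. vec_parity (ct p) a Z \<and> vec_parity (ct p) b X \<longrightarrow>
          double_inner p (brD Z X) Y + (-1) ^ (a * b) * double_inner p X (brD Z Y) = 0)
     \<and> (\<forall>X. dual_cobracket brDs X = ad_tensor (ct p) brD X (double_r p))"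

text \<open>
  The identification of $T^*\Pi g$ with $\Pi(g \oplus g^*)$: the linear functions
  $\langle e^i, \cdot\rangle$ and $\langle e_i, \cdot\rangle$ correspond to $\xi^i$ and $\xi_i$.
  As $\langle e_i, e^i\rangle = (-1)^{\tilde\imath}$, the linear coordinate dual to $e^i$ is
  $(-1)^{\tilde\imath} \xi_i$.
\<close>

definition double_sign :: "('i \<Rightarrow> nat) \<Rightarrow> 'i + 'i \<Rightarrow> real" where
  "double_sign p = case_sum (\<lambda>_. 1) (\<lambda>i. (-1) ^ p i)"


section \<open>The functions and fields of a Lie bialgebra\<close>

text \<open>In \<^term>\<open>Q i j k\<close> and \<^term>\<open>S l n m\<close> the arguments are the indices of $Q_{ij}^k$ and
  $S_l^{nm}$. Only the parts of these arrays with the appropriate symmetry matter.\<close>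

definition Q_field :: "('i::{finite,linorder} \<Rightarrow> nat) \<Rightarrow> ('i \<Rightarrow> 'i \<Rightarrow> 'i \<Rightarrow> real) \<Rightarrow>
    'i \<Rightarrow> 'i sfun" where
  "Q_field p Q = (\<lambda>k. (1/2) *\<^sub>R
     (\<Sum>i\<in>UNIV. \<Sum>j\<in>UNIV. Q i j k *\<^sub>R (crd (shift p) j * crd (shift p) i)))"

definition Q_fun :: "('i::{finite,linorder} \<Rightarrow> nat) \<Rightarrow> ('i \<Rightarrow> 'i \<Rightarrow> 'i \<Rightarrow> real) \<Rightarrow>
    ('i + 'i) sfun" where
  "Q_fun p Q = (1/2) *\<^sub>R (\<Sum>i\<in>UNIV. \<Sum>j\<in>UNIV. \<Sum>k\<in>UNIV.
     Q i j k *\<^sub>R (pos (shift p) j * pos (shift p) i * mom (shift p) k))"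

definition S_fun :: "('i::{finite,linorder} \<Rightarrow> nat) \<Rightarrow> ('i \<Rightarrow> 'i \<Rightarrow> 'i \<Rightarrow> real) \<Rightarrow>
    ('i + 'i) sfun" where
  "S_fun p S = (1/2) *\<^sub>R (\<Sum>l\<in>UNIV. \<Sum>n\<in>UNIV. \<Sum>m\<in>UNIV.
     S l n m *\<^sub>R (pos (shift p) l * mom (shift p) m * mom (shift p) n))"

definition QD_field :: "('i::{finite,linorder} \<Rightarrow> nat) \<Rightarrow> ('i \<Rightarrow> 'i \<Rightarrow> 'i \<Rightarrow> real) \<Rightarrow>
    ('i \<Rightarrow> 'i \<Rightarrow> 'i \<Rightarrow> real) \<Rightarrow> 'i + 'i \<Rightarrow> ('i + 'i) sfun" where
  "QD_field p Q S = ham_field (shift p) (Q_fun p Q + S_fun p S)"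

definition QD_fun :: "('i::{finite,linorder} \<Rightarrow> nat) \<Rightarrow> ('i \<Rightarrow> 'i \<Rightarrow> 'i \<Rightarrow> real) \<Rightarrow>
    ('i \<Rightarrow> 'i \<Rightarrow> 'i \<Rightarrow> real) \<Rightarrow> (('i + 'i) + ('i + 'i)) sfun" where
  "QD_fun p Q S = ham (ct (shift p)) (QD_field p Q S)"

text \<open>$\pi_i$ is the momentum of $\xi^i$, and $\pi^i$ is the momentum of $\xi_i$.\<close>

definition r_fun :: "('i::{finite,linorder} \<Rightarrow> nat) \<Rightarrow> (('i + 'i) + ('i + 'i)) sfun" where
  "r_fun p = (\<Sum>i\<in>UNIV. mom (ct (shift p)) (Inl i) * mom (ct (shift p)) (Inr i))"

definition SD_fun :: "('i::{finite,linorder} \<Rightarrow> nat) \<Rightarrow> ('i \<Rightarrow> 'i \<Rightarrow> 'i \<Rightarrow> real) \<Rightarrow>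
    ('i \<Rightarrow> 'i \<Rightarrow> 'i \<Rightarrow> real) \<Rightarrow> (('i + 'i) + ('i + 'i)) sfun" where
  "SD_fun p Q S = (1/2) *\<^sub>R poisson (ct (shift p)) (QD_fun p Q S) (r_fun p)"

end

theory Submission
  imports Defs
begin

text \<open>
  Put $H = Q + S$. The hypotheses amount to $\{H, H\} = 0$ on $T^*\Pi g$, so $X_H$ is homological
  and $\{Q_D, Q_D\} = 0$; the Jacobi identity gives $\{Q_D, \{Q_D, r\}\} = 0$, which is the derivation
  property of $S_D$. Up to signs, the structure constants of the double are the third partial
  derivatives of $H$, and both the skew symmetry of the bracket and the invariance of the inner
  product express the graded symmetry of these derivatives. On coordinates the bracket of $S_D$ is
  given by second derivatives of $H$: it is the negative of the bracket of $S$ on the $\xi^i$, it is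
  the bracket of $g$ on the $\xi_i$, and it vanishes on mixed arguments. Being a direct sum of two Lie
  brackets, it satisfies the Jacobi identity, whence $\{S_D, S_D\} = 0$; and comparing third
  derivatives of $H$ identifies the cobracket with the coboundary of $e_i \wedge e^i$, so that the
  cocycle condition is automatic.
\<close>

section \<open>Smooth functions\<close>

text \<open>By the Jacobi identity {S_D, S_D} is a quarter of {Q_D, {r, {Q_D, r}}}, but r satisfies
  only a modified classical Yang-Baxter equation, so {r, {Q_D, r}} need not vanish. This is why the
  argument returns from the Lie bracket that S_D defines on linear functions to the tensor itself.
  The tool for every such return is Euler's identity along the fibers: a function homogeneous of
  positive degree in the momenta vanishes as soon as its momentum derivatives do, and these are, up
  to sign, brackets with base coordinates. The factor 1/2 in S_D has its origin in {Q_D, r}: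
  bracketed with two coordinates it yields two terms, each a second derivative of H up to sign,
  which agree when both coordinates are of the type xi^i or both of the type xi_i, and cancel in the
  mixed case. Coefficients are arbitrary smooth functions of the even coordinates, so the calculus
  rests on the symmetry of mixed partial derivatives. The claim about every double reduces to one
  explicit double, because the double is unique.\<close>

lemma smooth_differentiable: "smooth \<phi> \<Longrightarrow> \<phi> differentiable at x"
  by (auto elim: smooth.cases)

lemma smooth_partial: "smooth \<phi> \<Longrightarrow> smooth (\<lambda>x. frechet_derivative \<phi> (at x) (axis a 1))"
  by (auto elim: smooth.cases)

lemma smooth_has_derivative:
  "smooth \<phi> \<Longrightarrow> (\<phi> has_derivative frechet_derivative \<phi> (at x)) (at x)"
  using smooth_differentiable frechet_derivative_works by blast

lemma frechet_derivative_add: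
  fixes f g :: "real ^ 'c \<Rightarrow> real"
  assumes "f differentiable at x" "g differentiable at x"
  shows "frechet_derivative (\<lambda>x. f x + g x) (at x) v
    = frechet_derivative f (at x) v + frechet_derivative g (at x) v"
proof -
  have "((\<lambda>x. f x + g x) has_derivative
      (\<lambda>v. frechet_derivative f (at x) v + frechet_derivative g (at x) v)) (at x)"
    using assms by (auto intro!: derivative_eq_intros simp: frechet_derivative_works)
  from frechet_derivative_at[OF this] show ?thesis by metis
qed

lemma frechet_derivative_mult:
  fixes f g :: "real ^ 'c \<Rightarrow> real"
  assumes "f differentiable at x" "g differentiable at x"
  shows "frechet_derivative (\<lambda>x. f x * g x) (at x) v
    = frechet_derivative f (at x) v * g x + f x * frechet_derivative g (at x) v"
proof -
  have "((\<lambda>x. f x * g x) has_derivative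
      (\<lambda>v. frechet_derivative f (at x) v * g x + f x * frechet_derivative g (at x) v)) (at x)"
    using assms by (auto intro!: derivative_eq_intros simp: frechet_derivative_works add.commute)
  from frechet_derivative_at[OF this] show ?thesis by metis
qed

lemma frechet_derivative_cmult:
  fixes f :: "real ^ 'c \<Rightarrow> real"
  assumes "f differentiable at x"
  shows "frechet_derivative (\<lambda>x. c * f x) (at x) v = c * frechet_derivative f (at x) v"
  using frechet_derivative_mult[of "\<lambda>x. c" x f v] assms by simp

text \<open>The derivative of a product is only a sum of products, so the coinduction runs over the algebra
  generated by the smooth functions.\<close>

inductive smooth_alg :: "(real ^ 'c \<Rightarrow> real) \<Rightarrow> bool" where
  "smooth f \<Longrightarrow> smooth_alg f"
| "smooth_alg f \<Longrightarrow> smooth_alg g \<Longrightarrow> smooth_alg (\<lambda>x. f x + g x)"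
| "smooth_alg f \<Longrightarrow> smooth_alg g \<Longrightarrow> smooth_alg (\<lambda>x. f x * g x)"

lemma smooth_alg_step:
  "smooth_alg f \<Longrightarrow> (\<forall>x. f differentiable at x) \<and>
     (\<forall>a. smooth_alg (\<lambda>x. frechet_derivative f (at x) (axis a 1)))"
proof (induction rule: smooth_alg.induct)
  case (1 f)
  then show ?case by (auto intro: smooth_differentiable smooth_partial smooth_alg.intros)
next
  case (2 f g)
  then show ?case by (auto simp: frechet_derivative_add intro: smooth_alg.intros)
next
  case (3 f g)
  then show ?case
    by (auto simp: frechet_derivative_mult differentiable_mult intro!: smooth_alg.intros(2,3))
qed

lemma smooth_alg_smooth: "smooth_alg f \<Longrightarrow> smooth f"
  by (coinduction arbitrary: f rule: smooth.coinduct) (use smooth_alg_step in blast)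

lemma smooth_add: "smooth f \<Longrightarrow> smooth g \<Longrightarrow> smooth (\<lambda>x. f x + g x)"
  and smooth_mult: "smooth f \<Longrightarrow> smooth g \<Longrightarrow> smooth (\<lambda>x. f x * g x)"
  by (auto intro: smooth_alg_smooth smooth_alg.intros)

lemma smooth_const [simp]: "smooth (\<lambda>x. c)"
  by (coinduction arbitrary: c rule: smooth.coinduct) auto

lemma smooth_sum: "(\<And>i. i \<in> I \<Longrightarrow> smooth (f i)) \<Longrightarrow> smooth (\<lambda>x. \<Sum>i\<in>I. f i x)"
  by (induction I rule: infinite_finite_induct) (auto intro: smooth_add)

lemma frechet_derivative_sum:
  fixes f :: "'i \<Rightarrow> real ^ 'c \<Rightarrow> real"
  assumes "\<And>i. i \<in> I \<Longrightarrow> f i differentiable at x"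
  shows "frechet_derivative (\<lambda>x. \<Sum>i\<in>I. f i x) (at x) v = (\<Sum>i\<in>I. frechet_derivative (f i) (at x) v)"
  using assms
  by (induction I rule: infinite_finite_induct) (auto simp: frechet_derivative_add)

section \<open>Composition with linear maps\<close>

lemma frechet_derivative_compose_linear:
  fixes \<phi> :: "real ^ 'c \<Rightarrow> real" and L :: "real ^ 'd \<Rightarrow> real ^ 'c"
  assumes "bounded_linear L" "\<phi> differentiable at (L x)"
  shows "frechet_derivative (\<lambda>x. \<phi> (L x)) (at x) v = frechet_derivative \<phi> (at (L x)) (L v)"
proof -
  have "(L has_derivative L) (at x)"
    using assms(1) by (rule bounded_linear_imp_has_derivative)
  from has_derivative_compose[OF this, of \<phi>] assms(2)
  have "((\<lambda>x. \<phi> (L x)) has_derivative (\<lambda>v. frechet_derivative \<phi> (at (L x)) (L v))) (at x)"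
    by (simp add: frechet_derivative_works)
  from frechet_derivative_at[OF this] show ?thesis by metis
qed

lemma differentiable_compose_linear:
  fixes \<phi> :: "real ^ 'c \<Rightarrow> real" and L :: "real ^ 'd \<Rightarrow> real ^ 'c"
  assumes "bounded_linear L" "\<phi> differentiable at (L x)"
  shows "(\<lambda>x. \<phi> (L x)) differentiable at x"
  using assms bounded_linear_imp_differentiable differentiable_compose by blast

text \<open>The condition on \<open>L\<close> makes every partial derivative of a composite with
  \<open>L\<close> either 0 or again a composite of a partial derivative with \<open>L\<close>, so
  the coinduction closes without forming linear combinations. The projection of a cotangent bundle
  to its base is such a map.\<close>

lemma smooth_compose_linear:
  fixes \<phi> :: "real ^ 'c \<Rightarrow> real" and L :: "real ^ 'd \<Rightarrow> real ^ 'c"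
  assumes L: "bounded_linear L" "\<And>d. L (axis d 1) = 0 \<or> (\<exists>c. L (axis d 1) = axis c 1)"
    and "smooth \<phi>"
  shows "smooth (\<lambda>x. \<phi> (L x))"
proof -
  have "smooth f" if "\<exists>\<psi>. smooth \<psi> \<and> f = (\<lambda>x. \<psi> (L x))" for f :: "real ^ 'd \<Rightarrow> real"
    using that
  proof (coinduction arbitrary: f rule: smooth.coinduct)
    case smooth
    then obtain \<psi> where \<psi>: "smooth \<psi>" "f = (\<lambda>x. \<psi> (L x))" by blast
    have "\<exists>\<omega>. smooth \<omega> \<and> (\<lambda>x. frechet_derivative \<psi> (at (L x)) (L (axis d 1))) = (\<lambda>x. \<omega> (L x))" for d
    proof (cases "L (axis d 1) = 0")
      case True
      then have "(\<lambda>x. frechet_derivative \<psi> (at (L x)) (L (axis d 1))) = (\<lambda>x. 0)"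
        using \<psi>(1) by (simp add: linear_frechet_derivative[OF smooth_differentiable] linear_0)
      then show ?thesis by (intro exI[of _ "\<lambda>x. 0"]) simp
    next
      case False
      then obtain c where "L (axis d 1) = axis c 1" using L(2) by blast
      then show ?thesis using smooth_partial[OF \<psi>(1), of c] by auto
    qed
    then show ?case
      using \<psi> L(1)
      by (auto simp: frechet_derivative_compose_linear differentiable_compose_linear
          smooth_differentiable)
  qed
  then show ?thesis using assms(3) by blast
qed

lemma frechet_derivative_nth:
  "frechet_derivative (\<lambda>x :: real ^ 'c. x $ a) (at x) v = v $ a"
proof -
  have "((\<lambda>x :: real ^ 'c. x $ a) has_derivative (\<lambda>v. v $ a)) (at x)"
    by (rule bounded_linear_imp_has_derivative) (rule bounded_linear_vec_nth)
  from frechet_derivative_at[OF this] show ?thesis by metis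
qed

lemma smooth_nth: "smooth (\<lambda>x :: real ^ 'c. x $ a)"
  by (rule smooth.intros)
    (auto simp: frechet_derivative_nth intro!: bounded_linear_imp_differentiable bounded_linear_vec_nth)

section \<open>Symmetry of second partial derivatives\<close>

lemma smooth_continuous: "smooth \<phi> \<Longrightarrow> isCont \<phi> x"
  by (meson differentiable_imp_continuous_within smooth_differentiable)

text \<open>Two applications of the mean value theorem, along \<open>a\<close> and then along
  \<open>b\<close>. The second difference is symmetric in \<open>a\<close> and \<open>b\<close>
  while the derivative on the right is not, which is what forces the mixed partials to
  agree.\<close>

lemma second_difference_mvt:
  fixes \<phi> :: "real ^ 'c \<Rightarrow> real"
  assumes "smooth \<phi>" and "h > 0"
  shows "\<exists>\<xi> \<eta>. 0 < \<xi> \<and> \<xi> < h \<and> 0 < \<eta> \<and> \<eta> < h \<and>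
    \<phi> (x + h *\<^sub>R axis a 1 + h *\<^sub>R axis b 1) - \<phi> (x + h *\<^sub>R axis a 1) - \<phi> (x + h *\<^sub>R axis b 1) + \<phi> x
    = h * (h * frechet_derivative (\<lambda>x. frechet_derivative \<phi> (at x) (axis a 1))
            (at (x + \<xi> *\<^sub>R axis a 1 + \<eta> *\<^sub>R axis b 1)) (axis b 1))"
proof -
  let ?a = "axis a 1 :: real ^ 'c" and ?b = "axis b 1 :: real ^ 'c"
  let ?\<phi>a = "\<lambda>x. frechet_derivative \<phi> (at x) ?a"
  have der: "((\<lambda>s. \<psi> (y + s *\<^sub>R v)) has_real_derivative frechet_derivative \<psi> (at (y + s *\<^sub>R v)) v) (at s)"
    if "smooth \<psi>" for \<psi> :: "real ^ 'c \<Rightarrow> real" and y v s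
  proof -
    have "((\<lambda>s. y + s *\<^sub>R v) has_derivative (\<lambda>t. t *\<^sub>R v)) (at s)"
      by (auto intro!: derivative_eq_intros)
    from has_derivative_compose[OF this smooth_has_derivative[OF that]]
    have "((\<lambda>s. \<psi> (y + s *\<^sub>R v)) has_derivative
        (\<lambda>t. frechet_derivative \<psi> (at (y + s *\<^sub>R v)) (t *\<^sub>R v))) (at s)" .
    moreover have "frechet_derivative \<psi> (at (y + s *\<^sub>R v)) (t *\<^sub>R v)
        = frechet_derivative \<psi> (at (y + s *\<^sub>R v)) v * t" for t
      using linear_frechet_derivative[OF smooth_differentiable[OF that]]
      by (simp add: linear_scale mult.commute)
    ultimately show ?thesis by (simp add: has_field_derivative_def)
  qed
  \<comment> \<open>The difference in direction \<open>b\<close>, as a function of the displacement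
    along \<open>a\<close>; its increment over [0, h] is the second difference.\<close>
  let ?F = "\<lambda>s. \<phi> ((x + h *\<^sub>R ?b) + s *\<^sub>R ?a) - \<phi> (x + s *\<^sub>R ?a)"
  have "\<exists>\<xi>. 0 < \<xi> \<and> \<xi> < h \<and> ?F h - ?F 0 = (h - 0) * (?\<phi>a ((x + h *\<^sub>R ?b) + \<xi> *\<^sub>R ?a) - ?\<phi>a (x + \<xi> *\<^sub>R ?a))"
    using assms by (intro MVT2 DERIV_diff der) auto
  then obtain \<xi> where \<xi>: "0 < \<xi>" "\<xi> < h"
    "?F h - ?F 0 = h * (?\<phi>a ((x + h *\<^sub>R ?b) + \<xi> *\<^sub>R ?a) - ?\<phi>a (x + \<xi> *\<^sub>R ?a))" by auto
  let ?G = "\<lambda>t. ?\<phi>a ((x + \<xi> *\<^sub>R ?a) + t *\<^sub>R ?b)"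
  have "\<exists>\<eta>. 0 < \<eta> \<and> \<eta> < h \<and> ?G h - ?G 0 =
      (h - 0) * frechet_derivative ?\<phi>a (at ((x + \<xi> *\<^sub>R ?a) + \<eta> *\<^sub>R ?b)) ?b"
    using assms by (intro MVT2 der smooth_partial) auto
  then obtain \<eta> where \<eta>: "0 < \<eta>" "\<eta> < h" "?G h - ?G 0 =
      h * frechet_derivative ?\<phi>a (at ((x + \<xi> *\<^sub>R ?a) + \<eta> *\<^sub>R ?b)) ?b" by auto
  have "?F h - ?F 0 = h * (?G h - ?G 0)"
    using \<xi>(3) by (simp add: algebra_simps)
  then have "?F h - ?F 0 = h * (h * frechet_derivative ?\<phi>a (at (x + \<xi> *\<^sub>R ?a + \<eta> *\<^sub>R ?b)) ?b)"
    using \<eta>(3) by simp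
  then show ?thesis using \<xi> \<eta> by (intro exI[of _ \<xi>] exI[of _ \<eta>]) (simp add: algebra_simps)
qed

text \<open>With h = 1/(n+1) the two factors \<open>real (Suc n)\<close> divide by the square of h.
  The intermediate points are squeezed to \<open>x\<close>, and the second partial derivative is
  continuous.\<close>

lemma second_difference_limit:
  fixes \<phi> :: "real ^ 'c \<Rightarrow> real"
  assumes "smooth \<phi>"
  shows "(\<lambda>n. (\<phi> (x + inverse (Suc n) *\<^sub>R axis a 1 + inverse (Suc n) *\<^sub>R axis b 1)
      - \<phi> (x + inverse (Suc n) *\<^sub>R axis a 1) - \<phi> (x + inverse (Suc n) *\<^sub>R axis b 1) + \<phi> x)
      * real (Suc n) * real (Suc n))
    \<longlonglongrightarrow> frechet_derivative (\<lambda>x. frechet_derivative \<phi> (at x) (axis a 1)) (at x) (axis b 1)"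
    (is "?D \<longlonglongrightarrow> ?P x")
proof -
  let ?h = "\<lambda>n. inverse (real (Suc n))"
  have "\<forall>n. \<exists>\<xi> \<eta>. 0 < \<xi> \<and> \<xi> < ?h n \<and> 0 < \<eta> \<and> \<eta> < ?h n \<and>
    ?D n = ?P (x + \<xi> *\<^sub>R axis a 1 + \<eta> *\<^sub>R axis b 1)"
  proof
    fix n
    have "?h n > 0" by simp
    from second_difference_mvt[OF assms this, of x a b]
    obtain \<xi> \<eta> where *: "0 < \<xi>" "\<xi> < ?h n" "0 < \<eta>" "\<eta> < ?h n"
      "\<phi> (x + ?h n *\<^sub>R axis a 1 + ?h n *\<^sub>R axis b 1)
      - \<phi> (x + ?h n *\<^sub>R axis a 1) - \<phi> (x + ?h n *\<^sub>R axis b 1) + \<phi> x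
      = ?h n * (?h n * ?P (x + \<xi> *\<^sub>R axis a 1 + \<eta> *\<^sub>R axis b 1))" by metis
    have "?D n = ?P (x + \<xi> *\<^sub>R axis a 1 + \<eta> *\<^sub>R axis b 1)"
      unfolding *(5) by (simp del: of_nat_Suc add: field_simps)
    then show "\<exists>\<xi> \<eta>. 0 < \<xi> \<and> \<xi> < ?h n \<and> 0 < \<eta> \<and> \<eta> < ?h n \<and>
      ?D n = ?P (x + \<xi> *\<^sub>R axis a 1 + \<eta> *\<^sub>R axis b 1)" using * by blast
  qed
  then obtain \<xi> \<eta> where *: "\<And>n. 0 < \<xi> n" "\<And>n. \<xi> n < ?h n" "\<And>n. 0 < \<eta> n" "\<And>n. \<eta> n < ?h n"
    "\<And>n. ?D n = ?P (x + \<xi> n *\<^sub>R axis a 1 + \<eta> n *\<^sub>R axis b 1)" by metis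
  have "\<xi> \<longlonglongrightarrow> 0" "\<eta> \<longlonglongrightarrow> 0"
    by (rule tendsto_sandwich[OF _ _ tendsto_const LIMSEQ_inverse_real_of_nat];
        use * in \<open>auto intro!: always_eventually less_imp_le\<close>)+
  then have "(\<lambda>n. x + \<xi> n *\<^sub>R axis a 1 + \<eta> n *\<^sub>R axis b 1) \<longlonglongrightarrow> x + 0 *\<^sub>R axis a 1 + 0 *\<^sub>R axis b 1"
    by (intro tendsto_intros)
  then have "(\<lambda>n. ?P (x + \<xi> n *\<^sub>R axis a 1 + \<eta> n *\<^sub>R axis b 1)) \<longlonglongrightarrow> ?P x"
    using assms by (intro isCont_tendsto_compose[of x ?P]) (auto intro!: smooth_continuous smooth_partial)
  then show ?thesis using *(5) by simp
qed

lemma smooth_partials_commute: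
  fixes \<phi> :: "real ^ 'c \<Rightarrow> real"
  assumes "smooth \<phi>"
  shows "frechet_derivative (\<lambda>x. frechet_derivative \<phi> (at x) (axis a 1)) (at x) (axis b 1)
    = frechet_derivative (\<lambda>x. frechet_derivative \<phi> (at x) (axis b 1)) (at x) (axis a 1)"
  by (rule LIMSEQ_unique[OF second_difference_limit[OF assms, of x a b]])
    (use second_difference_limit[OF assms, of x b a] in \<open>simp add: algebra_simps\<close>)

section \<open>Calculus on superdomains\<close>

lemma coef_zero [simp]: "coef 0 A x = 0"
  and coef_one: "coef 1 A x = (if A = {} then 1 else 0)"
  and coef_add [simp]: "coef (f + g) A x = coef f A x + coef g A x"
  and coef_minus [simp]: "coef (- f) A x = - coef f A x"
  and coef_diff [simp]: "coef (f - g) A x = coef f A x - coef g A x"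
  and coef_scaleR [simp]: "coef (c *\<^sub>R f) A x = c * coef f A x"
  and coef_mult: "coef (f * g) A x =
    (\<Sum>B\<in>Pow A. (-1) ^ inversions B (A - B) * coef f B x * coef g (A - B) x)"
  by (simp_all add: zero_sfun_def one_sfun_def plus_sfun_def uminus_sfun_def minus_sfun_def
      scaleR_sfun_def times_sfun_def)

lemma coef_sum [simp]: "coef (sum f I) A x = (\<Sum>i\<in>I. coef (f i) A x)"
  by (induction I rule: infinite_finite_induct) auto

lemma coef_mult_nonzeroE:
  assumes "coef (f * g) A x \<noteq> 0"
  obtains B where "B \<in> Pow A" "coef f B x \<noteq> 0" "coef g (A - B) x \<noteq> 0"
proof -
  have "\<exists>B\<in>Pow A. (-1) ^ inversions B (A - B) * coef f B x * coef g (A - B) x \<noteq> 0"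
    using assms unfolding coef_mult by (meson sum.neutral)
  then show ?thesis using that by auto
qed

text \<open>Turns an equality of signs into a parity statement about exponents, which linear
  arithmetic can settle.\<close>

lemma even_power_minus_one: "(-1 :: real) ^ m = (-1) ^ n \<longleftrightarrow> even (m + n)"
  by (simp add: minus_one_power_iff)

subsection \<open>Inversions\<close>

text \<open>For disjoint sets every pair is inverted in exactly one of the two orders. This is the
  source of the sign rule for products.\<close>

lemma inversions_swap:
  fixes A B :: "'c::{finite,linorder} set"
  assumes "A \<inter> B = {}"
  shows "inversions A B + inversions B A = card A * card B"
proof -
  let ?S = "{(a, b). a \<in> A \<and> b \<in> B \<and> b < a}" and ?T = "{(b, a). b \<in> B \<and> a \<in> A \<and> a < b}"
  have "?S \<union> prod.swap ` ?T = A \<times> B"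
    using assms by (auto simp: image_iff not_less disjoint_iff) (metis order_le_less)
  moreover have "?S \<inter> prod.swap ` ?T = {}" by auto
  moreover have "card (prod.swap ` ?T) = card ?T"
    by (rule card_image) (auto intro: inj_on_subset[OF bij_is_inj[OF bij_swap]])
  ultimately have "card ?S + card ?T = card (A \<times> B)"
    by (metis (no_types, lifting) card_Un_disjoint finite)
  then show ?thesis by (simp add: inversions_def card_cartesian_product)
qed

lemma inversions_singleton: "inversions {a} A = card {b \<in> A. b < a}"
proof -
  have "{(a', b). a' \<in> {a} \<and> b \<in> A \<and> b < a'} = Pair a ` {b \<in> A. b < a}" by auto
  then show ?thesis by (simp add: inversions_def card_image inj_on_def)
qed

lemma inversions_insert_left:
  fixes A B :: "'c::{finite,linorder} set"
  shows "a \<notin> A \<Longrightarrow> inversions (insert a A) B = inversions {a} B + inversions A B"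
  and inversions_insert_right: "a \<notin> B \<Longrightarrow> inversions A (insert a B) = inversions A {a} + inversions A B"
  using inversions_Un_left[of "{a}" A B] inversions_Un_right[of "{a}" B A] by auto

text \<open>Carrying a new factor from the right end of a monomial to its left end takes
  \<open>card A\<close> transpositions.\<close>

lemma inversions_right_singleton:
  fixes A :: "'c::{finite,linorder} set"
  shows "a \<notin> A \<Longrightarrow> (-1 :: real) ^ inversions A {a} = (-1) ^ (inversions {a} A + card A)"
  using inversions_swap[of A "{a}"] unfolding even_power_minus_one by (simp; presburger)

lemma sum_Pow_insert:
  fixes A :: "'c::finite set"
  assumes "a \<notin> A"
  shows "sum F (Pow (insert a A)) = (\<Sum>B\<in>Pow A. F B + F (insert a B))"
proof -
  have "sum F (Pow (insert a A)) = sum F (Pow A) + sum F (insert a ` Pow A)"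
    unfolding Pow_insert by (rule sum.union_disjoint) (use assms in auto)
  also have "sum F (insert a ` Pow A) = (\<Sum>B\<in>Pow A. F (insert a B))"
    using assms by (subst sum.reindex) (auto simp: inj_on_def Pow_def)
  finally show ?thesis by (simp add: sum.distrib)
qed

subsection \<open>Parity\<close>

lemma has_parity_cong: "even (e + e') \<Longrightarrow> has_parity e f \<Longrightarrow> has_parity e' f"
  by (fastforce simp: has_parity_def)

lemma has_parity_coef: "has_parity e f \<Longrightarrow> odd (card A + e) \<Longrightarrow> coef f A x = 0"
  by (auto simp: has_parity_def)

lemma has_parity_zero [simp]: "has_parity e 0"
  and has_parity_scaleR: "has_parity e f \<Longrightarrow> has_parity e (c *\<^sub>R f)"
  and has_parity_minus: "has_parity e f \<Longrightarrow> has_parity e (- f)"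
  by (auto simp: has_parity_def)

lemma has_parity_add: "has_parity e f \<Longrightarrow> has_parity e g \<Longrightarrow> has_parity e (f + g)"
  unfolding has_parity_def coef_add by (metis add_0)

lemma has_parity_sum: "(\<And>i. i \<in> I \<Longrightarrow> has_parity e (f i)) \<Longrightarrow> has_parity e (sum f I)"
  by (induction I rule: infinite_finite_induct) (auto intro: has_parity_add)

lemma has_parity_mult:
  assumes "has_parity e f" "has_parity e' g"
  shows "has_parity (e + e') (f * g)"
  unfolding has_parity_def
proof (intro allI impI)
  fix A x
  assume "coef (f * g) A x \<noteq> 0"
  then obtain B where B: "B \<in> Pow A" "coef f B x \<noteq> 0" "coef g (A - B) x \<noteq> 0"
    by (rule coef_mult_nonzeroE)
  then have "card A = card B + card (A - B)"
    by (metis PowD card_Diff_subset card_mono finite le_add_diff_inverse)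
  moreover have "even (card B + e)" "even (card (A - B) + e')"
    using assms B by (auto simp: has_parity_def)
  ultimately show "even (card A + (e + e'))" by presburger
qed

lemma has_parity_crd: "has_parity (p a) (crd p a)"
  by (auto simp: has_parity_def crd_def split: if_splits)

lemma has_parity_pd: "has_parity e f \<Longrightarrow> has_parity (e + p a) (pd p a f)"
proof (cases "odd (p a)")
  case True
  assume "has_parity e f"
  show ?thesis unfolding has_parity_def
  proof (intro allI impI)
    fix A x
    assume "coef (pd p a f) A x \<noteq> 0"
    then have "a \<notin> A" "coef f (insert a A) x \<noteq> 0"
      using True by (auto simp: pd_def split: if_splits)
    then have "even (Suc (card A) + e)" using \<open>has_parity e f\<close> by (force simp: has_parity_def)
    then show "even (card A + (e + p a))" using True by simp
  qed
next
  case False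
  assume f: "has_parity e f"
  show ?thesis unfolding has_parity_def
  proof (intro allI impI, rule ccontr)
    fix A x
    assume *: "coef (pd p a f) A x \<noteq> 0" "odd (card A + (e + p a))"
    have "coef f A = (\<lambda>x. 0)"
      by (rule ext) (use * False has_parity_coef[OF f] in auto)
    then show False using * False by (simp add: pd_def)
  qed
qed

lemma parity_part_same: "has_parity e f \<Longrightarrow> parity_part e f = f"
  and parity_part_other: "has_parity e f \<Longrightarrow> odd (e + e') \<Longrightarrow> parity_part e' f = 0"
   by (rule sfun_eqI; auto simp: parity_part_def has_parity_def)+

lemma has_parity_parity_part: "has_parity e (parity_part e f)"
  by (auto simp: has_parity_def parity_part_def split: if_splits)

lemma parity_part_cong: "even (e + e') \<Longrightarrow> parity_part e f = parity_part e' f"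
  by (rule sfun_eqI) (auto simp: parity_part_def)

lemma parity_decomp: "f = parity_part 0 f + parity_part 1 f"
  by (rule sfun_eqI) (auto simp: parity_part_def)

text \<open>Exchanging a subset with its complement costs the sign given by the product of their
  cardinalities, and where both coefficients are nonzero these cardinalities have the parities of
  \<open>f\<close> and \<open>g\<close>.\<close>

lemma mult_supercomm:
  fixes f g :: "'c::{finite,linorder} sfun"
  assumes "has_parity e f" "has_parity e' g"
  shows "f * g = (-1) ^ (e * e') *\<^sub>R (g * f)"
proof (rule sfun_eqI)
  fix A :: "'c set" and x
  have "coef (f * g) A x
      = (\<Sum>B\<in>Pow A. (-1) ^ inversions (A - B) B * coef f (A - B) x * coef g B x)"
    unfolding coef_mult
    by (rule sum.reindex_bij_witness[where i = "\<lambda>B. A - B" and j = "\<lambda>B. A - B"])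
      (auto simp: double_diff)
  also have "\<dots> = (\<Sum>B\<in>Pow A. (-1) ^ (e * e') * ((-1) ^ inversions B (A - B) * coef g B x * coef f (A - B) x))"
  proof (rule sum.cong)
    fix B assume "B \<in> Pow A"
    show "(-1) ^ inversions (A - B) B * coef f (A - B) x * coef g B x
      = (-1) ^ (e * e') * ((-1) ^ inversions B (A - B) * coef g B x * coef f (A - B) x)"
    proof (cases "coef g B x = 0 \<or> coef f (A - B) x = 0")
      case False
      then have *: "even (card B + e')" "even (card (A - B) + e)"
        using assms by (auto simp: has_parity_def)
      have "inversions (A - B) B + inversions B (A - B) = card (A - B) * card B"
        by (rule inversions_swap) auto
      then have "even (inversions (A - B) B + (e * e' + inversions B (A - B)))"
        using * by (metis (no_types, opaque_lifting) add.left_commute even_add even_mult_iff)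
      then have "(-1 :: real) ^ inversions (A - B) B = (-1) ^ (e * e') * (-1) ^ inversions B (A - B)"
        by (metis even_power_minus_one power_add)
      then show ?thesis by simp
    qed auto
  qed simp
  finally show "coef (f * g) A x = coef ((-1) ^ (e * e') *\<^sub>R (g * f)) A x"
    by (simp add: coef_mult sum_distrib_left)
qed

subsection \<open>The algebra of functions\<close>

lemma cinf_smooth: "f \<in> cinf p \<Longrightarrow> smooth (coef f A)"
  and cinf_support: "f \<in> cinf p \<Longrightarrow> coef f A x \<noteq> 0 \<Longrightarrow> A \<subseteq> {a. odd (p a)}"
  and cinf_eqI: "f \<in> cinf p \<Longrightarrow> (\<And>a. even (p a) \<Longrightarrow> x $ a = y $ a) \<Longrightarrow> coef f A x = coef f A y"
  by (auto simp: cinf_def)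

lemma cinf_differentiable: "f \<in> cinf p \<Longrightarrow> coef f A differentiable at x"
  by (simp add: cinf_smooth smooth_differentiable)

lemma cinfI:
  assumes "\<And>A. smooth (coef f A)" "\<And>A x. coef f A x \<noteq> 0 \<Longrightarrow> A \<subseteq> {a. odd (p a)}"
    and "\<And>A x y. (\<And>a. even (p a) \<Longrightarrow> x $ a = y $ a) \<Longrightarrow> coef f A x = coef f A y"
  shows "f \<in> cinf p"
  unfolding cinf_def mem_Collect_eq using assms by meson

lemma cinf_zero [simp]: "0 \<in> cinf p"
  by (rule cinfI) (auto simp: zero_sfun_def)

lemma cinf_one [simp]: "1 \<in> cinf p"
  by (rule cinfI) (auto simp: one_sfun_def split: if_splits)

lemma cinf_add: assumes "f \<in> cinf p" "g \<in> cinf p" shows "f + g \<in> cinf p"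
proof (rule cinfI)
  show "smooth (coef (f + g) A)" for A
    using assms by (simp add: plus_sfun_def smooth_add cinf_smooth)
  show "coef (f + g) A x \<noteq> 0 \<Longrightarrow> A \<subseteq> {a. odd (p a)}" for A x
    using assms[THEN cinf_support, of A x] by fastforce
  show "coef (f + g) A x = coef (f + g) A y" if "\<And>a. even (p a) \<Longrightarrow> x $ a = y $ a" for A x y
    using assms[THEN cinf_eqI, of x y A] that by auto
qed

lemma cinf_scaleR: assumes "f \<in> cinf p" shows "c *\<^sub>R f \<in> cinf p"
proof (rule cinfI)
  show "smooth (coef (c *\<^sub>R f) A)" for A
    using assms by (simp add: scaleR_sfun_def smooth_mult cinf_smooth)
  show "coef (c *\<^sub>R f) A x \<noteq> 0 \<Longrightarrow> A \<subseteq> {a. odd (p a)}" for A x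
    using assms[THEN cinf_support, of A x] by fastforce
  show "coef (c *\<^sub>R f) A x = coef (c *\<^sub>R f) A y" if "\<And>a. even (p a) \<Longrightarrow> x $ a = y $ a" for A x y
    using assms[THEN cinf_eqI, of x y A] that by auto
qed

lemma cinf_minus: "f \<in> cinf p \<Longrightarrow> - f \<in> cinf p"
  using cinf_scaleR[of f p "-1"] by simp

lemma cinf_diff: "f \<in> cinf p \<Longrightarrow> g \<in> cinf p \<Longrightarrow> f - g \<in> cinf p"
  using cinf_add[of f p "- g"] cinf_minus by auto

lemma cinf_sum: "(\<And>i. i \<in> I \<Longrightarrow> f i \<in> cinf p) \<Longrightarrow> sum f I \<in> cinf p"
  by (induction I rule: infinite_finite_induct) (auto intro: cinf_add)

lemma cinf_mult: assumes "f \<in> cinf p" "g \<in> cinf p" shows "f * g \<in> cinf p"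
proof (rule cinfI)
  show "smooth (coef (f * g) A)" for A
    using assms by (auto simp: times_sfun_def intro!: smooth_sum smooth_mult cinf_smooth)
  show "coef (f * g) A x = coef (f * g) A y" if "\<And>a. even (p a) \<Longrightarrow> x $ a = y $ a" for A x y
    unfolding coef_mult using assms[THEN cinf_eqI, of x y] that by auto
  show "A \<subseteq> {a. odd (p a)}" if nz: "coef (f * g) A x \<noteq> 0" for A x
  proof -
    obtain B where B: "B \<in> Pow A" "coef f B x \<noteq> 0" "coef g (A - B) x \<noteq> 0"
      using nz by (rule coef_mult_nonzeroE)
    show ?thesis using B assms[THEN cinf_support] by blast
  qed
qed

lemma cinf_crd [simp]: "crd p a \<in> cinf p"
proof (rule cinfI)
  show "smooth (coef (crd p a) A)" for A
    by (cases "odd (p a)"; cases "A = {a}"; cases "A = {}") (auto simp: crd_def smooth_nth)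
qed (auto simp: crd_def split: if_splits)

lemma cinf_parity_part: assumes "f \<in> cinf p" shows "parity_part e f \<in> cinf p"
proof (rule cinfI)
  show "smooth (coef (parity_part e f) A)" for A
    using assms by (cases "even (card A + e)") (auto simp: parity_part_def cinf_smooth)
  show "A \<subseteq> {a. odd (p a)}" if "coef (parity_part e f) A x \<noteq> 0" for A x
    using that cinf_support[OF assms, of A x] by (auto simp: parity_part_def split: if_splits)
  show "coef (parity_part e f) A x = coef (parity_part e f) A y"
    if "\<And>a. even (p a) \<Longrightarrow> x $ a = y $ a" for A x y
    using cinf_eqI[OF assms, of x y A] that by (auto simp: parity_part_def)
qed

subsection \<open>Partial derivatives\<close>

lemma coef_pd_odd:
  "odd (p a) \<Longrightarrow> coef (pd p a f) A x
    = (if a \<in> A then 0 else (-1) ^ inversions {a} A * coef f (insert a A) x)"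
  by (simp add: pd_def inversions_singleton)

lemma coef_pd_even:
  "even (p a) \<Longrightarrow> coef (pd p a f) A x = frechet_derivative (coef f A) (at x) (axis a 1)"
  by (simp add: pd_def)

lemma pd_zero [simp]: "pd p a 0 = 0"
  by (rule sfun_eqI) (auto simp: pd_def zero_sfun_def)

lemma pd_add: "f \<in> cinf p \<Longrightarrow> g \<in> cinf p \<Longrightarrow> pd p a (f + g) = pd p a f + pd p a g"
  by (rule sfun_eqI, cases "odd (p a)")
    (auto simp: coef_pd_odd coef_pd_even plus_sfun_def frechet_derivative_add cinf_differentiable
      algebra_simps)

lemma pd_scaleR: "f \<in> cinf p \<Longrightarrow> pd p a (c *\<^sub>R f) = c *\<^sub>R pd p a f"
  by (rule sfun_eqI, cases "odd (p a)")
    (auto simp: coef_pd_odd coef_pd_even scaleR_sfun_def frechet_derivative_cmult cinf_differentiable)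

lemma pd_minus: "f \<in> cinf p \<Longrightarrow> pd p a (- f) = - pd p a f"
  using pd_scaleR[of f p a "-1"] by simp

lemma pd_sum: "(\<And>i. i \<in> I \<Longrightarrow> f i \<in> cinf p) \<Longrightarrow> pd p a (sum f I) = (\<Sum>i\<in>I. pd p a (f i))"
  by (induction I rule: infinite_finite_induct) (auto simp: pd_add cinf_sum)

lemma cinf_pd: assumes "f \<in> cinf p" shows "pd p a f \<in> cinf p"
proof (cases "odd (p a)")
  case True
  show ?thesis
  proof (rule cinfI)
    show "smooth (coef (pd p a f) A)" for A
      using assms True
      by (cases "a \<in> A") (auto simp: pd_def intro!: smooth_mult[of "\<lambda>x. c" for c] cinf_smooth)
    show "A \<subseteq> {a. odd (p a)}" if "coef (pd p a f) A x \<noteq> 0" for A x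
      using that cinf_support[OF assms, of "insert a A" x] True
      by (auto simp: coef_pd_odd split: if_splits)
    show "coef (pd p a f) A x = coef (pd p a f) A y"
      if "\<And>a. even (p a) \<Longrightarrow> x $ a = y $ a" for A x y
      using cinf_eqI[OF assms, of x y "insert a A"] that True by (auto simp: coef_pd_odd)
  qed
next
  case False
  show ?thesis
  proof (rule cinfI)
    show "smooth (coef (pd p a f) A)" for A
      using assms False by (auto simp: pd_def intro!: smooth_partial cinf_smooth)
    show "A \<subseteq> {a. odd (p a)}" if nz: "coef (pd p a f) A x \<noteq> 0" for A x
    proof (rule ccontr)
      assume "\<not> A \<subseteq> {a. odd (p a)}"
      then have "coef f A = (\<lambda>x. 0)" using cinf_support[OF assms] by blast
      then show False using nz False by (simp add: coef_pd_even)
    qed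
    show "coef (pd p a f) A x = coef (pd p a f) A y"
      if xy: "\<And>a. even (p a) \<Longrightarrow> x $ a = y $ a" for A x y
    proof -
      \<comment> \<open>Adding \<open>y - x\<close> changes odd coordinates only, so the coefficient
        is invariant under this translation and its derivatives at \<open>x\<close> and
        \<open>y\<close> coincide.\<close>
      have "(coef f A has_derivative frechet_derivative (coef f A) (at y)) (at (x + (y - x)))"
        using smooth_has_derivative[OF cinf_smooth[OF assms]] by simp
      moreover have "((\<lambda>z. z + (y - x)) has_derivative (\<lambda>v. v)) (at x)"
        by (auto intro!: derivative_eq_intros)
      ultimately have "((\<lambda>z. coef f A (z + (y - x))) has_derivative frechet_derivative (coef f A) (at y)) (at x)"
        by (rule has_derivative_compose[rotated])
      moreover have "(\<lambda>z. coef f A (z + (y - x))) = coef f A"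
        using xy by (auto intro!: ext cinf_eqI[OF assms])
      ultimately show ?thesis using False by (simp add: coef_pd_even frechet_derivative_at[symmetric])
    qed
  qed
qed

lemma pd_crd: "pd p a (crd p b) = (if a = b then 1 else 0)"
proof (rule sfun_eqI)
  fix A x
  show "coef (pd p a (crd p b)) A x = coef (if a = b then 1 else 0) A x"
  proof (cases "odd (p a)")
    case True
    then show ?thesis
      by (auto simp: coef_pd_odd crd_def coef_one inversions_singleton)
  next
    case False
    have "frechet_derivative (\<lambda>x. x $ b) (at x) (axis a 1) = (if a = b then 1 else 0)"
      by (simp add: frechet_derivative_nth axis_def)
    with False show ?thesis
      by (cases "odd (p b)"; cases "A = {b}"; cases "A = {}")
        (auto simp: coef_pd_even crd_def coef_one)
  qed
qed

lemma pd_one [simp]: "pd p a 1 = 0"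
proof (rule sfun_eqI)
  fix A x
  show "coef (pd p a 1) A x = coef 0 A x"
    by (cases "odd (p a)"; cases "A = {}") (auto simp: coef_pd_odd coef_pd_even one_sfun_def)
qed

text \<open>If \<open>a\<close> is not in \<open>A\<close>, the subsets of \<open>insert a A\<close>
  split by whether they contain \<open>a\<close>: this says which factor is differentiated and gives
  the two Leibniz terms. If \<open>a\<close> is in \<open>A\<close>, the left side is 0, and on the
  right the terms in which \<open>a\<close> occurs in both factors cancel in pairs.\<close>

lemma pd_mult_odd:
  fixes f g :: "'c::{finite,linorder} sfun"
  assumes a: "odd (p a)" and f: "has_parity e f"
  shows "pd p a (f * g) = pd p a f * g + (-1) ^ e *\<^sub>R (f * pd p a g)"
proof (rule sfun_eqI)
  fix A :: "'c set" and x
  let ?s = "\<lambda>B C. (-1 :: real) ^ inversions B C"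
  have e: "(-1) ^ card B * coef f B x = (-1) ^ e * coef f B x" for B
    using has_parity_coef[OF f, of B x] by (cases "odd (card B + e)") (auto simp: minus_one_power_iff)
  show "coef (pd p a (f * g)) A x = coef (pd p a f * g + (-1) ^ e *\<^sub>R (f * pd p a g)) A x"
  proof (cases "a \<in> A")
    case False
    have "coef (pd p a (f * g)) A x = (\<Sum>B\<in>Pow A. ?s {a} A *
       (?s B (insert a A - B) * coef f B x * coef g (insert a A - B) x
        + ?s (insert a B) (insert a A - insert a B) * coef f (insert a B) x * coef g (insert a A - insert a B) x))"
      using a False by (simp add: coef_pd_odd coef_mult sum_Pow_insert sum_distrib_left)
    also have "\<dots> = (\<Sum>B\<in>Pow A. ?s B (A - B) * (?s {a} B * coef f (insert a B) x) * coef g (A - B) x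
       + (-1) ^ e * (?s B (A - B) * coef f B x * (?s {a} (A - B) * coef g (insert a (A - B)) x)))"
    proof (rule sum.cong)
      fix B assume B: "B \<in> Pow A"
      then have aB: "a \<notin> B" "insert a A - B = insert a (A - B)" "insert a A - insert a B = A - B"
        using False by auto
      have "A = B \<union> (A - B)" using B by auto
      then have 1: "?s {a} A = ?s {a} B * ?s {a} (A - B)"
        using inversions_Un_right[of B "A - B" "{a}"] by (metis Diff_disjoint power_add)
      have 2: "?s B (insert a (A - B)) = ?s {a} B * (-1) ^ card B * ?s B (A - B)"
        using False aB inversions_right_singleton[of a B] inversions_insert_right[of a "A - B" B]
        by (simp add: power_add)
      have 3: "?s (insert a B) (A - B) = ?s {a} (A - B) * ?s B (A - B)"
        using aB inversions_insert_left[of a B] by (simp add: power_add)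
      have sq: "?s C D * ?s C D = 1" for C D :: "'c set"
        by (simp flip: power_add)
      have t1: "?s {a} A * (?s B (insert a (A - B)) * coef f B x * coef g (insert a (A - B)) x)
        = (?s {a} B * ?s {a} B) * (?s B (A - B) * ((-1) ^ card B * coef f B x) * (?s {a} (A - B) * coef g (insert a (A - B)) x))"
        unfolding 1 2 by (simp only: mult_ac)
      have t2: "?s {a} A * (?s (insert a B) (A - B) * coef f (insert a B) x * coef g (A - B) x)
        = (?s {a} (A - B) * ?s {a} (A - B)) * (?s B (A - B) * (?s {a} B * coef f (insert a B) x) * coef g (A - B) x)"
        unfolding 1 3 by (simp only: mult_ac)
      show "?s {a} A *
         (?s B (insert a A - B) * coef f B x * coef g (insert a A - B) x
          + ?s (insert a B) (insert a A - insert a B) * coef f (insert a B) x * coef g (insert a A - insert a B) x)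
        = ?s B (A - B) * (?s {a} B * coef f (insert a B) x) * coef g (A - B) x
       + (-1) ^ e * (?s B (A - B) * coef f B x * (?s {a} (A - B) * coef g (insert a (A - B)) x))"
        unfolding aB(2,3) distrib_left t1 t2 sq e by (simp add: mult_ac)
    qed simp
    also have "\<dots> = coef (pd p a f * g + (-1) ^ e *\<^sub>R (f * pd p a g)) A x"
      unfolding sum.distrib coef_add coef_scaleR coef_mult sum_distrib_left
      by (intro arg_cong2[where f = "(+)"] sum.cong) (use a False in \<open>auto simp: coef_pd_odd\<close>)
    finally show ?thesis .
  next
    case True
    define A0 where "A0 = A - {a}"
    have A: "A = insert a A0" "a \<notin> A0" using True by (auto simp: A0_def)
    have "coef (pd p a f * g + (-1) ^ e *\<^sub>R (f * pd p a g)) A x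
      = (\<Sum>B\<in>Pow A0. ?s B (insert a (A0 - B)) * (?s {a} B * coef f (insert a B) x) * coef g (insert a (A0 - B)) x)
       + (\<Sum>B\<in>Pow A0. (-1) ^ e * (?s (insert a B) (A0 - B) * coef f (insert a B) x * (?s {a} (A0 - B) * coef g (insert a (A0 - B)) x)))"
      unfolding coef_add coef_scaleR coef_mult A(1) sum_Pow_insert[OF A(2)] sum_distrib_left
    proof (intro arg_cong2[where f = "(+)"] sum.cong refl)
      fix B assume "B \<in> Pow A0"
      then have "a \<notin> B" "insert a A0 - B = insert a (A0 - B)" "insert a A0 - insert a B = A0 - B"
        using A(2) by auto
      then show "?s B (insert a A0 - B) * coef (pd p a f) B x * coef g (insert a A0 - B) x +
         ?s (insert a B) (insert a A0 - insert a B) * coef (pd p a f) (insert a B) x * coef g (insert a A0 - insert a B) x =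
         ?s B (insert a (A0 - B)) * (?s {a} B * coef f (insert a B) x) * coef g (insert a (A0 - B)) x"
        and "(-1) ^ e * (?s B (insert a A0 - B) * coef f B x * coef (pd p a g) (insert a A0 - B) x +
         ?s (insert a B) (insert a A0 - insert a B) * coef f (insert a B) x * coef (pd p a g) (insert a A0 - insert a B) x) =
         (-1) ^ e * (?s (insert a B) (A0 - B) * coef f (insert a B) x * (?s {a} (A0 - B) * coef g (insert a (A0 - B)) x))"
        using a A(2) by (auto simp: coef_pd_odd)
    qed
    also have "\<dots> = 0"
      unfolding sum.distrib[symmetric]
    proof (rule sum.neutral, rule ballI)
      fix B assume "B \<in> Pow A0"
      then have aB: "a \<notin> B" "a \<notin> A0 - B" using A(2) by auto
      have 2: "?s B (insert a (A0 - B)) = ?s {a} B * (-1) ^ card B * ?s B (A0 - B)"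
        using aB inversions_right_singleton[of a B] inversions_insert_right[of a "A0 - B" B]
        by (simp add: power_add)
      have 3: "?s (insert a B) (A0 - B) = ?s {a} (A0 - B) * ?s B (A0 - B)"
        using aB inversions_insert_left[of a B] by (simp add: power_add)
      have sq: "?s C D * ?s C D = 1" for C D :: "'c set"
        by (simp flip: power_add)
      \<comment> \<open>\<open>insert a B\<close> has one element more than \<open>B\<close>, and
        this extra sign makes the paired terms cancel.\<close>
      have e': "(-1) ^ card B * coef f (insert a B) x = - ((-1) ^ e * coef f (insert a B) x)"
        using e[of "insert a B"] aB by simp
      have "?s B (insert a (A0 - B)) * (?s {a} B * coef f (insert a B) x) * coef g (insert a (A0 - B)) x
        = (?s {a} B * ?s {a} B) * (?s B (A0 - B) * ((-1) ^ card B * coef f (insert a B) x) * coef g (insert a (A0 - B)) x)"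
        unfolding 2 by (simp only: mult_ac)
      moreover have "(-1) ^ e * (?s (insert a B) (A0 - B) * coef f (insert a B) x * (?s {a} (A0 - B) * coef g (insert a (A0 - B)) x))
        = (?s {a} (A0 - B) * ?s {a} (A0 - B)) * (?s B (A0 - B) * ((-1) ^ e * coef f (insert a B) x) * coef g (insert a (A0 - B)) x)"
        unfolding 3 by (simp only: mult_ac)
      ultimately show "?s B (insert a (A0 - B)) * (?s {a} B * coef f (insert a B) x) * coef g (insert a (A0 - B)) x
        + (-1) ^ e * (?s (insert a B) (A0 - B) * coef f (insert a B) x * (?s {a} (A0 - B) * coef g (insert a (A0 - B)) x)) = 0"
        unfolding sq e' by simp
    qed
    finally show ?thesis using a True by (simp add: coef_pd_odd)
  qed
qed

lemma pd_mult_even: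
  fixes f g :: "'c::{finite,linorder} sfun"
  assumes "even (p a)" "f \<in> cinf p" "g \<in> cinf p"
  shows "pd p a (f * g) = pd p a f * g + f * pd p a g"
proof (rule sfun_eqI)
  fix A :: "'c set" and x
  have "coef (pd p a (f * g)) A x
    = (\<Sum>B\<in>Pow A. frechet_derivative (\<lambda>x. (-1) ^ inversions B (A - B) * coef f B x * coef g (A - B) x) (at x) (axis a 1))"
    unfolding coef_pd_even[of p a, OF assms(1)] times_sfun_def coef_Sfun
    by (intro frechet_derivative_sum differentiable_mult cinf_differentiable[OF assms(2)]
        cinf_differentiable[OF assms(3)] differentiable_const)
  also have "\<dots> = (\<Sum>B\<in>Pow A. (-1) ^ inversions B (A - B) * coef (pd p a f) B x * coef g (A - B) x
      + (-1) ^ inversions B (A - B) * coef f B x * coef (pd p a g) (A - B) x)"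
    using assms by (intro sum.cong) (auto simp: frechet_derivative_mult frechet_derivative_cmult
        cinf_differentiable differentiable_mult coef_pd_even)
  finally show "coef (pd p a (f * g)) A x = coef (pd p a f * g + f * pd p a g) A x"
    by (simp add: coef_mult sum.distrib)
qed

lemma pd_mult:
  assumes "has_parity e f" "f \<in> cinf p" "g \<in> cinf p"
  shows "pd p a (f * g) = pd p a f * g + (-1) ^ (p a * e) *\<^sub>R (f * pd p a g)"
proof (cases "odd (p a)")
  case True
  then have "(-1 :: real) ^ (p a * e) = (-1) ^ e"
    by (simp add: even_power_minus_one)
  then show ?thesis using pd_mult_odd[of p a, OF True assms(1)] by simp
next
  case False
  then show ?thesis using pd_mult_even[of p a f g] assms by simp
qed

lemma pd_commute:
  fixes f :: "'c::{finite,linorder} sfun"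
  assumes "f \<in> cinf p"
  shows "pd p a (pd p b f) = (-1) ^ (p a * p b) *\<^sub>R pd p b (pd p a f)"
proof (rule sfun_eqI)
  fix A :: "'c set" and x
  show "coef (pd p a (pd p b f)) A x = coef ((-1) ^ (p a * p b) *\<^sub>R pd p b (pd p a f)) A x"
  proof (cases "odd (p a)"; cases "odd (p b)")
    assume odd: "odd (p a)" "odd (p b)"
    show ?thesis
    proof (cases "a \<in> A \<or> b \<in> A \<or> a = b")
      case True
      then show ?thesis using odd by (auto simp: coef_pd_odd)
    next
      case False
      \<comment> \<open>Exactly one of \<open>a < b\<close> and \<open>b < a\<close> holds; the
        corresponding inversion is the summand 1 and the origin of the minus sign.\<close>
      have "inversions {a} (insert b A) + inversions {b} (insert a A)
        = inversions {a} A + inversions {b} A + 1"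
        using False inversions_swap[of "{a}" "{b}"] inversions_insert_right[of b A "{a}"]
          inversions_insert_right[of a A "{b}"] by simp
      then have "(-1 :: real) ^ (inversions {a} A + inversions {b} (insert a A))
        = (-1) ^ Suc (inversions {b} A + inversions {a} (insert b A))"
        unfolding even_power_minus_one by presburger
      then have "(-1 :: real) ^ inversions {a} A * ((-1) ^ inversions {b} (insert a A) * t)
        = - ((-1) ^ inversions {b} A * ((-1) ^ inversions {a} (insert b A) * t))" for t
        by (metis mult.assoc mult_minus_left mult_minus1 power_Suc power_add)
      then show ?thesis using odd False by (auto simp: coef_pd_odd insert_commute)
    qed
  next
    assume odd: "\<not> odd (p a)" "\<not> odd (p b)"
    have "coef (pd p a f) A = (\<lambda>x. frechet_derivative (coef f A) (at x) (axis a 1))"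
      if "even (p a)" for a
      using that by (auto simp: coef_pd_even)
    then show ?thesis
      using odd smooth_partials_commute[OF cinf_smooth[OF assms], of A]
      by (simp add: coef_pd_even)
  next
    assume odd: "odd (p a)" "\<not> odd (p b)"
    have "coef (pd p a f) A = (\<lambda>x. if a \<in> A then 0 else (-1) ^ inversions {a} A * coef f (insert a A) x)"
      using odd by (auto simp: coef_pd_odd)
    then show ?thesis
      using odd cinf_differentiable[OF assms]
      by (auto simp: coef_pd_odd coef_pd_even frechet_derivative_cmult)
  next
    assume odd: "\<not> odd (p a)" "odd (p b)"
    have "coef (pd p b f) A = (\<lambda>x. if b \<in> A then 0 else (-1) ^ inversions {b} A * coef f (insert b A) x)"
      using odd by (auto simp: coef_pd_odd)
    then show ?thesis
      using odd cinf_differentiable[OF assms]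
      by (auto simp: coef_pd_odd coef_pd_even frechet_derivative_cmult)
  qed
qed

lemma mult_left_supercomm:
  fixes f g :: "'c::{finite,linorder} sfun"
  assumes "has_parity e f" "has_parity e' g"
  shows "f * (g * h) = (-1) ^ (e * e') *\<^sub>R (g * (f * h))"
  by (simp add: mult_supercomm[OF assms] flip: mult.assoc)

subsection \<open>Vector fields\<close>

lemma vector_field_cinf: "vector_field p e X \<Longrightarrow> X a \<in> cinf p"
  and vector_field_parity: "vector_field p e X \<Longrightarrow> has_parity (e + p a) (X a)"
  by (auto simp: vector_field_def)

lemma cinf_vact: "vector_field p e X \<Longrightarrow> f \<in> cinf p \<Longrightarrow> vact p X f \<in> cinf p"
  unfolding vact_def by (intro cinf_sum cinf_mult cinf_pd) (auto simp: vector_field_def)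

lemma vact_add: "f \<in> cinf p \<Longrightarrow> g \<in> cinf p \<Longrightarrow> vact p X (f + g) = vact p X f + vact p X g"
  by (simp add: vact_def pd_add distrib_left sum.distrib)

lemma vact_scaleR: "f \<in> cinf p \<Longrightarrow> vact p X (c *\<^sub>R f) = c *\<^sub>R vact p X f"
  by (simp add: vact_def pd_scaleR scaleR_sum_right)

lemma vact_zero [simp]: "vact p X 0 = 0"
  by (simp add: vact_def)

lemma vact_sum: "(\<And>i. i \<in> I \<Longrightarrow> f i \<in> cinf p) \<Longrightarrow> vact p X (sum f I) = (\<Sum>i\<in>I. vact p X (f i))"
  by (induction I rule: infinite_finite_induct) (auto simp: vact_add cinf_sum)

lemma vact_crd: "vact p X (crd p a) = X a"
proof -
  have "vact p X (crd p a) = (\<Sum>b\<in>UNIV. if b = a then X b else 0)"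
    unfolding vact_def pd_crd by (rule sum.cong) auto
  then show ?thesis by simp
qed

lemma has_parity_vact:
  assumes X: "vector_field p e X" and "has_parity e' f"
  shows "has_parity (e + e') (vact p X f)"
  unfolding vact_def
proof (rule has_parity_sum)
  fix a
  have "has_parity ((e + p a) + (e' + p a)) (X a * pd p a f)"
    using assms by (intro has_parity_mult has_parity_pd vector_field_parity)
  then show "has_parity (e + e') (X a * pd p a f)"
    by (rule has_parity_cong[rotated]) (simp; argo)
qed

lemma vact_mult:
  assumes X: "vector_field p e X" and f: "has_parity e' f" "f \<in> cinf p" and g: "g \<in> cinf p"
  shows "vact p X (f * g) = vact p X f * g + (-1) ^ (e * e') *\<^sub>R (f * vact p X g)"
  unfolding vact_def sum_distrib_left sum_distrib_right scaleR_sum_right sum.distrib[symmetric]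
proof (rule sum.cong)
  fix a
  have "X a * (f * pd p a g) = (-1) ^ ((e + p a) * e') *\<^sub>R (f * (X a * pd p a g))"
    by (rule mult_left_supercomm[OF vector_field_parity[OF X] f(1)])
  then show "X a * pd p a (f * g) = X a * pd p a f * g + (-1) ^ (e * e') *\<^sub>R (f * (X a * pd p a g))"
    by (cases "even e"; cases "even e'"; cases "even (p a)")
      (simp_all add: pd_mult[OF f g] distrib_left right_diff_distrib mult.assoc)
qed simp

text \<open>After the Leibniz rule, the second-order parts of the two compositions agree up to the
  sign of the graded commutator, by supercommutativity and \<open>pd_commute\<close>. Only the
  first-order parts survive.\<close>

lemma vact_vcomm:
  assumes X: "vector_field p e X" and Y: "vector_field p e' Y" and f: "f \<in> cinf p"
  shows "vact p X (vact p Y f) - (-1) ^ (e * e') *\<^sub>R vact p Y (vact p X f)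
    = vact p (vcomm p e X e' Y) f"
proof -
  have exp: "vact p X (vact p Y f) = (\<Sum>a\<in>UNIV. vact p X (Y a) * pd p a f)
      + (\<Sum>a\<in>UNIV. \<Sum>b\<in>UNIV. (-1) ^ (e * (e' + p a)) *\<^sub>R (Y a * (X b * pd p b (pd p a f))))"
    if "vector_field p e X" "vector_field p e' Y" for e e' X Y
  proof -
    have "vact p X (vact p Y f) = (\<Sum>a\<in>UNIV. vact p X (Y a * pd p a f))"
      using that f unfolding vact_def[of p Y f]
      by (intro vact_sum cinf_mult cinf_pd) (auto simp: vector_field_def)
    also have "\<dots> = (\<Sum>a\<in>UNIV. vact p X (Y a) * pd p a f
        + (-1) ^ (e * (e' + p a)) *\<^sub>R (Y a * vact p X (pd p a f)))"
      using that f
      by (intro sum.cong refl vact_mult cinf_pd) (auto simp: vector_field_cinf vector_field_parity)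
    finally show ?thesis
      by (simp add: sum.distrib vact_def[of p X "pd p _ f"] sum_distrib_left scaleR_sum_right)
  qed
  have "(\<Sum>a\<in>UNIV. \<Sum>b\<in>UNIV. (-1) ^ (e * (e' + p a)) *\<^sub>R (Y a * (X b * pd p b (pd p a f))))
    = (\<Sum>a\<in>UNIV. \<Sum>b\<in>UNIV. (-1) ^ (e * e') *\<^sub>R ((-1) ^ (e' * (e + p b)) *\<^sub>R (X b * (Y a * pd p a (pd p b f)))))"
  proof (intro sum.cong refl)
    fix a b
    have "Y a * (X b * h) = (-1) ^ ((e' + p a) * (e + p b)) *\<^sub>R (X b * (Y a * h))" for h
      by (intro mult_left_supercomm vector_field_parity X Y)
    then show "(-1) ^ (e * (e' + p a)) *\<^sub>R (Y a * (X b * pd p b (pd p a f)))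
      = (-1) ^ (e * e') *\<^sub>R ((-1) ^ (e' * (e + p b)) *\<^sub>R (X b * (Y a * pd p a (pd p b f))))"
      unfolding pd_commute[OF f, of b a]
      by (cases "even e"; cases "even e'"; cases "even (p a)"; cases "even (p b)") simp_all
  qed
  also have "\<dots> = (-1) ^ (e * e') *\<^sub>R
      (\<Sum>b\<in>UNIV. \<Sum>a\<in>UNIV. (-1) ^ (e' * (e + p b)) *\<^sub>R (X b * (Y a * pd p a (pd p b f))))"
    unfolding scaleR_sum_right by (rule sum.swap)
  finally show ?thesis
    unfolding exp[OF X Y] exp[OF Y X] vact_def[of p "vcomm p e X e' Y"]
    unfolding vcomm_def
    by (simp add: left_diff_distrib sum_subtractf scaleR_add_right scaleR_sum_right)
qed

section \<open>Cotangent bundles\<close>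

lemma sum_UNIV_Plus: "(\<Sum>c\<in>UNIV. F c) = (\<Sum>a\<in>UNIV. F (Inl a)) + (\<Sum>a\<in>UNIV. F (Inr a))"
  for F :: "'a::finite + 'b::finite \<Rightarrow> 'd::comm_monoid_add"
  using sum.Plus[of "UNIV :: 'a set" "UNIV :: 'b set" F] unfolding UNIV_Plus_UNIV o_def
  by (metis finite)

lemma ct_simps [simp]: "ct p (Inl a) = p a" "ct p (Inr a) = p a"
  by (simp_all add: ct_def)

subsection \<open>Pullback and restriction to the zero section\<close>

lemma less_sum_simps [simp]:
  "(Inl a :: 'a::linorder + 'b::linorder) < Inl b \<longleftrightarrow> a < b"
  by (auto simp: less_sum_def less_eq_sum_def)

lemma inversions_Inl: "inversions (Inl ` A :: ('a + 'b::{finite,linorder}) set) (Inl ` B) = inversions A B"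
  for A B :: "'a::{finite,linorder} set"
proof -
  let ?I = "map_prod Inl Inl :: 'a \<times> 'a \<Rightarrow> ('a + 'b) \<times> ('a + 'b)"
  have "{(a, b). a \<in> Inl ` A \<and> b \<in> Inl ` B \<and> b < a} = ?I ` {(a, b). a \<in> A \<and> b \<in> B \<and> b < a}"
    by auto
  moreover have "card (?I ` {(a, b). a \<in> A \<and> b \<in> B \<and> b < a}) = card {(a, b). a \<in> A \<and> b \<in> B \<and> b < a}"
    by (rule card_image) (auto simp: inj_on_def)
  ultimately show ?thesis
    unfolding inversions_def by simp
qed

lemma coef_pull: "coef (pull f) A x
    = (if A \<subseteq> range Inl then coef f (Inl -` A) (\<chi> a. x $ Inl a) else 0)"
  by (simp add: pull_def)

lemma coef_pull_image: "coef (pull f) (Inl ` A) x = coef f A (\<chi> a. x $ Inl a)"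
  by (auto simp: coef_pull inj_vimage_image_eq)

lemma coef_pull_other: "\<not> A \<subseteq> range Inl \<Longrightarrow> coef (pull f) A x = 0"
  by (simp add: coef_pull)

lemma pull_eqI:
  assumes "\<And>A x. coef g (Inl ` A) x = coef f A (\<chi> a. x $ Inl a)"
    and "\<And>A x. \<not> A \<subseteq> range Inl \<Longrightarrow> coef g A x = 0"
  shows "g = pull f"
proof (rule sfun_eqI)
  fix A x
  show "coef g A x = coef (pull f) A x"
    using assms by (cases "A \<subseteq> range Inl") (auto simp: coef_pull_image coef_pull_other subset_image_iff)
qed

lemma pull_zero [simp]: "pull 0 = 0"
  and pull_add: "pull (f + g) = pull f + pull g"
  and pull_scaleR: "pull (c *\<^sub>R f) = c *\<^sub>R pull f"
  by (rule sfun_eqI; simp add: coef_pull)+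

lemma pull_one [simp]: "pull 1 = 1"
  by (rule pull_eqI[symmetric]) (auto simp: coef_one)

lemma pull_sum: "pull (sum f I) = (\<Sum>i\<in>I. pull (f i))"
  by (induction I rule: infinite_finite_induct) (auto simp: pull_add)

lemma sum_Pow_image_Inl: "(\<Sum>B\<in>Pow (Inl ` A). F B) = (\<Sum>B\<in>Pow A. F (Inl ` B))"
  for F :: "('a + 'b) set \<Rightarrow> real"
proof -
  have "Pow (Inl ` A :: ('a + 'b) set) = image Inl ` Pow A" by (simp add: image_Pow_surj)
  moreover have "inj_on (image (Inl :: 'a \<Rightarrow> 'a + 'b)) (Pow A)" by (rule inj_on_image_Pow) simp
  ultimately show ?thesis by (simp add: sum.reindex)
qed

lemma image_Inl_diff: "Inl ` A - Inl ` B = Inl ` (A - B)"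
  by (simp add: image_set_diff)

lemma pull_mult: "pull (f * g) = pull f * pull g"
proof (rule pull_eqI[symmetric])
  show "coef (pull f * pull g) (Inl ` A) x = coef (f * g) A (\<chi> a. x $ Inl a)" for A x
    by (simp add: coef_mult sum_Pow_image_Inl image_Inl_diff coef_pull_image inversions_Inl)
  show "coef (pull f * pull g) A x = 0" if "\<not> A \<subseteq> range Inl" for A x
  proof (rule ccontr)
    assume "coef (pull f * pull g) A x \<noteq> 0"
    then obtain B where "B \<in> Pow A" "coef (pull f) B x \<noteq> 0" "coef (pull g) (A - B) x \<noteq> 0"
      by (rule coef_mult_nonzeroE)
    then have "B \<subseteq> range Inl" "A - B \<subseteq> range Inl" by (auto simp: coef_pull split: if_splits)
    then show False using that by blast
  qed
qed

lemma bounded_linear_vec_lambda: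
  fixes f :: "real ^ 'a::finite \<Rightarrow> 'b::finite \<Rightarrow> real"
  assumes "\<And>i. bounded_linear (\<lambda>x. f x i)"
  shows "bounded_linear (\<lambda>x. \<chi> i. f x i)"
proof -
  have "linear (\<lambda>x. f x i)" for i using assms linear_conv_bounded_linear by blast
  then have "linear (\<lambda>x. \<chi> i. f x i)"
    by (auto intro!: linearI simp: vec_eq_iff linear_add[of "\<lambda>x. f x _"] linear_scale[of "\<lambda>x. f x _"])
  then show ?thesis using linear_conv_bounded_linear by blast
qed

lemma bounded_linear_base: "bounded_linear (\<lambda>x :: real ^ ('a::finite + 'b::finite). \<chi> a. x $ Inl a)"
  by (rule bounded_linear_vec_lambda[OF bounded_linear_vec_nth])

lemma base_axis: "(\<chi> a. (axis (Inl b) 1 :: real ^ ('a::finite + 'b::finite)) $ Inl a) = axis b 1"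
  "(\<chi> a. (axis (Inr c) 1 :: real ^ ('a::finite + 'b::finite)) $ Inl a) = (0 :: real ^ 'a)"
  by (auto simp: axis_def vec_eq_iff)

lemma card_vimage_Inl: "A \<subseteq> range Inl \<Longrightarrow> card (Inl -` A) = card A"
  by (simp add: card_vimage_inj)

lemma has_parity_pull: "has_parity e f \<Longrightarrow> has_parity e (pull f)"
  by (auto simp: has_parity_def coef_pull card_vimage_Inl split: if_splits)

lemma cinf_pull: assumes "f \<in> cinf p" shows "pull f \<in> cinf (ct p)"
proof (rule cinfI)
  show "smooth (coef (pull f) A)" for A
  proof (cases "A \<subseteq> range Inl")
    case True
    have "smooth (\<lambda>x :: real ^ ('a + 'a). coef f (Inl -` A) (\<chi> a. x $ Inl a))"
    proof (rule smooth_compose_linear[OF bounded_linear_base _ cinf_smooth[OF assms]])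
      fix d :: "'a + 'a"
      show "(\<chi> a. (axis d 1 :: real ^ ('a + 'a)) $ Inl a) = 0
        \<or> (\<exists>c. (\<chi> a. (axis d 1 :: real ^ ('a + 'a)) $ Inl a) = axis c 1)"
        by (cases d) (auto simp: base_axis)
    qed
    then show ?thesis using True by (simp add: pull_def)
  qed (simp add: pull_def)
  show "A \<subseteq> {a. odd (ct p a)}" if "coef (pull f) A x \<noteq> 0" for A x
    using that cinf_support[OF assms, of "Inl -` A" "\<chi> a. x $ Inl a"]
    by (fastforce simp: coef_pull split: if_splits)
  show "coef (pull f) A x = coef (pull f) A y" if "\<And>a. even (ct p a) \<Longrightarrow> x $ a = y $ a" for A x y
    unfolding coef_pull using that[of "Inl _"] by (auto intro!: cinf_eqI[OF assms])
qed

lemma pd_pull: assumes "f \<in> cinf p" shows "pd (ct p) (Inl a) (pull f) = pull (pd p a f)"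
proof (rule pull_eqI)
  show "coef (pd (ct p) (Inl a) (pull f)) (Inl ` A) x = coef (pd p a f) A (\<chi> a. x $ Inl a)" for A x
  proof (cases "odd (p a)")
    case True
    have "inversions {Inl a :: 'a + 'a} (Inl ` A) = inversions {a} A"
      using inversions_Inl[of "{a}" A] by simp
    moreover have "coef (pull f) (insert (Inl a) (Inl ` A)) x = coef f (insert a A) (\<chi> a. x $ Inl a)"
      using coef_pull_image[of f "insert a A" x] by simp
    ultimately show ?thesis using True by (auto simp: coef_pd_odd)
  next
    case False
    have "coef (pull f) (Inl ` A) = (\<lambda>x. coef f A (\<chi> a. x $ Inl a))"
      by (auto simp: coef_pull_image)
    then show ?thesis
      using False frechet_derivative_compose_linear[OF bounded_linear_base cinf_differentiable[OF assms], of A x]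
      by (simp add: coef_pd_even base_axis)
  qed
  show "coef (pd (ct p) (Inl a) (pull f)) A x = 0" if "\<not> A \<subseteq> range Inl" for A x
  proof (cases "odd (p a)")
    case True
    then show ?thesis using that by (auto simp: coef_pd_odd coef_pull)
  next
    case False
    then show ?thesis using that by (auto simp: coef_pd_even pull_def)
  qed
qed

lemma pd_Inr_pull: assumes "f \<in> cinf p" shows "pd (ct p) (Inr a) (pull f) = 0"
proof (rule sfun_eqI)
  fix A x
  show "coef (pd (ct p) (Inr a) (pull f)) A x = coef 0 A x"
  proof (cases "odd (p a)")
    case True
    then show ?thesis by (auto simp: coef_pd_odd coef_pull)
  next
    case False
    have "linear (frechet_derivative (coef f (Inl -` A)) (at (\<chi> a. x $ Inl a)))"
      by (intro linear_frechet_derivative cinf_differentiable[OF assms])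
    then show ?thesis
      using False frechet_derivative_compose_linear[OF bounded_linear_base cinf_differentiable[OF assms], of "Inl -` A" x]
      by (cases "A \<subseteq> range Inl") (auto simp: coef_pd_even pull_def base_axis linear_0)
  qed
qed

lemma pull_crd: "pull (crd p a) = crd (ct p) (Inl a)"
proof (rule pull_eqI[symmetric])
  have "Inl ` A = {Inl a} \<longleftrightarrow> A = {a}" for A :: "'a set" by auto
  then show "coef (crd (ct p) (Inl a)) (Inl ` A) x = coef (crd p a) A (\<chi> a. x $ Inl a)" for A x
    by (auto simp: crd_def)
qed (auto simp: crd_def)

lemma coef_zero_section:
  "coef (zero_section h) A x = coef h (Inl ` A) (\<chi> c. case_sum (\<lambda>a. x $ a) (\<lambda>_. 0) c)"
  by (simp add: zero_section_def)

lemma zero_section_zero [simp]: "zero_section 0 = 0"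
  and zero_section_add: "zero_section (f + g) = zero_section f + zero_section g"
  and zero_section_diff: "zero_section (f - g) = zero_section f - zero_section g"
  and zero_section_minus: "zero_section (- f) = - zero_section f"
  and zero_section_scaleR: "zero_section (c *\<^sub>R f) = c *\<^sub>R zero_section f"
  by (rule sfun_eqI; simp add: coef_zero_section)+

lemma zero_section_sum: "zero_section (sum f I) = (\<Sum>i\<in>I. zero_section (f i))"
  by (induction I rule: infinite_finite_induct) (auto simp: zero_section_add)

lemma zero_section_mult: "zero_section (f * g) = zero_section f * zero_section g"
  by (rule sfun_eqI)
    (simp add: coef_mult coef_zero_section sum_Pow_image_Inl image_Inl_diff inversions_Inl)

lemma zero_section_pull [simp]: "zero_section (pull f) = f"
  by (rule sfun_eqI) (simp add: coef_zero_section coef_pull_image)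

lemma zero_section_mom [simp]: "zero_section (mom p a) = 0"
  by (rule sfun_eqI) (auto simp: coef_zero_section crd_def)

lemma bounded_linear_zero_section:
  "bounded_linear (\<lambda>x. \<chi> c::'a::finite + 'b::finite. case_sum (\<lambda>a. x $ a) (\<lambda>_. 0 :: real) c)"
proof (rule bounded_linear_vec_lambda)
  fix c :: "'a + 'b"
  show "bounded_linear (\<lambda>x :: real ^ 'a. case_sum (\<lambda>a. x $ a) (\<lambda>_. 0) c)"
    by (cases c) (auto intro: bounded_linear_vec_nth)
qed

lemma zero_section_axis:
  "(\<chi> c. case_sum (\<lambda>b. (axis a 1 :: real ^ 'a) $ b) (\<lambda>_. 0) c) = (axis (Inl a) 1 :: real ^ ('a::finite + 'b::finite))"
  unfolding vec_eq_iff axis_def by (auto split: sum.splits)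

lemma zero_section_pd:
  assumes "F \<in> cinf (ct p)"
  shows "zero_section (pd (ct p) (Inl a) F) = pd p a (zero_section F)"
proof (rule sfun_eqI)
  fix A x
  show "coef (zero_section (pd (ct p) (Inl a) F)) A x = coef (pd p a (zero_section F)) A x"
  proof (cases "odd (p a)")
    case True
    have "inversions {Inl a :: 'a + 'a} (Inl ` A) = inversions {a} A"
      using inversions_Inl[of "{a}" A] by simp
    then show ?thesis using True by (auto simp: coef_pd_odd coef_zero_section)
  next
    case False
    have "coef (zero_section F) A = (\<lambda>x. coef F (Inl ` A) (\<chi> c. case_sum (\<lambda>a. x $ a) (\<lambda>_. 0) c))"
      by (auto simp: coef_zero_section)
    then show ?thesis
      using False frechet_derivative_compose_linear[OF bounded_linear_zero_section cinf_differentiable[OF assms], of "Inl ` A" x]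
      by (simp add: coef_zero_section coef_pd_even zero_section_axis)
  qed
qed

subsection \<open>The Poisson bracket\<close>

text \<open>One parity part of a homogeneous function is the function itself and the other is 0, so
  the sum over parities in \<open>poisson\<close> collapses; \<open>e\<close> matters only modulo
  2.\<close>

lemma ham_field_Inl:
  assumes "has_parity e f"
  shows "ham_field p f (Inl a) = (-1) ^ (p a * (e + 1)) *\<^sub>R pd (ct p) (Inr a) f"
    and "ham_field p f (Inr a) = - ((-1) ^ (p a * e) *\<^sub>R pd (ct p) (Inl a) f)"
proof -
  have delta: "(\<Sum>b\<in>UNIV. c b *\<^sub>R (g b * (if a = b then 1 else 0))) = c a *\<^sub>R g a"
    for c and g :: "'a \<Rightarrow> ('a + 'a) sfun"
  proof -
    have "(\<Sum>b\<in>UNIV. c b *\<^sub>R (g b * (if a = b then 1 else 0))) = (\<Sum>b\<in>UNIV. if b = a then c b *\<^sub>R g b else 0)"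
      by (rule sum.cong) auto
    then show ?thesis by simp
  qed
  have "ham_field p f (Inl a) = (-1) ^ (p a * (0 + 1)) *\<^sub>R pd (ct p) (Inr a) (parity_part 0 f)
      + (-1) ^ (p a * (1 + 1)) *\<^sub>R pd (ct p) (Inr a) (parity_part 1 f)"
    and "ham_field p f (Inr a) = - ((-1) ^ (p a * 0) *\<^sub>R pd (ct p) (Inl a) (parity_part 0 f))
      - (-1) ^ (p a * 1) *\<^sub>R pd (ct p) (Inl a) (parity_part 1 f)"
    unfolding ham_field_def poisson_def pd_crd
    by (simp_all add: sum_negf delta eq_commute[of _ a] del: power_mult)
  moreover have "parity_part 0 f = f \<and> parity_part 1 f = 0" if "even e"
    using parity_part_same[OF assms] parity_part_cong[of 0 e f] parity_part_other[OF assms, of 1] that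
    by auto
  moreover have "parity_part 1 f = f \<and> parity_part 0 f = 0" if "odd e"
    using parity_part_same[OF assms] parity_part_cong[of 1 e f] parity_part_other[OF assms, of 0] that
    by auto
  ultimately show "ham_field p f (Inl a) = (-1) ^ (p a * (e + 1)) *\<^sub>R pd (ct p) (Inr a) f"
    and "ham_field p f (Inr a) = - ((-1) ^ (p a * e) *\<^sub>R pd (ct p) (Inl a) f)"
    by (cases "even e"; cases "even (p a)"; simp)+
qed

text \<open>Holds for inhomogeneous \<open>f\<close> as well. It transfers linearity, the Leibniz
  rule and the commutator formula from vector fields to the Poisson bracket.\<close>

lemma poisson_vact: "poisson p f g = vact (ct p) (ham_field p f) g"
proof -
  have delta: "(\<Sum>b\<in>UNIV. c b *\<^sub>R (g b * (if b = a then 1 else 0))) = c a *\<^sub>R g a"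
    for c and g :: "'a \<Rightarrow> ('a + 'a) sfun" and a
  proof -
    have "(\<Sum>b\<in>UNIV. c b *\<^sub>R (g b * (if b = a then 1 else 0))) = (\<Sum>b\<in>UNIV. if b = a then c b *\<^sub>R g b else 0)"
      by (rule sum.cong) auto
    then show ?thesis by simp
  qed
  have "ham_field p f (Inl a) = (\<Sum>e\<in>{0,1}. (-1) ^ (p a * (e + 1)) *\<^sub>R pd (ct p) (Inr a) (parity_part e f))"
    and "ham_field p f (Inr a) = (\<Sum>e\<in>{0,1}. - ((-1) ^ (p a * e) *\<^sub>R pd (ct p) (Inl a) (parity_part e f)))" for a
    unfolding ham_field_def poisson_def pd_crd
    by (simp_all add: sum_negf delta del: power_mult)
  then show ?thesis
    unfolding poisson_def vact_def sum_UNIV_Plus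
    by (simp add: sum.distrib sum_subtractf sum_negf distrib_right left_diff_distrib)
qed

lemma ham_field_vector_field:
  assumes "has_parity e f" "f \<in> cinf (ct p)"
  shows "vector_field (ct p) e (ham_field p f)"
  unfolding vector_field_def
proof
  fix c
  show "ham_field p f c \<in> cinf (ct p) \<and> has_parity (e + ct p c) (ham_field p f c)"
    using has_parity_pd[OF assms(1), of "ct p"] assms(2)
    by (cases c) (auto simp: ham_field_Inl[OF assms(1)] intro!: cinf_scaleR cinf_pd cinf_minus
        has_parity_minus has_parity_scaleR; metis ct_simps)+
qed

lemma parity_part_add: "parity_part e (f + g) = parity_part e f + parity_part e g"
  and parity_part_scaleR: "parity_part e (c *\<^sub>R f) = c *\<^sub>R parity_part e f"
  by (rule sfun_eqI; simp add: parity_part_def)+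

lemma poisson_add_left:
  "f \<in> cinf (ct p) \<Longrightarrow> g \<in> cinf (ct p) \<Longrightarrow> poisson p (f + g) h = poisson p f h + poisson p g h"
  unfolding poisson_def
  by (simp add: parity_part_add pd_add cinf_parity_part distrib_right scaleR_add_right sum.distrib
      sum_subtractf del: power_mult)

lemma poisson_scaleR_left:
  "f \<in> cinf (ct p) \<Longrightarrow> poisson p (c *\<^sub>R f) h = c *\<^sub>R poisson p f h"
  unfolding poisson_def
  by (simp add: parity_part_scaleR pd_scaleR cinf_parity_part scaleR_add_right
      scaleR_diff_right scaleR_sum_right sum_subtractf mult.commute del: power_mult)

lemma poisson_zero_left [simp]: "poisson p 0 h = 0"
  using poisson_scaleR_left[of 0 p 0 h] by simp

lemma poisson_zero_right [simp]: "poisson p f 0 = 0"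
  by (simp add: poisson_vact)

lemma poisson_minus_left: "f \<in> cinf (ct p) \<Longrightarrow> poisson p (- f) h = - poisson p f h"
  using poisson_scaleR_left[of f p "-1" h] by simp

lemma poisson_sum_left:
  "(\<And>i. i \<in> I \<Longrightarrow> f i \<in> cinf (ct p)) \<Longrightarrow> poisson p (sum f I) h = (\<Sum>i\<in>I. poisson p (f i) h)"
  by (induction I rule: infinite_finite_induct) (auto simp: poisson_add_left cinf_sum)

lemma poisson_add_right:
  "g \<in> cinf (ct p) \<Longrightarrow> h \<in> cinf (ct p) \<Longrightarrow> poisson p f (g + h) = poisson p f g + poisson p f h"
  by (simp add: poisson_vact vact_add)

lemma poisson_scaleR_right:
  "g \<in> cinf (ct p) \<Longrightarrow> poisson p f (c *\<^sub>R g) = c *\<^sub>R poisson p f g"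
  by (simp add: poisson_vact vact_scaleR)

lemma poisson_minus_right: "g \<in> cinf (ct p) \<Longrightarrow> poisson p f (- g) = - poisson p f g"
  using poisson_scaleR_right[of g p f "-1"] by simp

lemma poisson_diff_right:
  "g \<in> cinf (ct p) \<Longrightarrow> h \<in> cinf (ct p) \<Longrightarrow> poisson p f (g - h) = poisson p f g - poisson p f h"
  using poisson_add_right[of g p "- h" f] by (simp add: poisson_minus_right cinf_minus)

lemma poisson_sum_right:
  "(\<And>i. i \<in> I \<Longrightarrow> g i \<in> cinf (ct p)) \<Longrightarrow> poisson p f (sum g I) = (\<Sum>i\<in>I. poisson p f (g i))"
  by (simp add: poisson_vact vact_sum)

lemma cinf_poisson:
  assumes "f \<in> cinf (ct p)" "g \<in> cinf (ct p)"
  shows "poisson p f g \<in> cinf (ct p)"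
  unfolding poisson_def
  by (intro cinf_sum cinf_diff cinf_scaleR cinf_mult cinf_pd cinf_parity_part assms)

lemma has_parity_poisson:
  assumes "has_parity e f" "f \<in> cinf (ct p)" "has_parity e' g"
  shows "has_parity (e + e') (poisson p f g)"
  unfolding poisson_vact by (rule has_parity_vact[OF ham_field_vector_field[OF assms(1,2)] assms(3)])

lemma poisson_crd: "poisson p f (crd (ct p) c) = ham_field p f c"
  by (simp add: ham_field_def)

text \<open>Supercommuting the two factors in each term exchanges the two sums of which the bracket
  is the difference.\<close>

lemma poisson_antisym:
  assumes f: "has_parity e f" and g: "has_parity e' g"
  shows "poisson p f g = - ((-1) ^ (e * e') *\<^sub>R poisson p g f)"
proof -
  have 1: "(-1) ^ (p a * (e + 1)) *\<^sub>R (pd (ct p) (Inr a) f * pd (ct p) (Inl a) g)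
    = (-1) ^ (e * e') *\<^sub>R ((-1) ^ (p a * e') *\<^sub>R (pd (ct p) (Inl a) g * pd (ct p) (Inr a) f))"
    if f: "has_parity e f" and g: "has_parity e' g" for e e' f g a
  proof -
    have "pd (ct p) (Inr a) f * pd (ct p) (Inl a) g
      = (-1) ^ ((e + ct p (Inr a)) * (e' + ct p (Inl a))) *\<^sub>R (pd (ct p) (Inl a) g * pd (ct p) (Inr a) f)"
      by (intro mult_supercomm has_parity_pd f g)
    then show ?thesis
      by (cases "even e"; cases "even e'"; cases "even (p a)") simp_all
  qed
  have 2: "poisson p f g = (\<Sum>a\<in>UNIV. (-1) ^ (p a * (e + 1)) *\<^sub>R (pd (ct p) (Inr a) f * pd (ct p) (Inl a) g))
     - (\<Sum>a\<in>UNIV. (-1) ^ (p a * e) *\<^sub>R (pd (ct p) (Inl a) f * pd (ct p) (Inr a) g))"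
    if "has_parity e f" for e f g
    unfolding poisson_vact vact_def sum_UNIV_Plus ham_field_Inl[OF that]
    by (simp add: sum_negf del: power_mult)
  have "(-1) ^ (p a * e) *\<^sub>R (pd (ct p) (Inl a) f * pd (ct p) (Inr a) g)
    = (-1) ^ (e * e') *\<^sub>R ((-1) ^ (p a * (e' + 1)) *\<^sub>R (pd (ct p) (Inr a) g * pd (ct p) (Inl a) f))" for a
    using 1[OF g f, of a] by (cases "even (e * e')") (simp_all add: mult.commute)
  then show ?thesis
    unfolding 2[OF f] 2[OF g] 1[OF f g] by (simp add: scaleR_sum_right scaleR_diff_right)
qed

text \<open>No sign remains: the one from commuting the two derivatives is absorbed by the change of
  parity from \<open>e\<close> to \<open>e + ct p c\<close> in \<open>ham_field_Inl\<close>.\<close>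

lemma ham_field_pd:
  assumes "has_parity e f" "f \<in> cinf (ct p)"
  shows "pd (ct p) c (ham_field p f d) = ham_field p (pd (ct p) c f) d"
proof -
  have c: "pd (ct p) c (pd (ct p) b f) = (-1) ^ (ct p c * ct p b) *\<^sub>R pd (ct p) b (pd (ct p) c f)" for b
    by (rule pd_commute[OF assms(2)])
  show ?thesis
    using c[of "Inl (projl d)"] c[of "Inr (projr d)"] c[of "Inr (projl d)"] c[of "Inl (projr d)"] assms(2)
    by (cases d; cases "even e"; cases "even (ct p c)"; cases "even (ct p d)")
      (simp_all add: ham_field_Inl[OF assms(1)] ham_field_Inl[OF has_parity_pd[OF assms(1)]] pd_scaleR
        pd_minus cinf_pd cinf_minus cinf_scaleR)
qed

lemma pd_poisson:
  assumes f: "has_parity e f" "f \<in> cinf (ct p)" and g: "g \<in> cinf (ct p)"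
  shows "pd (ct p) c (poisson p f g)
    = poisson p (pd (ct p) c f) g + (-1) ^ (ct p c * e) *\<^sub>R poisson p f (pd (ct p) c g)"
proof -
  note X = ham_field_vector_field[OF f]
  have "pd (ct p) c (poisson p f g) = (\<Sum>d\<in>UNIV. pd (ct p) c (ham_field p f d * pd (ct p) d g))"
    unfolding poisson_vact vact_def
    by (intro pd_sum cinf_mult cinf_pd vector_field_cinf[OF X] g)
  also have "\<dots> = (\<Sum>d\<in>UNIV. ham_field p (pd (ct p) c f) d * pd (ct p) d g
      + (-1) ^ (ct p c * e) *\<^sub>R (ham_field p f d * pd (ct p) d (pd (ct p) c g)))"
  proof (rule sum.cong)
    fix d
    show "pd (ct p) c (ham_field p f d * pd (ct p) d g) = ham_field p (pd (ct p) c f) d * pd (ct p) d g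
      + (-1) ^ (ct p c * e) *\<^sub>R (ham_field p f d * pd (ct p) d (pd (ct p) c g))"
      unfolding pd_mult[OF vector_field_parity[OF X] vector_field_cinf[OF X] cinf_pd[OF g]]
        ham_field_pd[OF f] pd_commute[OF g, of c d]
      by (cases "even (ct p c)"; cases "even e"; cases "even (ct p d)") simp_all
  qed simp
  finally show ?thesis
    by (simp add: poisson_vact vact_def sum.distrib scaleR_sum_right)
qed

text \<open>Both sides are derivations of \<open>h\<close>; on coordinates the identity says that the partial
  derivatives are derivations of the bracket.\<close>

lemma poisson_jacobi:
  assumes f: "has_parity e f" "f \<in> cinf (ct p)" and g: "has_parity e' g" "g \<in> cinf (ct p)"
    and h: "h \<in> cinf (ct p)"
  shows "poisson p f (poisson p g h)
    = poisson p (poisson p f g) h + (-1) ^ (e * e') *\<^sub>R poisson p g (poisson p f h)"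
proof -
  let ?X = "ham_field p f" and ?Y = "ham_field p g"
  have "vcomm (ct p) e ?X e' ?Y c = ham_field p (poisson p f g) c" for c
  proof -
    have fg: "has_parity (e + e') (poisson p f g)"
      by (rule has_parity_poisson[OF f g(1)])
    have anti: "poisson p g (pd (ct p) c f) = - ((-1) ^ (e' * (e + ct p c)) *\<^sub>R poisson p (pd (ct p) c f) g)" for c
      by (rule poisson_antisym[OF g(1) has_parity_pd[OF f(1)]])
    show ?thesis
      unfolding vcomm_def poisson_vact[symmetric]
      by (cases c; cases "even e"; cases "even e'"; cases "even (ct p c)")
        (simp_all add: ham_field_Inl[OF fg] ham_field_Inl[OF f(1)] ham_field_Inl[OF g(1)]
          pd_poisson[OF f g(2)] poisson_scaleR_right poisson_minus_right cinf_pd cinf_minus cinf_scaleR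
          f g anti)
  qed
  then have "vcomm (ct p) e ?X e' ?Y = ham_field p (poisson p f g)" by blast
  then show ?thesis
    using vact_vcomm[OF ham_field_vector_field[OF f] ham_field_vector_field[OF g] h]
    by (simp add: poisson_vact diff_eq_eq)
qed

subsection \<open>Hamiltonians of vector fields\<close>

lemma cinf_ham: "vector_field p e X \<Longrightarrow> ham p X \<in> cinf (ct p)"
  unfolding ham_def by (intro cinf_sum cinf_mult cinf_pull cinf_crd) (auto simp: vector_field_def)

lemma has_parity_mom: "has_parity (p a) (mom p a)"
  using has_parity_crd[of "ct p" "Inr a"] by simp

lemma has_parity_ham:
  assumes X: "vector_field p e X" shows "has_parity e (ham p X)"
  unfolding ham_def
proof (rule has_parity_sum)
  fix a
  have "has_parity ((e + p a) + p a) (pull (X a) * mom p a)"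
    by (intro has_parity_mult has_parity_pull vector_field_parity[OF X] has_parity_mom)
  then show "has_parity e (pull (X a) * mom p a)"
    by (rule has_parity_cong[rotated]) (simp; argo)
qed

lemma sum_delta_mult: "(\<Sum>b\<in>UNIV. g b * (if a = b then 1 else 0)) = g a"
  "(\<Sum>b\<in>UNIV. (if a = b then 1 else 0) * g b) = g a"
  for g :: "'a::finite \<Rightarrow> 'c::{finite,linorder} sfun"
proof -
  have "(\<Sum>b\<in>UNIV. g b * (if a = b then 1 else 0)) = (\<Sum>b\<in>UNIV. if a = b then g b else 0)"
    "(\<Sum>b\<in>UNIV. (if a = b then 1 else 0) * g b) = (\<Sum>b\<in>UNIV. if a = b then g b else 0)"
    by (rule sum.cong; simp)+
  then show "(\<Sum>b\<in>UNIV. g b * (if a = b then 1 else 0)) = g a"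
    "(\<Sum>b\<in>UNIV. (if a = b then 1 else 0) * g b) = g a" by simp_all
qed

lemma pd_Inr_ham:
  assumes X: "vector_field p e X"
  shows "pd (ct p) (Inr a) (ham p X) = (-1) ^ (p a * (e + p a)) *\<^sub>R pull (X a)"
proof -
  have "pd (ct p) (Inr a) (ham p X) = (\<Sum>b\<in>UNIV. pd (ct p) (Inr a) (pull (X b) * mom p b))"
    unfolding ham_def
    by (intro pd_sum cinf_mult cinf_pull vector_field_cinf[OF X] cinf_crd)
  also have "\<dots> = (\<Sum>b\<in>UNIV. ((-1) ^ (p a * (e + p b)) *\<^sub>R pull (X b)) * (if a = b then 1 else 0))"
    by (rule sum.cong)
      (simp_all add: pd_mult[OF has_parity_pull[OF vector_field_parity[OF X]]
          cinf_pull[OF vector_field_cinf[OF X]] cinf_crd] pd_Inr_pull vector_field_cinf[OF X] pd_crd)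
  finally show ?thesis by (simp only: sum_delta_mult)
qed

lemma ham_field_ham:
  assumes X: "vector_field p e X" shows "ham_field p (ham p X) (Inl a) = pull (X a)"
  unfolding ham_field_Inl(1)[OF has_parity_ham[OF X]] pd_Inr_ham[OF X]
  by (cases "even e"; cases "even (p a)") simp_all

lemma poisson_ham_pull:
  assumes X: "vector_field p e X" and f: "f \<in> cinf p"
  shows "poisson p (ham p X) (pull f) = pull (vact p X f)"
  unfolding poisson_vact vact_def sum_UNIV_Plus
  by (simp add: ham_field_ham[OF X] pd_pull pd_Inr_pull f pull_sum pull_mult)

text \<open>The function \<open>ham p X\<close> vanishes on the zero section, hence so do its base
  derivatives, which are the momentum components of its Hamiltonian field. That field is therefore
  tangent to the zero section and restricts to \<open>X\<close> there.\<close>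

lemma zero_section_poisson_ham:
  assumes X: "vector_field p e X" and F: "F \<in> cinf (ct p)"
  shows "zero_section (poisson p (ham p X) F) = vact p X (zero_section F)"
proof -
  have "zero_section (ham p X) = 0"
    by (simp add: ham_def zero_section_sum zero_section_mult)
  then have "zero_section (ham_field p (ham p X) (Inr a)) = 0" for a
    by (simp add: ham_field_Inl(2)[OF has_parity_ham[OF X]] zero_section_minus zero_section_scaleR
        zero_section_pd cinf_ham[OF X])
  then show ?thesis
    unfolding poisson_vact vact_def sum_UNIV_Plus
    by (simp add: zero_section_add zero_section_sum zero_section_mult ham_field_ham[OF X]
        zero_section_pd F)
qed

subsection \<open>Functions that are homogeneous along the fibers\<close>

text \<open>Polynomials homogeneous of degree \<open>k\<close> in the momenta, with coefficients
  pulled back from the base. Splitting off momenta on the left suits left derivatives and induction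
  on the degree.\<close>

primrec fiber_hom :: "('c::{finite,linorder} \<Rightarrow> nat) \<Rightarrow> nat \<Rightarrow> ('c + 'c) sfun set" where
  "fiber_hom p 0 = pull ` cinf p"
| "fiber_hom p (Suc k) = {(\<Sum>a\<in>UNIV. mom p a * F a) | F. \<forall>a. F a \<in> fiber_hom p k}"

lemma fiber_hom_SucE:
  assumes "F \<in> fiber_hom p (Suc k)"
  obtains G where "F = (\<Sum>a\<in>UNIV. mom p a * G a)" "\<And>a. G a \<in> fiber_hom p k"
  using assms by auto

lemma fiber_hom_SucI:
  "(\<And>a. G a \<in> fiber_hom p k) \<Longrightarrow> (\<Sum>a\<in>UNIV. mom p a * G a) \<in> fiber_hom p (Suc k)"
  by auto

lemma cinf_fiber_hom: "F \<in> fiber_hom p k \<Longrightarrow> F \<in> cinf (ct p)"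
  by (induction k arbitrary: F) (auto intro!: cinf_pull cinf_sum cinf_mult)

declare fiber_hom.simps(2) [simp del]

lemma fiber_hom_zero [simp]: "0 \<in> fiber_hom p k"
proof (induction k)
  case 0
  then show ?case using imageI[OF cinf_zero, of pull p] by simp
next
  case (Suc k)
  then show ?case using fiber_hom_SucI[of "\<lambda>_. 0" p k] by simp
qed

lemma fiber_hom_add: "F \<in> fiber_hom p k \<Longrightarrow> G \<in> fiber_hom p k \<Longrightarrow> F + G \<in> fiber_hom p k"
proof (induction k arbitrary: F G)
  case 0
  then show ?case by (auto simp flip: pull_add intro!: cinf_add)
next
  case (Suc k)
  obtain F' where "F = (\<Sum>a\<in>UNIV. mom p a * F' a)" "\<And>a. F' a \<in> fiber_hom p k"
    by (rule fiber_hom_SucE[OF Suc.prems(1)]) blast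
  moreover obtain G' where "G = (\<Sum>a\<in>UNIV. mom p a * G' a)" "\<And>a. G' a \<in> fiber_hom p k"
    by (rule fiber_hom_SucE[OF Suc.prems(2)]) blast
  ultimately show ?case
    using fiber_hom_SucI[of "\<lambda>a. F' a + G' a" p k] Suc.IH by (simp add: distrib_left sum.distrib)
qed

lemma fiber_hom_scaleR: "F \<in> fiber_hom p k \<Longrightarrow> c *\<^sub>R F \<in> fiber_hom p k"
proof (induction k arbitrary: F)
  case 0
  then show ?case by (auto simp flip: pull_scaleR intro!: cinf_scaleR)
next
  case (Suc k)
  obtain F' where "F = (\<Sum>a\<in>UNIV. mom p a * F' a)" "\<And>a. F' a \<in> fiber_hom p k"
    using Suc.prems by (auto elim: fiber_hom_SucE)
  then show ?case
    using fiber_hom_SucI[of "\<lambda>a. c *\<^sub>R F' a" p k] Suc.IH by (simp add: scaleR_sum_right)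
qed

lemma fiber_hom_diff: "F \<in> fiber_hom p k \<Longrightarrow> G \<in> fiber_hom p k \<Longrightarrow> F - G \<in> fiber_hom p k"
  using fiber_hom_add[of F p k "(-1) *\<^sub>R G"] fiber_hom_scaleR[of G p k "-1"] by simp

lemma fiber_hom_sum: "(\<And>i. i \<in> I \<Longrightarrow> F i \<in> fiber_hom p k) \<Longrightarrow> sum F I \<in> fiber_hom p k"
  by (induction I rule: infinite_finite_induct) (auto intro: fiber_hom_add)

lemma fiber_hom_mom:
  assumes "F \<in> fiber_hom p k" shows "mom p a * F \<in> fiber_hom p (Suc k)"
proof -
  have "(\<Sum>b\<in>UNIV. mom p b * (if b = a then F else 0)) = (\<Sum>b\<in>UNIV. if b = a then mom p b * F else 0)"
    by (rule sum.cong) auto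
  then show ?thesis
    using fiber_hom_SucI[of "\<lambda>b. if b = a then F else 0" p k] assms by simp
qed

lemma pull_parity_part: "parity_part e (pull f) = pull (parity_part e f)"
  by (rule sfun_eqI) (auto simp: parity_part_def coef_pull card_vimage_Inl)

lemma parity_part_sum: "parity_part e (sum f I) = (\<Sum>i\<in>I. parity_part e (f i))"
proof -
  have "parity_part e 0 = 0" by (rule sfun_eqI) (simp add: parity_part_def)
  then show ?thesis
    by (induction I rule: infinite_finite_induct) (auto simp: parity_part_add)
qed

lemma parity_part_mult:
  assumes "has_parity e' f" shows "parity_part e (f * g) = f * parity_part (e + e') g"
proof -
  have "f * g = f * parity_part (e + e') g + f * parity_part (e + e' + 1) g"
    unfolding distrib_left[symmetric] by (rule arg_cong, rule sfun_eqI) (auto simp: parity_part_def)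
  moreover have "has_parity e (f * parity_part (e + e') g)"
    by (rule has_parity_cong[OF _ has_parity_mult[OF assms has_parity_parity_part]]) (simp; argo)
  moreover have "has_parity (e + 1) (f * parity_part (e + e' + 1) g)"
    by (rule has_parity_cong[OF _ has_parity_mult[OF assms has_parity_parity_part]]) (simp; argo)
  ultimately show ?thesis
    using parity_part_same[of e "f * parity_part (e + e') g"]
      parity_part_other[of "e + 1" "f * parity_part (e + e' + 1) g" e]
    by (simp add: parity_part_add)
qed

lemma fiber_hom_parity_part: "F \<in> fiber_hom p k \<Longrightarrow> parity_part e F \<in> fiber_hom p k"
proof (induction k arbitrary: F e)
  case 0
  then show ?case by (auto simp: pull_parity_part intro!: cinf_parity_part)
next
  case (Suc k)
  obtain F' where "F = (\<Sum>a\<in>UNIV. mom p a * F' a)" "\<And>a. F' a \<in> fiber_hom p k"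
    using Suc.prems by (auto elim: fiber_hom_SucE)
  then show ?case
    using fiber_hom_SucI[of "\<lambda>a. parity_part (e + p a) (F' a)" p k] Suc.IH
    by (simp add: parity_part_sum parity_part_mult[OF has_parity_mom])
qed

text \<open>An odd momentum passes the even part of \<open>f\<close> freely and reverses the sign of
  the odd part; the parity parts express this for inhomogeneous \<open>f\<close>.\<close>

lemma pull_mom_swap:
  "pull f * (mom p a * G)
    = mom p a * (pull (parity_part 0 f + (-1) ^ p a *\<^sub>R parity_part 1 f) * G)"
proof -
  have "pull (parity_part e f) * (mom p a * G)
    = (-1) ^ (e * p a) *\<^sub>R (mom p a * (pull (parity_part e f) * G))" for e
    by (rule mult_left_supercomm[OF has_parity_pull[OF has_parity_parity_part] has_parity_mom])
  from this[of 0] this[of 1] show ?thesis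
    by (subst parity_decomp[of f]) (simp add: pull_add pull_scaleR distrib_left distrib_right)
qed

lemma fiber_hom_pull_mult: "f \<in> cinf p \<Longrightarrow> F \<in> fiber_hom p k \<Longrightarrow> pull f * F \<in> fiber_hom p k"
proof (induction k arbitrary: F f)
  case 0
  then show ?case by (auto simp flip: pull_mult intro!: cinf_mult)
next
  case (Suc k)
  obtain F' where "F = (\<Sum>a\<in>UNIV. mom p a * F' a)" "\<And>a. F' a \<in> fiber_hom p k"
    using Suc.prems by (auto elim: fiber_hom_SucE)
  then show ?case
    using fiber_hom_SucI[of "\<lambda>a. pull (parity_part 0 f + (-1) ^ p a *\<^sub>R parity_part 1 f) * F' a" p k]
      Suc.IH Suc.prems(1)
    by (simp add: sum_distrib_left pull_mom_swap cinf_add cinf_scaleR cinf_parity_part)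
qed

lemma fiber_hom_mult: "F \<in> fiber_hom p k \<Longrightarrow> G \<in> fiber_hom p l \<Longrightarrow> F * G \<in> fiber_hom p (k + l)"
proof (induction k arbitrary: F)
  case 0
  then show ?case by (auto intro: fiber_hom_pull_mult)
next
  case (Suc k)
  obtain F' where F': "F = (\<Sum>a\<in>UNIV. mom p a * F' a)" "\<And>a. F' a \<in> fiber_hom p k"
    using Suc.prems by (auto elim: fiber_hom_SucE)
  have "(\<Sum>a\<in>UNIV. mom p a * (F' a * G)) \<in> fiber_hom p (Suc (k + l))"
    by (rule fiber_hom_SucI) (intro Suc.IH F'(2) Suc.prems(2))
  then show ?case
    by (simp add: F'(1) sum_distrib_right mult.assoc del: fiber_hom.simps)
qed

section \<open>Derivatives of fiberwise homogeneous functions\<close>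

lemma pd_mom_mult:
  assumes "G \<in> cinf (ct p)"
  shows "pd (ct p) c (mom p b * G)
    = (if c = Inr b then 1 else 0) * G + (-1) ^ (ct p c * p b) *\<^sub>R (mom p b * pd (ct p) c G)"
  using pd_mult[OF has_parity_mom cinf_crd assms, of c b] by (simp add: pd_crd)

lemma fiber_hom_pd_Inl: "F \<in> fiber_hom p k \<Longrightarrow> pd (ct p) (Inl a) F \<in> fiber_hom p k"
proof (induction k arbitrary: F)
  case 0
  then show ?case by (auto simp: pd_pull intro!: cinf_pd)
next
  case (Suc k)
  obtain F' where F': "F = (\<Sum>a\<in>UNIV. mom p a * F' a)" "\<And>a. F' a \<in> fiber_hom p k"
    using Suc.prems by (auto elim: fiber_hom_SucE)
  have "pd (ct p) (Inl a) F = (\<Sum>b\<in>UNIV. pd (ct p) (Inl a) (mom p b * F' b))"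
    unfolding F'(1) by (intro pd_sum cinf_mult cinf_crd cinf_fiber_hom[OF F'(2)])
  also have "\<dots> = (\<Sum>b\<in>UNIV. mom p b * ((-1) ^ (p a * p b) *\<^sub>R pd (ct p) (Inl a) (F' b)))"
    using pd_mom_mult[OF cinf_fiber_hom[OF F'(2)], of "Inl a"] by simp
  also have "\<dots> \<in> fiber_hom p (Suc k)"
    by (intro fiber_hom_SucI fiber_hom_scaleR Suc.IH F'(2))
  finally show ?case .
qed

lemma pd_Inr_fiber_hom_0: "F \<in> fiber_hom p 0 \<Longrightarrow> pd (ct p) (Inr a) F = 0"
  by (auto simp: pd_Inr_pull)

lemma pd_Inr_SucE:
  assumes "\<And>a. G a \<in> fiber_hom p k"
  shows "pd (ct p) (Inr a) (\<Sum>b\<in>UNIV. mom p b * G b)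
    = G a + (\<Sum>b\<in>UNIV. mom p b * ((-1) ^ (p a * p b) *\<^sub>R pd (ct p) (Inr a) (G b)))"
proof -
  have "pd (ct p) (Inr a) (\<Sum>b\<in>UNIV. mom p b * G b) = (\<Sum>b\<in>UNIV. pd (ct p) (Inr a) (mom p b * G b))"
    by (intro pd_sum cinf_mult cinf_crd cinf_fiber_hom[OF assms])
  also have "\<dots> = (\<Sum>b\<in>UNIV. (if a = b then 1 else 0) * G b
      + mom p b * ((-1) ^ (p a * p b) *\<^sub>R pd (ct p) (Inr a) (G b)))"
    using pd_mom_mult[OF cinf_fiber_hom[OF assms], of "Inr a"] by simp
  finally show ?thesis by (simp only: sum.distrib sum_delta_mult)
qed

lemma fiber_hom_pd_Inr: "F \<in> fiber_hom p (Suc k) \<Longrightarrow> pd (ct p) (Inr a) F \<in> fiber_hom p k"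
proof (induction k arbitrary: F)
  case 0
  obtain F' where F': "F = (\<Sum>a\<in>UNIV. mom p a * F' a)" "\<And>a. F' a \<in> fiber_hom p 0"
    using 0 by (auto elim: fiber_hom_SucE)
  then show ?case by (simp add: pd_Inr_SucE[OF F'(2)] pd_Inr_fiber_hom_0 del: fiber_hom.simps)
next
  case (Suc k)
  obtain F' where F': "F = (\<Sum>a\<in>UNIV. mom p a * F' a)" "\<And>a. F' a \<in> fiber_hom p (Suc k)"
    using Suc.prems by (auto elim: fiber_hom_SucE)
  show ?case
    unfolding F'(1) pd_Inr_SucE[OF F'(2)]
    by (intro fiber_hom_add F'(2) fiber_hom_SucI fiber_hom_scaleR Suc.IH)
qed

text \<open>By induction on the degree. Differentiating the leading momenta returns \<open>F\<close>
  once; in the other terms the sign from passing \<open>mom p b\<close> cancels against the exchange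
  of the two momenta, leaving \<open>k\<close> further copies of \<open>F\<close>.\<close>

lemma fiber_hom_euler:
  "F \<in> fiber_hom p k \<Longrightarrow> (\<Sum>a\<in>UNIV. mom p a * pd (ct p) (Inr a) F) = real k *\<^sub>R F"
proof (induction k arbitrary: F)
  case 0
  then show ?case by (simp add: pd_Inr_fiber_hom_0 del: fiber_hom.simps)
next
  case (Suc k)
  obtain F' where F': "F = (\<Sum>a\<in>UNIV. mom p a * F' a)" "\<And>a. F' a \<in> fiber_hom p k"
    using Suc.prems by (auto elim: fiber_hom_SucE)
  have "(\<Sum>a\<in>UNIV. mom p a * (\<Sum>b\<in>UNIV. mom p b * ((-1) ^ (p a * p b) *\<^sub>R pd (ct p) (Inr a) (F' b))))
    = (\<Sum>a\<in>UNIV. \<Sum>b\<in>UNIV. mom p b * (mom p a * pd (ct p) (Inr a) (F' b)))"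
  proof -
    have "mom p a * (mom p b * ((-1) ^ (p a * p b) *\<^sub>R G)) = mom p b * (mom p a * G)" for a b G
      unfolding mult_left_supercomm[OF has_parity_mom[of p a] has_parity_mom[of p b]] by simp
    then show ?thesis unfolding sum_distrib_left by simp
  qed
  also have "\<dots> = (\<Sum>b\<in>UNIV. mom p b * (\<Sum>a\<in>UNIV. mom p a * pd (ct p) (Inr a) (F' b)))"
    unfolding sum_distrib_left by (rule sum.swap)
  also have "\<dots> = real k *\<^sub>R F"
    using Suc.IH[OF F'(2)] by (simp add: F'(1) scaleR_sum_right)
  finally show ?case
    unfolding F'(1) pd_Inr_SucE[OF F'(2)]
    by (simp add: distrib_left sum.distrib scaleR_left_distrib)
qed

text \<open>Euler's identity with a degree different from 0. Used repeatedly, it reduces the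
  vanishing of a bracket to its iterated momentum derivatives, which are functions on the
  base.\<close>

lemma fiber_hom_eq_0I:
  assumes "F \<in> fiber_hom p (Suc k)" "\<And>a. pd (ct p) (Inr a) F = 0"
  shows "F = 0"
proof -
  have "real (Suc k) *\<^sub>R F = 0"
    using fiber_hom_euler[OF assms(1)] assms(2) by simp
  then show ?thesis by simp
qed

text \<open>Each term differentiates one factor by a momentum and so lowers the total degree by one.
  For \<open>k\<close> and \<open>l\<close> both 0 the subtraction truncates, which is harmless
  because the bracket is then 0.\<close>

lemma fiber_hom_poisson:
  assumes F: "F \<in> fiber_hom p k" and G: "G \<in> fiber_hom p l"
  shows "poisson p F G \<in> fiber_hom p (k + l - 1)"
proof -
  have *: "pd (ct p) (Inr a) F * pd (ct p) (Inl b) G \<in> fiber_hom p (k + l - 1)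
    \<and> pd (ct p) (Inl b) G * pd (ct p) (Inr a) F \<in> fiber_hom p (k + l - 1)"
    if "F \<in> fiber_hom p k" "G \<in> fiber_hom p l" for F G k l a b
  proof (cases k)
    case 0
    then have "pd (ct p) (Inr a) F = 0"
      using that(1) pd_Inr_fiber_hom_0 by simp
    then show ?thesis by simp
  next
    case (Suc m)
    then have "pd (ct p) (Inr a) F \<in> fiber_hom p m" "pd (ct p) (Inl b) G \<in> fiber_hom p l"
      using that fiber_hom_pd_Inr fiber_hom_pd_Inl by blast+
    from fiber_hom_mult[OF this] fiber_hom_mult[OF this(2,1)]
    show ?thesis by (simp add: Suc add.commute)
  qed
  show ?thesis
    unfolding poisson_def
    using *[OF fiber_hom_parity_part[OF F] G] *[OF G fiber_hom_parity_part[OF F]]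
    by (intro fiber_hom_sum fiber_hom_diff fiber_hom_scaleR) (simp_all add: add.commute)
qed

lemma fiber_hom_0_pull: "F \<in> fiber_hom p 0 \<Longrightarrow> F = pull (zero_section F)"
  by auto

lemma fiber_hom_mom_1: "mom p a \<in> fiber_hom p (Suc 0)"
proof -
  have "1 \<in> fiber_hom p 0" using imageI[OF cinf_one, of pull p] by simp
  from fiber_hom_mom[OF this, of a] show ?thesis by simp
qed

lemma fiber_hom_ham: "vector_field p e X \<Longrightarrow> ham p X \<in> fiber_hom p (Suc 0)"
  unfolding ham_def
  by (intro fiber_hom_sum fiber_hom_pull_mult fiber_hom_mom_1) (simp add: vector_field_def)

text \<open>The definition writes coefficients to the left of the momenta, \<open>fiber_hom\<close>
  writes them to the right; only the signs from moving them across have to be matched.\<close>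

lemma fiberwise_quadratic_fiber_hom: "fiberwise_quadratic p S \<longleftrightarrow> S \<in> fiber_hom p (Suc (Suc 0))"
proof
  assume "fiberwise_quadratic p S"
  then obtain s where s: "\<And>a b. s a b \<in> cinf p"
    "S = (\<Sum>a\<in>UNIV. \<Sum>b\<in>UNIV. pull (s a b) * mom p a * mom p b)"
    unfolding fiberwise_quadratic_def by blast
  have "pull (s a b) * (mom p a * mom p b) \<in> fiber_hom p (Suc (Suc 0))" for a b
    by (intro fiber_hom_pull_mult s fiber_hom_mom fiber_hom_mom_1)
  then show "S \<in> fiber_hom p (Suc (Suc 0))"
    unfolding s(2) by (intro fiber_hom_sum) (simp add: mult.assoc)
next
  assume "S \<in> fiber_hom p (Suc (Suc 0))"
  then obtain F where F: "S = (\<Sum>a\<in>UNIV. mom p a * F a)" "\<And>a. F a \<in> fiber_hom p (Suc 0)"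
    using fiber_hom_SucE by metis
  have "\<forall>a. \<exists>f. F a = (\<Sum>b\<in>UNIV. mom p b * pull (f b)) \<and> (\<forall>b. f b \<in> cinf p)"
  proof
    fix a
    obtain G where G: "F a = (\<Sum>b\<in>UNIV. mom p b * G b)" "\<And>b. G b \<in> fiber_hom p 0"
      using fiber_hom_SucE[OF F(2)] by metis
    then have "\<forall>b. \<exists>g. G b = pull g \<and> g \<in> cinf p" by auto
    then show "\<exists>f. F a = (\<Sum>b\<in>UNIV. mom p b * pull (f b)) \<and> (\<forall>b. f b \<in> cinf p)"
      using G(1) by (metis (mono_tags, lifting) sum.cong)
  qed
  then obtain f where f: "\<And>a. F a = (\<Sum>b\<in>UNIV. mom p b * pull (f a b))" "\<And>a b. f a b \<in> cinf p"
    by metis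
  \<comment> \<open>The twist that a coefficient undergoes when it passes \<open>mom p a\<close>. It
    is an involution, so the coefficients can be moved back to the left.\<close>
  let ?t = "\<lambda>a f. parity_part 0 f + (-1) ^ p a *\<^sub>R parity_part 1 f :: 'a sfun"
  have invol: "?t a (?t a f) = f" for a f
    by (rule sfun_eqI) (auto simp: parity_part_def)
  have t: "mom p a * (pull f * G) = pull (?t a f) * (mom p a * G)" for a f G
    unfolding pull_mom_swap invol ..
  have "mom p a * (mom p b * pull h) = pull (?t a (?t b h)) * mom p a * mom p b" for a b h
    using t[of b h 1] by (simp add: t mult.assoc)
  then have "S = (\<Sum>a\<in>UNIV. \<Sum>b\<in>UNIV. pull (?t a (?t b (f a b))) * mom p a * mom p b)"
    unfolding F(1) f(1) sum_distrib_left by simp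
  moreover have "?t a (?t b (f a b)) \<in> cinf p" for a b
    by (intro cinf_add cinf_scaleR cinf_parity_part f(2))
  ultimately show "fiberwise_quadratic p S"
    unfolding fiberwise_quadratic_def by (intro exI[of _ "\<lambda>a b. ?t a (?t b (f a b))"]) blast
qed

section \<open>Homological fields and Schouten tensors\<close>

text \<open>The bracket of \<open>ham p X\<close> with itself is linear in the momenta, so it is
  determined by its brackets with base coordinates. By the Jacobi identity these are twice the
  square of \<open>X\<close> on the coordinates.\<close>

lemma poisson_ham_self:
  assumes "homological p X" shows "poisson p (ham p X) (ham p X) = 0"
proof (rule fiber_hom_eq_0I)
  let ?h = "ham p X"
  have X: "vector_field p 1 X" and X2: "\<And>f. f \<in> cinf p \<Longrightarrow> vact p X (vact p X f) = 0"
    using assms by (auto simp: homological_def)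
  note h = has_parity_ham[OF X] cinf_ham[OF X]
  show "poisson p ?h ?h \<in> fiber_hom p (Suc 0)"
    using fiber_hom_poisson[OF fiber_hom_ham[OF X] fiber_hom_ham[OF X]] by simp
  fix a
  have "poisson p ?h (poisson p ?h (pos p a)) = 0"
    using X2[of "crd p a"]
    by (simp add: pull_crd[symmetric] poisson_ham_pull[OF X] cinf_vact[OF X])
  then have "poisson p (poisson p ?h ?h) (pos p a) = 0"
    using poisson_jacobi[OF h h cinf_crd[of "ct p" "Inl a"]] by simp
  then show "pd (ct p) (Inr a) (poisson p ?h ?h) = 0"
    unfolding poisson_crd ham_field_Inl(1)[OF has_parity_poisson[OF h h(1)]]
    by simp
qed

text \<open>Two applications of the Jacobi identity show that the failure of \<open>X\<close> to be
  a derivation is the derived bracket of {p_X, S}. The condition on functions can thus be traded for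
  an equation between Hamiltonians, in both directions.\<close>

lemma derivation_defect:
  assumes X: "vector_field p 1 X" and S: "has_parity 1 S" "S \<in> cinf (ct p)"
    and f: "has_parity e f" "f \<in> cinf p" and g: "g \<in> cinf p"
  shows "vact p X (schouten_bracket p S f g)
    = schouten_bracket p S (vact p X f) g + (-1) ^ (e + 1) *\<^sub>R schouten_bracket p S f (vact p X g)
      + (-1) ^ e *\<^sub>R zero_section (poisson p (pull f) (poisson p (poisson p (ham p X) S) (pull g)))"
proof -
  note h = has_parity_ham[OF X] cinf_ham[OF X]
  note f' = has_parity_pull[OF f(1)] cinf_pull[OF f(2)]
  note Sg = cinf_poisson[OF S(2) cinf_pull[OF g]]
  have "poisson p (ham p X) (poisson p S (pull g))
    = poisson p (poisson p (ham p X) S) (pull g) - poisson p S (pull (vact p X g))"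
    using poisson_jacobi[OF h S cinf_pull[OF g]] by (simp add: poisson_ham_pull[OF X g])
  then have "poisson p (ham p X) (poisson p (pull f) (poisson p S (pull g)))
    = poisson p (pull (vact p X f)) (poisson p S (pull g))
      + (-1) ^ e *\<^sub>R (poisson p (pull f) (poisson p (poisson p (ham p X) S) (pull g))
        - poisson p (pull f) (poisson p S (pull (vact p X g))))"
    using poisson_jacobi[OF h f' Sg]
    by (simp add: poisson_ham_pull[OF X f(2)] poisson_diff_right cinf_poisson S h f' cinf_pull g
        cinf_vact[OF X])
  then have "zero_section (poisson p (ham p X) (poisson p (pull f) (poisson p S (pull g))))
    = schouten_bracket p S (vact p X f) g
      + (-1) ^ e *\<^sub>R (zero_section (poisson p (pull f) (poisson p (poisson p (ham p X) S) (pull g)))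
        - schouten_bracket p S f (vact p X g))"
    unfolding schouten_bracket_def
    by (simp add: zero_section_add zero_section_scaleR zero_section_diff)
  then show ?thesis
    unfolding zero_section_poisson_ham[OF X cinf_poisson[OF f'(2) Sg]] schouten_bracket_def[of p S f g, symmetric]
    by (simp add: scaleR_diff_right)
qed

lemma odd_derivationI:
  assumes X: "vector_field p 1 X" and S: "has_parity 1 S" "S \<in> cinf (ct p)"
    and "poisson p (ham p X) S = 0"
  shows "odd_derivation p X S"
  unfolding odd_derivation_def using derivation_defect[OF X S] assms(4) by simp

text \<open>The defects on pairs of coordinates are, up to sign, the second momentum derivatives of
  {p_X, S}. This function is quadratic in the momenta and so vanishes with them.\<close>

lemma odd_derivationD:
  assumes X: "vector_field p 1 X" and S: "has_parity 1 S" "S \<in> cinf (ct p)" "fiberwise_quadratic p S"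
    and der: "odd_derivation p X S"
  shows "poisson p (ham p X) S = 0"
proof -
  let ?F = "poisson p (ham p X) S"
  have F: "has_parity 0 ?F" "?F \<in> cinf (ct p)"
    using has_parity_cong[OF _ has_parity_poisson[OF has_parity_ham[OF X] cinf_ham[OF X] S(1)], of 0]
    by (auto intro!: cinf_poisson cinf_ham[OF X] S)
  have F2: "?F \<in> fiber_hom p (Suc (Suc 0))"
    using fiber_hom_poisson[OF fiber_hom_ham[OF X] S(3)[unfolded fiberwise_quadratic_fiber_hom]]
    by (simp del: fiber_hom.simps)
  have "pd (ct p) (Inr a) (pd (ct p) (Inr b) ?F) = 0" for a b
  proof -
    have "vact p X (schouten_bracket p S (crd p a) (crd p b))
      = schouten_bracket p S (vact p X (crd p a)) (crd p b)
        + (-1) ^ (p a + 1) *\<^sub>R schouten_bracket p S (crd p a) (vact p X (crd p b))"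
      using der has_parity_crd[of p a] unfolding odd_derivation_def by simp
    then have "zero_section (poisson p (pos p a) (poisson p ?F (pos p b))) = 0"
      using derivation_defect[OF X S(1,2) has_parity_crd cinf_crd cinf_crd, of a b]
      by (simp add: pull_crd)
    moreover have "poisson p ?F (pos p b) = (-1) ^ (p b * (0 + 1)) *\<^sub>R pd (ct p) (Inr b) ?F"
      unfolding poisson_crd ham_field_Inl(1)[OF F(1)] ..
    moreover have "poisson p (pos p a) G = - ((-1) ^ (p a * e) *\<^sub>R ((-1) ^ (p a * (e + 1)) *\<^sub>R pd (ct p) (Inr a) G))"
      if "has_parity e G" for e G
      using poisson_antisym[OF has_parity_crd[of "ct p" "Inl a"] that, of p]
      unfolding poisson_crd ham_field_Inl(1)[OF that] by simp
    moreover have "has_parity (0 + p b) (pd (ct p) (Inr b) ?F)"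
      using has_parity_pd[OF F(1), of "ct p" "Inr b"] by simp
    ultimately have "zero_section (pd (ct p) (Inr a) (pd (ct p) (Inr b) ?F)) = 0"
      by (simp add: poisson_scaleR_right cinf_pd F zero_section_minus zero_section_scaleR)
    \<comment> \<open>In degree 0 the function is a pullback, so its restriction to the zero section
      loses nothing.\<close>
    moreover have "pd (ct p) (Inr a) (pd (ct p) (Inr b) ?F) \<in> fiber_hom p 0"
      by (intro fiber_hom_pd_Inr F2)
    ultimately show ?thesis using fiber_hom_0_pull by fastforce
  qed
  then have "pd (ct p) (Inr b) ?F = 0" for b
    by (intro fiber_hom_eq_0I[OF fiber_hom_pd_Inr[OF F2]])
  then show ?thesis by (intro fiber_hom_eq_0I[OF F2])
qed

section \<open>Lie superalgebras in a basis\<close>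

lemma vec_axis_expansion: "(X :: real ^ 'c) = (\<Sum>i\<in>UNIV. X $ i *\<^sub>R axis i 1)"
  by (simp add: vec_eq_iff axis_def if_distrib[of "\<lambda>x. _ * x"] cong: if_cong)

lemma bilinear_sum_axis:
  assumes "bilinear br"
  shows "br (X :: real ^ 'c) (Y :: real ^ 'd) = (\<Sum>i\<in>UNIV. \<Sum>j\<in>UNIV. (X $ i * Y $ j) *\<^sub>R br (axis i 1) (axis j 1))"
proof -
  have l: "linear (br X)" "linear (\<lambda>X. br X Y)" for X Y
    using assms by (auto simp: bilinear_def)
  have "br X Y = (\<Sum>i\<in>UNIV. X $ i *\<^sub>R br (axis i 1) Y)"
    by (subst vec_axis_expansion[of X]) (simp add: linear_sum[OF l(2)] linear_scale[OF l(2)])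
  also have "\<dots> = (\<Sum>i\<in>UNIV. X $ i *\<^sub>R (\<Sum>j\<in>UNIV. Y $ j *\<^sub>R br (axis i 1) (axis j 1)))"
    by (subst vec_axis_expansion[of Y]) (simp add: linear_sum[OF l(1)] linear_scale[OF l(1)])
  finally show ?thesis by (simp add: scaleR_sum_right)
qed

lemma bilinear_eq_axisI:
  fixes f g :: "real ^ 'c \<Rightarrow> real ^ 'd \<Rightarrow> real ^ 'e"
  assumes "bilinear f" "bilinear g" "\<And>i j. f (axis i 1) (axis j 1) = g (axis i 1) (axis j 1)"
  shows "f X Y = g X Y"
  using assms by (simp add: bilinear_sum_axis[of f X Y] bilinear_sum_axis[of g X Y])

lemma linear_eq_axisI:
  fixes f g :: "real ^ 'c \<Rightarrow> 'e::real_vector"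
  assumes "linear f" "linear g" "\<And>i. f (axis i 1) = g (axis i 1)"
  shows "f X = g X"
  by (subst (1 2) vec_axis_expansion[of X]) (use assms in \<open>simp add: linear_sum linear_scale\<close>)

definition structure_bracket :: "('c::finite \<Rightarrow> 'c \<Rightarrow> 'c \<Rightarrow> real) \<Rightarrow> real ^ 'c \<Rightarrow> real ^ 'c \<Rightarrow> real ^ 'c" where
  "structure_bracket C X Y = (\<chi> k. \<Sum>i\<in>UNIV. \<Sum>j\<in>UNIV. X $ i * Y $ j * C i j k)"

lemma bilinear_structure_bracket: "bilinear (structure_bracket C)"
  unfolding bilinear_def structure_bracket_def
  by (auto intro!: linearI simp: vec_eq_iff algebra_simps sum.distrib sum_distrib_left)

lemma structure_bracket_axis: "structure_bracket C (axis i 1) (axis j 1) $ k = C i j k"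
proof -
  have "structure_bracket C (axis i 1) (axis j 1) $ k
    = (\<Sum>i'\<in>UNIV. \<Sum>j'\<in>UNIV. if j' = j then (if i' = i then C i' j' k else 0) else 0)"
    unfolding structure_bracket_def vec_lambda_beta
    by (intro sum.cong refl) (auto simp: axis_def)
  then show ?thesis by simp
qed

lemma vec_parity_axis: "vec_parity p (p i) (axis i 1)"
  by (auto simp: vec_parity_def axis_def)

text \<open>Signs that involve the parities of basis vectors may be replaced by signs of the whole
  vector, since only components of matching parity are nonzero.\<close>

lemma vec_parity_sign: "vec_parity p a X \<Longrightarrow> X $ i * (-1) ^ (p i * n) = X $ i * (-1) ^ (a * n)"
  and vec_parity_sign': "vec_parity p a X \<Longrightarrow> X $ i * (-1) ^ p i = X $ i * (-1) ^ a"
  by (cases "X $ i = 0"; fastforce simp: vec_parity_def minus_one_power_iff)+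

text \<open>On the supports of \<open>X\<close> and \<open>Y\<close> the sign for basis vectors
  equals the sign for \<open>X\<close> and \<open>Y\<close>, so the axioms extend bilinearly. The
  last argument of the Jacobi identity enters no sign and is extended by plain linearity.\<close>

lemma lie_super_axisI:
  fixes br :: "real ^ 'c \<Rightarrow> real ^ 'c \<Rightarrow> real ^ 'c"
  assumes br: "bilinear br"
    and par: "\<And>i j k. br (axis i 1) (axis j 1) $ k \<noteq> 0 \<Longrightarrow> even (p i + p j + p k)"
    and skew: "\<And>i j. br (axis i 1) (axis j 1) = - ((-1) ^ (p i * p j) *\<^sub>R br (axis j 1) (axis i 1))"
    and jac: "\<And>i j k. br (axis i 1) (br (axis j 1) (axis k 1))
      = br (br (axis i 1) (axis j 1)) (axis k 1)
        + (-1) ^ (p i * p j) *\<^sub>R br (axis j 1) (br (axis i 1) (axis k 1))"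
  shows "lie_super p br"
  unfolding lie_super_def
proof (intro conjI allI impI)
  show "bilinear br" by fact
next
  fix a b and X Y :: "real ^ 'c"
  assume XY: "vec_parity p a X \<and> vec_parity p b Y"
  show "vec_parity p (a + b) (br X Y)"
    unfolding vec_parity_def
  proof (intro allI impI, rule ccontr)
    fix k
    assume nz: "br X Y $ k \<noteq> 0" and odd: "odd (p k + (a + b))"
    have zero: "X $ i * Y $ j * br (axis i 1) (axis j 1) $ k = 0" for i j
      using par[of i j k] XY odd by (auto simp: vec_parity_def)
    show False
      using nz unfolding bilinear_sum_axis[OF br, of X Y] by (simp add: zero)
  qed
  have "(X $ i * Y $ j) *\<^sub>R br (axis i 1) (axis j 1)
    = - ((-1) ^ (a * b) *\<^sub>R ((Y $ j * X $ i) *\<^sub>R br (axis j 1) (axis i 1)))" for i j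
  proof -
    have "X $ i * Y $ j * (-1) ^ (p i * p j) = X $ i * Y $ j * (-1) ^ (a * b)"
      using vec_parity_sign[of p a X i "p j"] vec_parity_sign[of p b Y j a] XY
      by (metis mult.assoc mult.commute)
    then show ?thesis
      unfolding skew[of i j] by (simp add: mult.commute)
  qed
  then have "br X Y = - ((-1) ^ (a * b) *\<^sub>R (\<Sum>i\<in>UNIV. \<Sum>j\<in>UNIV. (Y $ j * X $ i) *\<^sub>R br (axis j 1) (axis i 1)))"
    by (simp add: bilinear_sum_axis[OF br, of X Y] scaleR_sum_right sum_negf)
  also have "(\<Sum>i\<in>UNIV. \<Sum>j\<in>UNIV. (Y $ j * X $ i) *\<^sub>R br (axis j 1) (axis i 1)) = br Y X"
    unfolding bilinear_sum_axis[OF br, of Y X] by (rule sum.swap)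
  finally show "br X Y = - ((-1) ^ (a * b) *\<^sub>R br Y X)" .
next
  fix a b c and X Y Z :: "real ^ 'c"
  assume XYZ: "vec_parity p a X \<and> vec_parity p b Y \<and> vec_parity p c Z"
  have l: "linear (br X)" "linear (\<lambda>X. br X Y)" for X Y
    using br by (auto simp: bilinear_def)
  have "linear (\<lambda>Z. br X (br Y Z) - br (br X Y) Z - (-1) ^ (a * b) *\<^sub>R br Y (br X Z))"
    by (intro linear_compose_sub linear_compose_scale_right l linear_compose[OF l(1) l(1), unfolded o_def])
  moreover have "br X (br Y (axis k 1)) - br (br X Y) (axis k 1) - (-1) ^ (a * b) *\<^sub>R br Y (br X (axis k 1)) = 0" for k
  proof -
    let ?z = "axis k 1 :: real ^ 'c"
    have b1: "bilinear (\<lambda>X Y. br X (br Y ?z))"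
      unfolding bilinear_def
      by (intro conjI allI l(2) linear_compose[OF l(2) l(1), unfolded o_def])
    have b2: "bilinear (\<lambda>X Y. br (br X Y) ?z)"
      unfolding bilinear_def
      by (intro conjI allI linear_compose[OF l(1) l(2), unfolded o_def] linear_compose[OF l(2) l(2), unfolded o_def])
    have b3: "bilinear (\<lambda>X Y. br Y (br X ?z))"
      unfolding bilinear_def
      by (intro conjI allI l(2) linear_compose[OF l(2) l(1), unfolded o_def])
    have "(X $ i * Y $ j) *\<^sub>R br (axis i 1) (br (axis j 1) ?z)
      = (X $ i * Y $ j) *\<^sub>R br (br (axis i 1) (axis j 1)) ?z
        + (-1) ^ (a * b) *\<^sub>R ((X $ i * Y $ j) *\<^sub>R br (axis j 1) (br (axis i 1) ?z))" for i j
    proof -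
      have "X $ i * Y $ j * (-1) ^ (p i * p j) = X $ i * Y $ j * (-1) ^ (a * b)"
        using vec_parity_sign[of p a X i "p j"] vec_parity_sign[of p b Y j a] XYZ
        by (metis mult.assoc mult.commute)
      then show ?thesis
        unfolding jac[of i j k] by (simp add: scaleR_add_right mult.commute)
    qed
    then have "br X (br Y ?z) = br (br X Y) ?z
      + (-1) ^ (a * b) *\<^sub>R (\<Sum>i\<in>UNIV. \<Sum>j\<in>UNIV. (X $ i * Y $ j) *\<^sub>R br (axis j 1) (br (axis i 1) ?z))"
      unfolding bilinear_sum_axis[OF b1, of X Y] bilinear_sum_axis[OF b2, of X Y]
      by (simp add: sum.distrib scaleR_sum_right)
    also have "(\<Sum>i\<in>UNIV. \<Sum>j\<in>UNIV. (X $ i * Y $ j) *\<^sub>R br (axis j 1) (br (axis i 1) ?z)) = br Y (br X ?z)"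
      using bilinear_sum_axis[OF b3, of Y X] by simp
    finally show ?thesis by simp
  qed
  ultimately have "br X (br Y Z) - br (br X Y) Z - (-1) ^ (a * b) *\<^sub>R br Y (br X Z) = 0"
    using linear_eq_axisI[of "\<lambda>Z. br X (br Y Z) - br (br X Y) Z - (-1) ^ (a * b) *\<^sub>R br Y (br X Z)" "\<lambda>_. 0" Z]
      linear_zero by simp
  then show "br X (br Y Z) = br (br X Y) Z + (-1) ^ (a * b) *\<^sub>R br Y (br X Z)"
    by (simp add: diff_diff_eq)
qed

lemma lie_superD:
  assumes "lie_super p br"
  shows "bilinear br"
    and "vec_parity p a X \<Longrightarrow> vec_parity p b Y \<Longrightarrow> vec_parity p (a + b) (br X Y)"
    and "vec_parity p a X \<Longrightarrow> vec_parity p b Y \<Longrightarrow> br X Y = - ((-1) ^ (a * b) *\<^sub>R br Y X)"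
    and "vec_parity p a X \<Longrightarrow> vec_parity p b Y \<Longrightarrow> vec_parity p c Z \<Longrightarrow>
      br X (br Y Z) = br (br X Y) Z + (-1) ^ (a * b) *\<^sub>R br Y (br X Z)"
  using assms unfolding lie_super_def by blast+

subsection \<open>The bracket of a quadratic field\<close>

lemma shift_apply: "shift p i = p i + 1"
  by (simp add: shift_def)

lemma pd_const [simp]: "pd p a (c *\<^sub>R 1) = 0"
  by (simp add: pd_scaleR)

lemma vact_const [simp]: "vact p X (c *\<^sub>R 1) = 0"
  by (simp add: vact_def)

text \<open>Contractions have constant components and are annihilated by every vector field, so one
  term of each commutator survives. The sign of the second contraction is used up by the inner
  commutator, that of the first remains.\<close>

lemma derived_bracket_contraction:
  assumes Q: "\<And>i. Q i \<in> cinf (shift p)"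
  shows "vcomm (shift p) (a + 1) (contraction t a X) b (vcomm (shift p) 1 Q (b + 1) (contraction t b Y)) k
    = (\<Sum>i\<in>UNIV. \<Sum>j\<in>UNIV. ((-1) ^ a * (X $ i / t i) * (Y $ j / t j)) *\<^sub>R pd (shift p) i (pd (shift p) j (Q k)))"
proof -
  have act: "vact (shift p) (contraction t e X) f = (\<Sum>i\<in>UNIV. ((-1) ^ e * X $ i / t i) *\<^sub>R pd (shift p) i f)"
    for e X f
    by (simp add: vact_def contraction_def)
  have zero: "vact (shift p) Y (contraction t e X i) = 0" for Y e X i
    unfolding contraction_def by (rule vact_const)
  have "vcomm (shift p) 1 Q (b + 1) (contraction t b Y) k
    = (\<Sum>j\<in>UNIV. (Y $ j / t j) *\<^sub>R pd (shift p) j (Q k))" for k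
    unfolding vcomm_def zero act
    by (cases "even b") (simp_all add: sum_negf)
  then have eq: "vcomm (shift p) 1 Q (b + 1) (contraction t b Y)
    = (\<lambda>k. \<Sum>j\<in>UNIV. (Y $ j / t j) *\<^sub>R pd (shift p) j (Q k))" by blast
  have "pd (shift p) i (\<Sum>j\<in>UNIV. (Y $ j / t j) *\<^sub>R pd (shift p) j (Q k))
    = (\<Sum>j\<in>UNIV. (Y $ j / t j) *\<^sub>R pd (shift p) i (pd (shift p) j (Q k)))" for i
    using Q by (simp add: pd_sum pd_scaleR cinf_scaleR cinf_pd)
  then show ?thesis
    unfolding vcomm_def[of _ "a + 1"] zero act eq by (simp add: scaleR_sum_right)
qed

text \<open>Reduces the correspondence to basis vectors: the second derivatives of \<open>Q\<close>
  have to be constants, and these are the structure constants up to sign. As each \<open>t i\<close>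
  squares to 1, dividing by it is the same as multiplying by it.\<close>

lemma field_gives_lie_iff:
  assumes Q: "\<And>i. Q i \<in> cinf (shift p)" and t: "\<And>i. t i * t i = 1"
  shows "field_gives_lie p t Q br \<longleftrightarrow> bilinear br \<and>
    (\<forall>i j k. pd (shift p) i (pd (shift p) j (Q k))
      = ((-1) ^ p j * t i * t j * t k * br (axis i 1) (axis j 1) $ k) *\<^sub>R 1)"
proof
  have inv: "1 / t i = t i" for i
    using t[of i] by (metis div_by_1 divide_divide_eq_right mult.right_neutral mult_cancel_right nonzero_divide_eq_eq zero_neq_one)
  have div: "x / t i = x * t i" for x i
    using inv[of i] by (metis mult.right_neutral times_divide_eq_right)
  have nz: "t i \<noteq> 0" for i using t[of i] by auto
  have sq: "t d * (t d * x) = x" for d x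
    using t[of d] by (metis mult.assoc mult_1)
  {
    assume L: "field_gives_lie p t Q br"
    show "bilinear br \<and> (\<forall>i j k. pd (shift p) i (pd (shift p) j (Q k))
      = ((-1) ^ p j * t i * t j * t k * br (axis i 1) (axis j 1) $ k) *\<^sub>R 1)"
    proof (intro conjI allI)
      show "bilinear br" using L by (simp add: field_gives_lie_def)
      fix i j k
      have delta: "(\<Sum>i'\<in>UNIV. \<Sum>j'\<in>UNIV. ((-1) ^ p i * (axis i 1 $ i' / t i') * (axis j 1 $ j' / t j')) *\<^sub>R F i' j')
        = ((-1) ^ p i * t i * t j) *\<^sub>R F i j" for F :: "'a \<Rightarrow> 'a \<Rightarrow> 'a sfun"
      proof -
        have "(\<Sum>i'\<in>UNIV. \<Sum>j'\<in>UNIV. ((-1) ^ p i * (axis i 1 $ i' / t i') * (axis j 1 $ j' / t j')) *\<^sub>R F i' j')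
          = (\<Sum>i'\<in>UNIV. \<Sum>j'\<in>UNIV. if j' = j then (if i' = i then ((-1) ^ p i * t i * t j) *\<^sub>R F i' j' else 0) else 0)"
          by (intro sum.cong refl) (auto simp: axis_def div)
        then show ?thesis by simp
      qed
      have "contraction t (p i + p j) (br (axis i 1) (axis j 1))
        = vcomm (shift p) (p i + 1) (contraction t (p i) (axis i 1))
            (p j) (vcomm (shift p) 1 Q (p j + 1) (contraction t (p j) (axis j 1)))"
        using L vec_parity_axis[of p i] vec_parity_axis[of p j]
        unfolding field_gives_lie_def by blast
      then have "contraction t (p i + p j) (br (axis i 1) (axis j 1)) k
        = ((-1) ^ p i * t i * t j) *\<^sub>R pd (shift p) i (pd (shift p) j (Q k))"
        by (simp only: derived_bracket_contraction[OF Q] delta)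
      then have "((-1) ^ p i * t i * t j) *\<^sub>R (((-1) ^ p i * t i * t j) *\<^sub>R pd (shift p) i (pd (shift p) j (Q k)))
        = ((-1) ^ p i * t i * t j) *\<^sub>R (((-1) ^ (p i + p j) * br (axis i 1) (axis j 1) $ k * t k) *\<^sub>R 1)"
        by (simp add: contraction_def div)
      moreover have "((-1) ^ p i * t i * t j) * (((-1) ^ p i * t i * t j) * x) = x" for x
        by (cases "even (p i)") (simp_all add: mult_ac sq t)
      ultimately show "pd (shift p) i (pd (shift p) j (Q k))
        = ((-1) ^ p j * t i * t j * t k * br (axis i 1) (axis j 1) $ k) *\<^sub>R 1"
        by (cases "even (p i)") (simp_all add: power_add mult_ac sq t)
    qed
  next
    assume R: "bilinear br \<and> (\<forall>i j k. pd (shift p) i (pd (shift p) j (Q k))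
      = ((-1) ^ p j * t i * t j * t k * br (axis i 1) (axis j 1) $ k) *\<^sub>R 1)"
    show "field_gives_lie p t Q br"
      unfolding field_gives_lie_def
    proof (intro conjI allI impI)
      show "bilinear br" using R by simp
      fix a b X Y
      assume XY: "vec_parity p a X \<and> vec_parity p b Y"
      show "contraction t (a + b) (br X Y) =
            vcomm (shift p) (a + 1) (contraction t a X)
              b (vcomm (shift p) 1 Q (b + 1) (contraction t b Y))"
      proof
        fix k
        have "((-1) ^ a * (X $ i / t i) * (Y $ j / t j)) *\<^sub>R pd (shift p) i (pd (shift p) j (Q k))
          = ((-1) ^ (a + b) / t k * (X $ i * Y $ j * br (axis i 1) (axis j 1) $ k)) *\<^sub>R 1" for i j
        proof -
          have "Y $ j * (-1) ^ p j = Y $ j * (-1) ^ b"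
            using vec_parity_sign'[of p b Y j] XY by simp
          then have "((-1) ^ a * (X $ i / t i) * (Y $ j / t j)) * ((-1) ^ p j * t i * t j * t k * br (axis i 1) (axis j 1) $ k)
            = (-1) ^ (a + b) / t k * (X $ i * Y $ j * br (axis i 1) (axis j 1) $ k)"
            using nz[of i] nz[of j] by (simp add: div[of _ k] power_add)
              (metis (no_types, lifting) mult.assoc mult.commute)
          then show ?thesis using R by simp
        qed
        then have "vcomm (shift p) (a + 1) (contraction t a X) b (vcomm (shift p) 1 Q (b + 1) (contraction t b Y)) k
          = ((-1) ^ (a + b) / t k * (\<Sum>i\<in>UNIV. \<Sum>j\<in>UNIV. X $ i * Y $ j * br (axis i 1) (axis j 1) $ k)) *\<^sub>R 1"
          unfolding derived_bracket_contraction[OF Q] by (simp add: scaleR_left.sum sum_distrib_left)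
        also have "(\<Sum>i\<in>UNIV. \<Sum>j\<in>UNIV. X $ i * Y $ j * br (axis i 1) (axis j 1) $ k) = br X Y $ k"
          using R bilinear_sum_axis[of br X Y] by simp
        finally show "contraction t (a + b) (br X Y) k =
            vcomm (shift p) (a + 1) (contraction t a X) b (vcomm (shift p) 1 Q (b + 1) (contraction t b Y)) k"
          by (simp add: contraction_def)
      qed
    qed
  }
qed

text \<open>The Jacobi identity is obtained by differentiating $Q(Q^l) = 0$ three times.\<close>

lemma homological_imp_lie_super:
  assumes hom: "homological (shift p) Q" and br: "field_gives_lie p t Q br"
    and t: "\<And>i. t i * t i = 1"
  shows "lie_super p br"
proof -
  let ?q = "shift p"
  let ?C = "\<lambda>i j k. br (axis i 1) (axis j 1) $ k"
  have X: "vector_field ?q 1 Q" and Q2: "\<And>l. vact ?q Q (Q l) = 0"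
    using hom cinf_crd[of ?q] by (auto simp: homological_def vact_crd dest!: bspec[of _ _ "crd ?q _"])
  have Qc: "Q i \<in> cinf ?q" and Qp: "has_parity (p i) (Q i)" for i
    using X has_parity_cong[of "1 + ?q i" "p i" "Q i"] by (auto simp: vector_field_def shift_apply)
  \<comment> \<open>The constant second derivatives of \<open>Q\<close>. They differ from the
    structure constants only by signs, and parity, symmetry and the quadratic relation are read off
    more directly for them.\<close>
  define D where "D = (\<lambda>i j k. (-1) ^ p j * t i * t j * t k * ?C i j k)"
  have bil: "bilinear br" and D: "\<And>i j k. pd ?q i (pd ?q j (Q k)) = D i j k *\<^sub>R 1"
    using br unfolding field_gives_lie_iff[OF Qc t] D_def by auto
  have sq: "t d * (t d * x) = x" for d x
    using t[of d] by (metis mult.assoc mult_1)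
  have C: "?C i j k = (-1) ^ p j * t i * t j * t k * D i j k" for i j k
    unfolding D_def by (cases "even (p j)") (simp_all add: mult_ac sq)
  \<comment> \<open>A nonzero constant is even, while the second derivative of \<open>Q k\<close>
    has parity \<open>p k + ?q j + ?q i\<close>; the two shifts cancel modulo 2.\<close>
  have parD: "even (p i + p j + p k)" if "D i j k \<noteq> 0" for i j k
  proof -
    have "has_parity (p k + ?q j + ?q i) (D i j k *\<^sub>R (1 :: 'a sfun))"
      using has_parity_pd[OF has_parity_pd[OF Qp[of k], of ?q j], of ?q i] by (simp add: D)
    then have "even (p k + ?q j + ?q i)"
      using that has_parity_coef[of _ "D i j k *\<^sub>R (1 :: 'a sfun)" "{}"] by (force simp: coef_one)
    then show ?thesis by (simp add: shift_apply) argo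
  qed
  have skewD: "D i j k = (-1) ^ (?q i * ?q j) * D j i k" for i j k
    using pd_commute[OF Qc[of k], of i j] by (simp add: D)
  \<comment> \<open>Second derivatives of \<open>Q\<close> are constant, so of the three derivatives
    two must fall on \<open>Q d\<close> and one on \<open>pd ?q d (Q l)\<close>. The three summands
    are the choices of the latter.\<close>
  have jacD: "(\<Sum>d\<in>UNIV. D j k d * D i d l + (-1) ^ (?q j * (p d + ?q k)) * D i k d * D j d l
    + (-1) ^ (?q k * p d) * D i j d * D k d l) = 0" for i j k l
  proof -
    have 1: "pd ?q k (Q d * pd ?q d (Q l)) = pd ?q k (Q d) * pd ?q d (Q l)
      + ((-1) ^ (?q k * p d) * D k d l) *\<^sub>R Q d" for d
      using pd_mult[OF Qp[of d] Qc[of d] cinf_pd[OF Qc[of l], of d], of k] by (simp add: D)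
    have 2: "pd ?q j (pd ?q k (Q d * pd ?q d (Q l))) = D j k d *\<^sub>R pd ?q d (Q l)
      + ((-1) ^ (?q j * (p d + ?q k)) * D j d l) *\<^sub>R pd ?q k (Q d)
      + ((-1) ^ (?q k * p d) * D k d l) *\<^sub>R pd ?q j (Q d)" for d
      unfolding 1 using pd_mult[OF has_parity_pd[OF Qp[of d], of ?q k] cinf_pd[OF Qc[of d], of k]
          cinf_pd[OF Qc[of l], of d], of j]
      by (simp add: pd_add cinf_mult cinf_pd cinf_scaleR Qc pd_scaleR D)
    have 3: "pd ?q i (pd ?q j (pd ?q k (Q d * pd ?q d (Q l))))
      = (D j k d * D i d l + (-1) ^ (?q j * (p d + ?q k)) * D i k d * D j d l
         + (-1) ^ (?q k * p d) * D i j d * D k d l) *\<^sub>R 1" for d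
      unfolding 2 by (simp add: pd_add cinf_add cinf_pd cinf_scaleR Qc pd_scaleR D scaleR_left_distrib mult_ac)
    have "pd ?q i (pd ?q j (pd ?q k (vact ?q Q (Q l)))) = (\<Sum>d\<in>UNIV. pd ?q i (pd ?q j (pd ?q k (Q d * pd ?q d (Q l)))))"
      unfolding vact_def by (simp add: pd_sum cinf_mult cinf_pd Qc)
    then have "(\<Sum>d\<in>UNIV. D j k d * D i d l + (-1) ^ (?q j * (p d + ?q k)) * D i k d * D j d l
    + (-1) ^ (?q k * p d) * D i j d * D k d l) *\<^sub>R (1 :: 'a sfun) = 0"
      unfolding Q2 3 by (simp add: scaleR_left.sum)
    then show ?thesis by (simp only: scaleR_eq_0_iff) simp
  qed
  show ?thesis
  proof (rule lie_super_axisI[OF bil])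
    show "even (p i + p j + p k)" if "?C i j k \<noteq> 0" for i j k
      using parD[of i j k] that C by auto
    have skewC: "?C i j k = - ((-1) ^ (p i * p j) * ?C j i k)" for i j k
      using skewD[of i j k] unfolding C
      by (cases "even (p i)"; cases "even (p j)") (simp_all add: shift_apply)
    show "br (axis i 1) (axis j 1) = - ((-1) ^ (p i * p j) *\<^sub>R br (axis j 1) (axis i 1))" for i j
      by (simp add: vec_eq_iff skewC[of i j])
    fix i j k
    have l: "linear (br X)" "linear (\<lambda>X. br X Y)" for X Y
      using bil by (auto simp: bilinear_def)
    have right: "br (axis i 1) Y $ l = (\<Sum>d\<in>UNIV. Y $ d * ?C i d l)" for i Y l
      by (subst vec_axis_expansion[of Y]) (simp add: linear_sum[OF l(1)] linear_scale[OF l(1)])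
    have left: "br Y (axis i 1) $ l = (\<Sum>d\<in>UNIV. Y $ d * ?C d i l)" for i Y l
      by (subst vec_axis_expansion[of Y]) (simp add: linear_sum[OF l(2)] linear_scale[OF l(2)])
    have J: "(\<Sum>d\<in>UNIV. ?C j k d * ?C i d l) = (\<Sum>d\<in>UNIV. ?C i j d * ?C d k l)
      + (-1) ^ (p i * p j) * (\<Sum>d\<in>UNIV. ?C i k d * ?C j d l)" for l
    proof -
      \<comment> \<open>The two relations agree summand by summand, up to a sign independent of
        \<open>d\<close>; exponents containing \<open>p d\<close> are resolved by
        \<open>parD\<close>.\<close>
      have "?C j k d * ?C i d l - ?C i j d * ?C d k l - (-1) ^ (p i * p j) * (?C i k d * ?C j d l)
        = (-1) ^ p j * (t i * t j * t k * t l) * (D j k d * D i d l + (-1) ^ (?q j * (p d + ?q k)) * D i k d * D j d l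
          + (-1) ^ (?q k * p d) * D i j d * D k d l)" (is "?L = ?R") for d
      proof -
        have a: "?C j k d * ?C i d l = (-1) ^ p j * (t i * t j * t k * t l) * (D j k d * D i d l)"
          using parD[of j k d] unfolding C[of j k d] C[of i d l]
          by (cases "D j k d = 0"; cases "even (p j)"; cases "even (p k)") (simp_all add: mult_ac sq)
        have b: "- (?C i j d * ?C d k l) = (-1) ^ p j * (t i * t j * t k * t l) * ((-1) ^ (?q k * p d) * D i j d * D k d l)"
          using parD[of i j d] unfolding C[of i j d] C[of d k l] skewD[of d k l]
          by (cases "D i j d = 0"; cases "even (p j)"; cases "even (p k)"; cases "even (p i)")
            (simp_all add: mult_ac sq shift_apply)
        have c: "- ((-1) ^ (p i * p j) * (?C i k d * ?C j d l))
          = (-1) ^ p j * (t i * t j * t k * t l) * ((-1) ^ (?q j * (p d + ?q k)) * D i k d * D j d l)"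
          using parD[of i k d] unfolding C[of i k d] C[of j d l]
          by (cases "D i k d = 0"; cases "even (p j)"; cases "even (p k)"; cases "even (p i)")
            (simp_all add: mult_ac sq shift_apply)
        show ?thesis using a b c by (simp add: distrib_left)
      qed
      then have "(\<Sum>d\<in>UNIV. ?C j k d * ?C i d l - ?C i j d * ?C d k l - (-1) ^ (p i * p j) * (?C i k d * ?C j d l)) = 0"
        using jacD[where i = i and j = j and k = k and l = l] by (simp flip: sum_distrib_left)
      then show ?thesis by (simp add: sum_subtractf sum_distrib_left)
    qed
    show "br (axis i 1) (br (axis j 1) (axis k 1))
      = br (br (axis i 1) (axis j 1)) (axis k 1)
        + (-1) ^ (p i * p j) *\<^sub>R br (axis j 1) (br (axis i 1) (axis k 1))"
      unfolding vec_eq_iff vector_add_component vector_scaleR_component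
        right[of i "br (axis j 1) (axis k 1)"] left[of "br (axis i 1) (axis j 1)" k]
        right[of j "br (axis i 1) (axis k 1)"]
      using J by simp
  qed
qed

subsection \<open>The bracket of a linear Schouten tensor\<close>

lemma poisson_pos: "poisson p (pos p a) G = - ((-1) ^ p a *\<^sub>R pd (ct p) (Inr a) G)"
proof -
  have "poisson p (pos p a) G = (\<Sum>b\<in>UNIV. (if a = b then 1 else 0) * - ((-1) ^ (p b * p a) *\<^sub>R pd (ct p) (Inr b) G))"
    using has_parity_crd[of "ct p" "Inl a"]
    unfolding poisson_vact vact_def sum_UNIV_Plus
    by (auto simp: ham_field_Inl pd_crd intro!: sum.cong)
  also have "\<dots> = - ((-1) ^ (p a * p a) *\<^sub>R pd (ct p) (Inr a) G)"
    by (rule sum_delta_mult(2))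
  finally show ?thesis by (cases "even (p a)") simp_all
qed

lemma poisson_mom: "poisson p (mom p a) G = pd (ct p) (Inl a) G"
proof -
  have "poisson p (mom p a) G = (\<Sum>b\<in>UNIV. (if a = b then 1 else 0) * ((-1) ^ (p b * (p a + 1)) *\<^sub>R pd (ct p) (Inl b) G))"
    using has_parity_mom[of p a]
    unfolding poisson_vact vact_def sum_UNIV_Plus
    by (auto simp: ham_field_Inl pd_crd intro!: sum.cong)
  also have "\<dots> = (-1) ^ (p a * (p a + 1)) *\<^sub>R pd (ct p) (Inl a) G"
    by (rule sum_delta_mult(2))
  finally show ?thesis by simp
qed

text \<open>Degrees in the momenta drop from 2 to 1 and from 1 to 0, so the iterated bracket is a
  pullback and \<open>zero_section\<close> in the definition discards nothing.\<close>

lemma pull_schouten_bracket: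
  assumes S: "S \<in> fiber_hom p (Suc (Suc 0))" and f: "f \<in> cinf p" and g: "g \<in> cinf p"
  shows "poisson p (pull f) (poisson p S (pull g)) = pull (schouten_bracket p S f g)"
proof -
  have "pull f \<in> fiber_hom p 0" "pull g \<in> fiber_hom p 0" using f g by auto
  then have "poisson p (pull f) (poisson p S (pull g)) \<in> fiber_hom p 0"
    using fiber_hom_poisson[OF S, of "pull g" 0] fiber_hom_poisson[of "pull f" p 0 _ "Suc 0"] by simp
  then show ?thesis unfolding schouten_bracket_def by (rule fiber_hom_0_pull)
qed

lemma schouten_bracket_sum:
  assumes S: "S \<in> cinf (ct p)" and f: "\<And>i. f i \<in> cinf p" and g: "\<And>i. g i \<in> cinf p"
  shows "schouten_bracket p S (\<Sum>i\<in>UNIV. a i *\<^sub>R f i) (\<Sum>j\<in>UNIV. b j *\<^sub>R g j)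
    = (\<Sum>i\<in>UNIV. \<Sum>j\<in>UNIV. (a i * b j) *\<^sub>R schouten_bracket p S (f i) (g j))"
proof -
  have "poisson p S (pull (\<Sum>j\<in>UNIV. b j *\<^sub>R g j)) = (\<Sum>j\<in>UNIV. b j *\<^sub>R poisson p S (pull (g j)))"
    by (simp add: pull_sum pull_scaleR poisson_sum_right poisson_scaleR_right cinf_pull cinf_scaleR g)
  moreover have "poisson p (pull (\<Sum>i\<in>UNIV. a i *\<^sub>R f i)) (\<Sum>j\<in>UNIV. b j *\<^sub>R G j)
    = (\<Sum>i\<in>UNIV. \<Sum>j\<in>UNIV. (a i * b j) *\<^sub>R poisson p (pull (f i)) (G j))"
    if "\<And>j. G j \<in> cinf (ct p)" for G :: "'c \<Rightarrow> ('a + 'a) sfun"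
    using that
    by (subst sum.swap) (simp add: pull_sum pull_scaleR poisson_sum_left poisson_scaleR_left poisson_sum_right
        poisson_scaleR_right cinf_pull cinf_scaleR f scaleR_sum_right mult.commute)
  ultimately show ?thesis
    unfolding schouten_bracket_def
    by (simp add: cinf_poisson S cinf_pull g zero_section_sum zero_section_scaleR)
qed

lemma cinf_linear_function: "linear_function p t u \<in> cinf (shift p)"
  unfolding linear_function_def by (intro cinf_sum cinf_scaleR cinf_crd)

lemma has_parity_linear_function:
  assumes "vec_parity p a u" shows "has_parity (a + 1) (linear_function p t u)"
  unfolding linear_function_def
proof (rule has_parity_sum)
  fix i
  show "has_parity (a + 1) ((u $ i * t i) *\<^sub>R crd (shift p) i)"
  proof (cases "u $ i = 0")
    case False
    then have "even (p i + a)" using assms by (auto simp: vec_parity_def)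
    then have "has_parity (a + 1) (crd (shift p) i)"
      by (intro has_parity_cong[OF _ has_parity_crd]) (simp add: shift_apply)
    then show ?thesis by (rule has_parity_scaleR)
  qed simp
qed

lemma linear_linear_function: "linear (linear_function p t)"
  by (rule linearI) (simp_all add: linear_function_def distrib_right scaleR_left_distrib sum.distrib
      scaleR_sum_right mult.assoc)

lemma linear_function_axis: "linear_function p t (axis i 1) = t i *\<^sub>R crd (shift p) i"
proof -
  have "linear_function p t (axis i 1) = (\<Sum>j\<in>UNIV. if j = i then t j *\<^sub>R crd (shift p) j else 0)"
    unfolding linear_function_def by (rule sum.cong) (auto simp: axis_def)
  then show ?thesis by simp
qed

lemma schouten_gives_lieI:
  assumes S: "S \<in> cinf (ct (shift p))" and brs: "bilinear brs"
    and basis: "\<And>i j. (t i * t j) *\<^sub>R schouten_bracket (shift p) S (crd (shift p) i) (crd (shift p) j)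
      = linear_function p t (brs (axis i 1) (axis j 1))"
  shows "schouten_gives_lie p t S brs"
  unfolding schouten_gives_lie_def
proof (intro conjI allI brs)
  fix u v
  have "schouten_bracket (shift p) S (linear_function p t u) (linear_function p t v)
    = (\<Sum>i\<in>UNIV. \<Sum>j\<in>UNIV. (u $ i * v $ j) *\<^sub>R linear_function p t (brs (axis i 1) (axis j 1)))"
    unfolding linear_function_def[of p t u] linear_function_def[of p t v]
    by (simp add: schouten_bracket_sum S basis[symmetric] mult_ac)
  also have "\<dots> = linear_function p t (brs u v)"
    unfolding bilinear_sum_axis[OF brs, of u v]
    by (simp add: linear_sum[OF linear_linear_function] linear_scale[OF linear_linear_function])
  finally show "schouten_bracket (shift p) S (linear_function p t u) (linear_function p t v)
    = linear_function p t (brs u v)" .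
qed

text \<open>The derived bracket of \<open>S\<close> satisfies the Jacobi identity up to \<open>{S,S}\<close>, which is cubic in
  the momenta and hence determined by its bracket with three linear functions.\<close>

lemma lie_super_imp_poisson_zero:
  assumes S: "S \<in> fiber_hom (shift p) (Suc (Suc 0))" "has_parity 1 S"
    and gives: "schouten_gives_lie p t S brs" and lie: "lie_super p brs"
    and t: "\<And>i. t i \<noteq> 0"
  shows "poisson (shift p) S S = 0"
proof -
  let ?q = "shift p"
  define l where "l = (\<lambda>u. pull (linear_function p t u))"
  have Sc: "S \<in> cinf (ct ?q)" by (rule cinf_fiber_hom[OF S(1)])
  have lc: "l u \<in> cinf (ct ?q)" for u
    unfolding l_def by (intro cinf_pull cinf_linear_function)
  have lp: "has_parity (a + 1) (l u)" if "vec_parity p a u" for a u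
    unfolding l_def by (intro has_parity_pull has_parity_linear_function that)
  have lin: "linear l"
    unfolding l_def
    by (rule linearI) (simp_all add: linear_add[OF linear_linear_function] linear_scale[OF linear_linear_function]
        pull_add pull_scaleR)
  have br: "poisson ?q (l u) (poisson ?q S (l v)) = l (brs u v)" for u v
    using gives unfolding l_def schouten_gives_lie_def
    by (simp add: pull_schouten_bracket[OF S(1)] cinf_linear_function)
  note P = cinf_poisson Sc lc
  let ?F = "poisson ?q S S"
  have F: "?F \<in> fiber_hom ?q (Suc (Suc (Suc 0)))" "has_parity 0 ?F" "?F \<in> cinf (ct ?q)"
    using fiber_hom_poisson[OF S(1) S(1)] has_parity_cong[OF _ has_parity_poisson[OF S(2) Sc S(2)], of 0]
    by (simp_all add: P)
  \<comment> \<open>With y_v = {S, l_v}, the fact \<open>br\<close> says that {l_u, y_v} is the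
    linear function of \<open>brs u v\<close>. The Poisson Jacobi identity moves l_u and l_v inward
    until only the Jacobi expression of \<open>brs\<close> remains.\<close>
  have zero: "poisson ?q (l u) (poisson ?q (l v) (poisson ?q S (poisson ?q S (l w)))) = 0"
    if u: "vec_parity p a u" and v: "vec_parity p b v" and w: "vec_parity p c w" for a b c u v w
  proof -
    let ?y = "\<lambda>v. poisson ?q S (l v)"
    have yc: "?y v \<in> cinf (ct ?q)" for v by (intro P)
    have yp: "has_parity (e + 2) (?y v)" if "vec_parity p e v" for e v
      using has_parity_poisson[OF S(2) Sc lp[OF that]] by simp
    have "poisson ?q (l v) S = - ((-1) ^ ((b + 1) * 1) *\<^sub>R ?y v)"
      by (rule poisson_antisym[OF lp[OF v] S(2)])
    then have 1: "poisson ?q (l v) (poisson ?q S (?y w))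
      = (-1) ^ b *\<^sub>R (poisson ?q (?y v) (?y w) - poisson ?q S (l (brs v w)))"
      using poisson_jacobi[OF lp[OF v] lc S(2) Sc yc[of w]]
      by (cases "even b") (simp_all add: poisson_minus_left yc br)
    have uw: "vec_parity p (a + c) (brs u w)"
      by (rule lie_superD(2)[OF lie u w])
    \<comment> \<open>Here the linear function stands in the second place; the antisymmetry of the
      Poisson bracket is compensated by that of \<open>brs\<close>.\<close>
    have "poisson ?q (?y v) (l (brs u w)) = - ((-1) ^ ((b + 2) * (a + c + 1)) *\<^sub>R poisson ?q (l (brs u w)) (?y v))"
      by (rule poisson_antisym[OF yp[OF v] lp[OF uw]])
    moreover have "brs (brs u w) v = - ((-1) ^ ((a + c) * b) *\<^sub>R brs v (brs u w))"
      by (rule lie_superD(3)[OF lie uw v])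
    ultimately have 2: "poisson ?q (?y v) (l (brs u w)) = (-1) ^ b *\<^sub>R l (brs v (brs u w))"
      by (cases "even a"; cases "even b"; cases "even c") (simp_all add: br linear_neg[OF lin] linear_scale[OF lin])
    have 3: "poisson ?q (l u) (poisson ?q (?y v) (?y w))
      = l (brs (brs u v) w) + (-1) ^ (a * b) *\<^sub>R l (brs v (brs u w))"
      using poisson_jacobi[OF lp[OF u] lc yp[OF v] yc yc[of w]]
      by (cases "even a"; cases "even b") (simp_all add: br 2)
    have "poisson ?q (l u) (poisson ?q (?y v) (?y w) - poisson ?q S (l (brs v w)))
      = l (brs (brs u v) w + (-1) ^ (a * b) *\<^sub>R brs v (brs u w) - brs u (brs v w))"
      by (simp add: poisson_diff_right P 3 br linear_add[OF lin] linear_diff[OF lin] linear_scale[OF lin])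
    also have "\<dots> = 0"
      using lie_superD(4)[OF lie u v w] by (simp add: linear_0[OF lin])
    finally show ?thesis
      unfolding 1 by (simp add: poisson_scaleR_right P cinf_diff)
  qed
  have "pd (ct ?q) (Inr i) (pd (ct ?q) (Inr j) (pd (ct ?q) (Inr k) ?F)) = 0" for i j k
  proof -
    \<comment> \<open>For the odd \<open>S\<close> the Jacobi identity doubles the iterated bracket
      instead of cancelling it, which brings in {S, S}.\<close>
    have "poisson ?q S (poisson ?q S (l w)) = (1/2) *\<^sub>R poisson ?q ?F (l w)" for w
    proof -
      have "poisson ?q ?F (l w) = 2 *\<^sub>R poisson ?q S (poisson ?q S (l w))"
        using poisson_jacobi[OF S(2) Sc S(2) Sc lc[of w]] by (simp add: scaleR_2 eq_diff_eq)
      then show ?thesis by simp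
    qed
    then have "poisson ?q (l (axis i 1)) (poisson ?q (l (axis j 1)) (poisson ?q ?F (l (axis k 1)))) = 0"
      using zero[OF vec_parity_axis vec_parity_axis vec_parity_axis, of i j k]
      by (simp add: poisson_scaleR_right P F)
    moreover have la: "l (axis i 1) = t i *\<^sub>R pos ?q i" for i
      unfolding l_def by (simp add: linear_function_axis pull_scaleR pull_crd)
    moreover have "poisson ?q ?F (pos ?q k) = (-1) ^ (?q k) *\<^sub>R pd (ct ?q) (Inr k) ?F"
      unfolding poisson_crd ham_field_Inl(1)[OF F(2)] by simp
    ultimately show ?thesis
      using t by (simp add: poisson_scaleR_left poisson_scaleR_right poisson_pos P F cinf_pd
          cinf_scaleR cinf_minus poisson_minus_right pd_minus pd_scaleR)
  qed
  then have "pd (ct ?q) (Inr j) (pd (ct ?q) (Inr k) ?F) = 0" for j k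
    by (intro fiber_hom_eq_0I[OF fiber_hom_pd_Inr[OF fiber_hom_pd_Inr[OF F(1)]]])
  then have "pd (ct ?q) (Inr k) ?F = 0" for k
    by (intro fiber_hom_eq_0I[OF fiber_hom_pd_Inr[OF F(1)]])
  then show ?thesis by (intro fiber_hom_eq_0I[OF F(1)])
qed

subsection \<open>The adjoint action on tensors\<close>

lemma tensor_nth: "tensor X Y $ i $ j = X $ i * Y $ j"
  by (simp add: tensor_def)

lemma linear_tensor: "linear (tensor X)" "linear (\<lambda>X. tensor X Y)"
  by (auto intro!: linearI simp: vec_eq_iff tensor_nth algebra_simps)

lemma tensor_expansion: "(s :: real ^ 'c ^ 'c) = (\<Sum>i\<in>UNIV. \<Sum>j\<in>UNIV. s $ i $ j *\<^sub>R tensor (axis i 1) (axis j 1))"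
proof -
  have *: "s $ k $ l = (\<Sum>i\<in>UNIV. \<Sum>j\<in>UNIV. s $ i $ j * (axis i 1 $ k * axis j 1 $ l))" for k l
  proof -
    have "s $ k $ l = (\<Sum>i\<in>UNIV. \<Sum>j\<in>UNIV. if j = l then (if i = k then s $ i $ j else 0) else 0)"
      by simp
    also have "\<dots> = (\<Sum>i\<in>UNIV. \<Sum>j\<in>UNIV. s $ i $ j * (axis i 1 $ k * axis j 1 $ l))"
      by (intro sum.cong refl) (auto simp: axis_def)
    finally show ?thesis .
  qed
  show ?thesis
    unfolding vec_eq_iff
  proof (intro allI)
    fix k l
    show "s $ k $ l = (\<Sum>i\<in>UNIV. \<Sum>j\<in>UNIV. s $ i $ j *\<^sub>R tensor (axis i 1) (axis j 1)) $ k $ l"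
      by (subst *) (simp add: tensor_nth)
  qed
qed

lemma linear_ad_tensor: "linear (ad_tensor p br X)" "linear (\<lambda>X. ad_tensor p br X s)"
  unfolding ad_tensor_def
  by (auto intro!: linearI simp: algebra_simps scaleR_left_distrib sum.distrib scaleR_sum_right)

text \<open>Recovers the graded Leibniz rule from the definition in a basis. \<open>V\<close> may be
  inhomogeneous, since the sign involves only the factor passed by \<open>X\<close>.\<close>

lemma ad_tensor_tensor:
  assumes br: "bilinear br" and X: "vec_parity p a X" and U: "vec_parity p u U"
  shows "ad_tensor p br X (tensor U V) = tensor (br X U) V + (-1) ^ (a * u) *\<^sub>R tensor U (br X V)"
proof -
  have 1: "tensor (br X U) V = (\<Sum>a\<in>UNIV. \<Sum>i\<in>UNIV. \<Sum>j\<in>UNIV. (X $ a * U $ i * V $ j) *\<^sub>R tensor (br (axis a 1) (axis i 1)) (axis j 1))"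
  proof -
    have "tensor (br X U) V = (\<Sum>a\<in>UNIV. \<Sum>i\<in>UNIV. (X $ a * U $ i) *\<^sub>R tensor (br (axis a 1) (axis i 1)) V)"
      unfolding bilinear_sum_axis[OF br, of X U]
      by (simp add: linear_sum[OF linear_tensor(2)] linear_scale[OF linear_tensor(2)])
    also have "\<dots> = (\<Sum>a\<in>UNIV. \<Sum>i\<in>UNIV. (X $ a * U $ i) *\<^sub>R (\<Sum>j\<in>UNIV. V $ j *\<^sub>R tensor (br (axis a 1) (axis i 1)) (axis j 1)))"
      by (subst vec_axis_expansion[of V]) (simp add: linear_sum[OF linear_tensor(1)] linear_scale[OF linear_tensor(1)])
    finally show ?thesis by (simp add: scaleR_sum_right)
  qed
  have 2: "(-1) ^ (a * u) *\<^sub>R tensor U (br X V) = (\<Sum>b\<in>UNIV. \<Sum>i\<in>UNIV. \<Sum>j\<in>UNIV.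
      (X $ b * U $ i * V $ j) *\<^sub>R ((-1) ^ (p b * p i) *\<^sub>R tensor (axis i 1) (br (axis b 1) (axis j 1))))"
  proof -
    have sgn: "X $ b * U $ i * V $ j * (-1) ^ (p b * p i) = (-1) ^ (a * u) * (X $ b * U $ i * V $ j)" for b i j
      using X U by (cases "X $ b = 0"; cases "U $ i = 0")
        (fastforce simp: vec_parity_def minus_one_power_iff)+
    have "tensor U (br X V) = (\<Sum>i\<in>UNIV. U $ i *\<^sub>R tensor (axis i 1) (br X V))"
      by (subst vec_axis_expansion[of U]) (simp add: linear_sum[OF linear_tensor(2)] linear_scale[OF linear_tensor(2)])
    also have "\<dots> = (\<Sum>i\<in>UNIV. U $ i *\<^sub>R (\<Sum>b\<in>UNIV. \<Sum>j\<in>UNIV. (X $ b * V $ j) *\<^sub>R tensor (axis i 1) (br (axis b 1) (axis j 1))))"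
      unfolding bilinear_sum_axis[OF br, of X V]
      by (simp add: linear_sum[OF linear_tensor(1)] linear_scale[OF linear_tensor(1)])
    also have "\<dots> = (\<Sum>i\<in>UNIV. \<Sum>b\<in>UNIV. \<Sum>j\<in>UNIV. (X $ b * U $ i * V $ j) *\<^sub>R tensor (axis i 1) (br (axis b 1) (axis j 1)))"
      by (simp add: scaleR_sum_right mult_ac)
    also have "\<dots> = (\<Sum>b\<in>UNIV. \<Sum>i\<in>UNIV. \<Sum>j\<in>UNIV. (X $ b * U $ i * V $ j) *\<^sub>R tensor (axis i 1) (br (axis b 1) (axis j 1)))"
      by (rule sum.swap)
    finally show ?thesis by (simp add: scaleR_sum_right sgn)
  qed
  show ?thesis
    unfolding 1 2 ad_tensor_def tensor_nth
    by (simp add: sum.distrib scaleR_add_right mult.assoc)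
qed

text \<open>The Jacobi identity acts in each factor separately, and the cross terms, in which
  \<open>X\<close> and \<open>Y\<close> act on different factors, cancel. Consequently every
  coboundary is a cocycle.\<close>

lemma ad_tensor_representation:
  assumes lie: "lie_super p br" and X: "vec_parity p a X" and Y: "vec_parity p b Y"
  shows "ad_tensor p br (br X Y) s
    = ad_tensor p br X (ad_tensor p br Y s) - (-1) ^ (a * b) *\<^sub>R ad_tensor p br Y (ad_tensor p br X s)"
proof -
  note br = lie_superD(1)[OF lie]
  note lin = linear_ad_tensor(1)[of p br]
  let ?f = "\<lambda>s. ad_tensor p br X (ad_tensor p br Y s) - (-1) ^ (a * b) *\<^sub>R ad_tensor p br Y (ad_tensor p br X s)"
  have f: "linear ?f"
    by (intro linear_compose_sub linear_compose_scale_right linear_compose[OF lin lin, unfolded o_def])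
  have basis: "ad_tensor p br (br X Y) (tensor (axis i 1) V) = ?f (tensor (axis i 1) V)" for i V
  proof -
    let ?U = "axis i 1"
    note U = vec_parity_axis[of p i]
    note ad = ad_tensor_tensor[OF br]
    note XU = lie_superD(2)[OF lie X U] and YU = lie_superD(2)[OF lie Y U]
    have jac: "br X (br Y Z) = br (br X Y) Z + (-1) ^ (a * b) *\<^sub>R br Y (br X Z)" if "vec_parity p c Z" for c Z
      by (rule lie_superD(4)[OF lie X Y that])
    \<comment> \<open>The second tensor factor is arbitrary, so the identity is needed with an
      inhomogeneous last argument.\<close>
    have jac': "br X (br Y Z) = br (br X Y) Z + (-1) ^ (a * b) *\<^sub>R br Y (br X Z)" for Z
    proof -
      have l: "linear (br X)" for X using br by (auto simp: bilinear_def)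
      have "linear (\<lambda>Z. br X (br Y Z))" "linear (\<lambda>Z. br (br X Y) Z + (-1) ^ (a * b) *\<^sub>R br Y (br X Z))"
        by (intro linear_compose_add linear_compose_scale_right l linear_compose[OF l l, unfolded o_def])+
      then show ?thesis
        by (rule linear_eq_axisI) (rule jac[OF vec_parity_axis])
    qed
    have 1: "ad_tensor p br (br X Y) (tensor ?U V)
      = tensor (br (br X Y) ?U) V + (-1) ^ ((a + b) * p i) *\<^sub>R tensor ?U (br (br X Y) V)"
      by (rule ad[OF lie_superD(2)[OF lie X Y] U])
    have 2: "?f (tensor ?U V) =
      tensor (br X (br Y ?U)) V - (-1) ^ (a * b) *\<^sub>R tensor (br Y (br X ?U)) V
      + (-1) ^ ((a + b) * p i) *\<^sub>R (tensor ?U (br X (br Y V)) - (-1) ^ (a * b) *\<^sub>R tensor ?U (br Y (br X V)))"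
      unfolding ad[OF X U] ad[OF Y U] linear_add[OF lin] linear_scale[OF lin] ad[OF X YU] ad[OF Y XU]
        ad[OF X U] ad[OF Y U]
      by (cases "even a"; cases "even b"; cases "even (p i)") (simp_all add: algebra_simps)
    show ?thesis
      unfolding 1 2 jac'[of ?U] jac'[of V] linear_add[OF linear_tensor(1)] linear_add[OF linear_tensor(2)]
        linear_scale[OF linear_tensor(1)] linear_scale[OF linear_tensor(2)]
      by (simp add: algebra_simps)
  qed
  show ?thesis
    by (subst (1 2 3) tensor_expansion[of s])
      (simp add: linear_sum[OF f] linear_scale[OF f] linear_sum[OF lin] linear_scale[OF lin] basis
        sum_subtractf scaleR_diff_right scaleR_sum_right mult.commute)
qed

subsection \<open>The tensor \<open>{p_X, r}\<close>\<close>

lemma sum_delta_mult_scaleR: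
  "(\<Sum>b\<in>UNIV. c b *\<^sub>R ((if a = b then 1 else 0) * g b)) = c a *\<^sub>R g a"
  for g :: "'a::finite \<Rightarrow> 'c::{finite,linorder} sfun"
  using sum_delta_mult(2)[of a "\<lambda>b. c b *\<^sub>R g b"] by simp

lemma double_ct_shift: "shift (ct p) = ct (shift p)"
  by (rule ext) (simp add: shift_def ct_def split: sum.splits)

text \<open>The partner of an index: xi^i and its momentum xi_i, or equally e_i and the dual vector
  e^i.\<close>

definition conj_index :: "'i + 'i \<Rightarrow> 'i + 'i" where
  "conj_index = case_sum Inr Inl"

lemma conj_index_simps [simp]: "conj_index (Inl i) = Inr i" "conj_index (Inr i) = Inl i"
  "conj_index (conj_index c) = c" "ct p (conj_index c) = ct p c"
  by (simp_all add: conj_index_def ct_def split: sum.splits)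

lemma r_fun_properties:
  "has_parity 0 (r_fun p)" "r_fun p \<in> cinf (ct (ct (shift p)))"
  "r_fun p \<in> fiber_hom (ct (shift p)) (Suc (Suc 0))"
proof -
  let ?m = "mom (ct (shift p))"
  have "has_parity (shift p i + shift p i) (?m (Inl i) * ?m (Inr i))" for i
    using has_parity_mult[OF has_parity_mom has_parity_mom, of "ct (shift p)" "Inl i" "ct (shift p)" "Inr i"] by simp
  then show "has_parity 0 (r_fun p)"
    unfolding r_fun_def by (intro has_parity_sum has_parity_cong[of "shift p _ + shift p _" 0]) auto
  show "r_fun p \<in> fiber_hom (ct (shift p)) (Suc (Suc 0))"
    unfolding r_fun_def by (intro fiber_hom_sum fiber_hom_mom fiber_hom_mom_1)
  then show "r_fun p \<in> cinf (ct (ct (shift p)))" by (rule cinf_fiber_hom)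
qed

text \<open>The sign in {r, x^b}. For xi^i it is the sign in the Poisson bracket; for xi_i that sign
  is cancelled when the derivative passes the factor pi_i to reach pi^i.\<close>

definition r_sign :: "('i \<Rightarrow> nat) \<Rightarrow> 'i + 'i \<Rightarrow> real" where
  "r_sign p = case_sum (\<lambda>i. (-1) ^ shift p i) (\<lambda>_. 1)"

lemma poisson_r_pos:
  "poisson (ct (shift p)) (r_fun p) (pos (ct (shift p)) b)
    = r_sign p b *\<^sub>R mom (ct (shift p)) (conj_index b)"
proof -
  let ?q = "ct (shift p)"
  have "pd (ct ?q) (Inr b) (r_fun p) = (\<Sum>i\<in>UNIV. pd (ct ?q) (Inr b) (mom ?q (Inl i) * mom ?q (Inr i)))"
    unfolding r_fun_def by (intro pd_sum cinf_mult cinf_crd)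
  also have "\<dots> = (\<Sum>i\<in>UNIV. (if b = Inl i then 1 else 0) * mom ?q (Inr i)
      + (if b = Inr i then 1 else 0) * ((-1) ^ (?q b * shift p i) *\<^sub>R mom ?q (Inl i)))"
    by (rule sum.cong) (auto simp: pd_mom_mult[OF cinf_crd] pd_crd)
  finally have "pd (ct ?q) (Inr b) (r_fun p) = (case b of Inl i \<Rightarrow> mom ?q (Inr i)
      | Inr i \<Rightarrow> (-1) ^ shift p i *\<^sub>R mom ?q (Inl i))"
    by (cases b; cases "even (shift p (projr b))")
      (simp_all add: sum_delta_mult sum_delta_mult_scaleR sum.distrib)
  then show ?thesis
    unfolding poisson_crd
    by (cases b) (simp_all add: ham_field_Inl[OF r_fun_properties(1)] r_sign_def)
qed

text \<open>The Jacobi identity splits {{p_X, r}, x^b} into {p_X, {r, x^b}} - {r, {p_X, x^b}}.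
  Bracketed with x^a, the first part differentiates X^a along the partner of \<open>b\<close>, the
  second X^b along the partner of \<open>a\<close>.\<close>

lemma schouten_bracket_crd:
  fixes p :: "'i::{finite,linorder} \<Rightarrow> nat"
  defines "q \<equiv> ct (shift p)"
  assumes X: "vector_field q 1 X"
  shows "2 *\<^sub>R schouten_bracket q ((1/2) *\<^sub>R poisson q (ham q X) (r_fun p)) (crd q a) (crd q b)
    = (r_sign p b * (-1) ^ (q a + q b + q a * q b)) *\<^sub>R pd q (conj_index b) (X a)
      + r_sign p a *\<^sub>R pd q (conj_index a) (X b)"
proof -
  let ?h = "ham q X" and ?r = "r_fun p"
  note h = has_parity_ham[OF X] cinf_ham[OF X]
  have r: "has_parity 0 ?r" "?r \<in> cinf (ct q)" using r_fun_properties unfolding q_def by auto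
  have r_pos: "poisson q ?r (pos q b) = r_sign p b *\<^sub>R mom q (conj_index b)" for b
    unfolding q_def by (rule poisson_r_pos)
  have qc: "q (conj_index b) = q b" for b unfolding q_def by simp
  have Xc: "X a \<in> cinf q" for a by (rule vector_field_cinf[OF X])
  have 1: "poisson q (poisson q ?h ?r) (pos q b)
    = r_sign p b *\<^sub>R poisson q ?h (mom q (conj_index b)) - poisson q ?r (pull (X b))"
    using poisson_jacobi[OF h r cinf_crd[of "ct q" "Inl b"]]
    by (simp add: r_pos poisson_scaleR_right poisson_crd[of q ?h] ham_field_ham[OF X])
  have 2: "poisson q (pos q a) (poisson q ?h (mom q c)) = (-1) ^ (q a + q c + q a * q c) *\<^sub>R pull (pd q c (X a))" for c
  proof -
    have "poisson q ?h (mom q c) = - ((-1) ^ (q c * 1) *\<^sub>R pd (ct q) (Inl c) ?h)"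
      unfolding poisson_crd by (rule ham_field_Inl(2)[OF h(1)])
    then have "poisson q (pos q a) (poisson q ?h (mom q c))
      = (-1) ^ q a *\<^sub>R (-1) ^ q c *\<^sub>R pd (ct q) (Inr a) (pd (ct q) (Inl c) ?h)"
      by (simp add: poisson_pos pd_minus pd_scaleR cinf_scaleR cinf_pd h)
    also have "pd (ct q) (Inr a) (pd (ct q) (Inl c) ?h) = (-1) ^ (q a * q c) *\<^sub>R pull (pd q c (X a))"
      unfolding pd_commute[OF h(2), of "Inr a" "Inl c"] pd_Inr_ham[OF X]
      by (simp add: pd_scaleR cinf_pull Xc pd_pull)
    finally show ?thesis by (simp add: power_add)
  qed
  \<comment> \<open>Functions of the base commute with each other, so only the bracket of
    \<open>pos q a\<close> with r contributes.\<close>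
  have 3: "poisson q (pos q a) (poisson q ?r (pull (X b))) = - (r_sign p a *\<^sub>R pull (pd q (conj_index a) (X b)))"
  proof -
    have "poisson q (pos q a) ?r = - (r_sign p a *\<^sub>R mom q (conj_index a))"
      using poisson_antisym[OF has_parity_crd r(1), of q "ct q" "Inl a"] by (simp add: r_pos)
    moreover have "poisson q (pos q a) (pull (X b)) = 0"
      by (simp add: poisson_pos pd_Inr_pull Xc)
    moreover have "has_parity (q a) (pos q a)" using has_parity_crd[of "ct q" "Inl a"] by simp
    ultimately show ?thesis
      using poisson_jacobi[OF _ cinf_crd r cinf_pull[OF Xc], of "q a" "Inl a" b]
      by (simp add: poisson_minus_left poisson_scaleR_left cinf_scaleR poisson_mom pd_pull Xc)
  qed
  have "poisson q (pos q a) (poisson q (poisson q ?h ?r) (pos q b))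
    = pull ((r_sign p b * (-1) ^ (q a + q b + q a * q b)) *\<^sub>R pd q (conj_index b) (X a)
      + r_sign p a *\<^sub>R pd q (conj_index a) (X b))"
    unfolding 1
    by (simp add: poisson_diff_right poisson_scaleR_right cinf_scaleR cinf_poisson h r cinf_pull Xc 2 3
        pull_add pull_scaleR qc)
  then show ?thesis
    unfolding schouten_bracket_def pull_crd
    by (simp add: poisson_scaleR_left poisson_scaleR_right cinf_poisson h r zero_section_scaleR)
qed

section \<open>The double of a Lie bialgebra\<close>

lemma double_sign_simps [simp]: "double_sign p (Inl i) = 1" "double_sign p (Inr i) = (-1) ^ p i"
  by (simp_all add: double_sign_def)

lemma double_sign_square: "double_sign p c * double_sign p c = 1"
  by (cases c) (simp_all flip: power_add)

lemma incl_nth [simp]: "incl X $ Inl i = X $ i" "incl X $ Inr i = 0"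
  "incl_dual X $ Inl i = 0" "incl_dual X $ Inr i = X $ i"
  by (simp_all add: incl_def incl_dual_def)

lemma vec_sum_eqI: "(\<And>i. X $ Inl i = Y $ Inl i) \<Longrightarrow> (\<And>i. X $ Inr i = Y $ Inr i) \<Longrightarrow> X = Y"
  by (metis vec_eq_iff sum.exhaust)

lemma incl_axis: "incl (axis i 1) = axis (Inl i) 1" "incl_dual (axis i 1) = axis (Inr i) 1"
  by (rule vec_sum_eqI; simp add: axis_def)+

lemma linear_incl: "linear incl" "linear incl_dual"
  by (auto intro!: linearI vec_sum_eqI)

lemma bilinear_compose_incl:
  assumes "bilinear br"
  shows "bilinear (\<lambda>X Y. br (incl X) (incl Y))" "bilinear (\<lambda>X Y. br (incl_dual X) (incl_dual Y))"
  using assms unfolding bilinear_def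
  by (auto intro: linear_compose[OF linear_incl(1), unfolded o_def] linear_compose[OF linear_incl(2), unfolded o_def])

lemma bilinear_incl_compose:
  assumes "bilinear br"
  shows "bilinear (\<lambda>X Y. incl (br X Y))" "bilinear (\<lambda>X Y. incl_dual (br X Y))"
  using assms unfolding bilinear_def
  by (auto intro: linear_compose[OF _ linear_incl(1), unfolded o_def] linear_compose[OF _ linear_incl(2), unfolded o_def])

section \<open>The inner product and the tensor of the double in a basis\<close>

lemma double_inner_axis:
  "double_inner p Y (axis c 1) = double_sign p c * Y $ conj_index c"
  "double_inner p (axis c 1) Y = double_sign p (conj_index c) * Y $ conj_index c"
proof -
  have *: "(\<Sum>i\<in>UNIV. a i * (if i = k then 1 else 0)) = a k" for k :: 'a and a :: "'a \<Rightarrow> real"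
  proof -
    have "(\<Sum>i\<in>UNIV. a i * (if i = k then 1 else 0)) = (\<Sum>i\<in>UNIV. if i = k then a i else 0)"
      by (rule sum.cong) auto
    then show ?thesis by simp
  qed
  have sq: "(-1 :: real) ^ (n * n) = (-1) ^ n" for n :: nat
    by (cases "even n") simp_all
  show "double_inner p Y (axis c 1) = double_sign p c * Y $ conj_index c"
    "double_inner p (axis c 1) Y = double_sign p (conj_index c) * Y $ conj_index c"
    by (cases c; simp add: double_inner_def axis_def sq *[where a = "\<lambda>i. Y $ Inr i"]
        *[where a = "\<lambda>i. (-1) ^ p i * Y $ Inl i", unfolded mult.assoc] *
        if_distrib[of "\<lambda>x. x * _"] if_distrib[of "\<lambda>x. _ * x"] cong: if_cong)+
qed

lemma linear_double_inner: "linear (double_inner p X)" "linear (\<lambda>X. double_inner p X Y)"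
  by (auto intro!: linearI simp: double_inner_def algebra_simps sum.distrib sum_distrib_left)

lemma double_inner_nondegenerate:
  assumes "\<And>c. double_inner p Y (axis c 1) = 0" shows "Y = 0"
proof -
  have "Y $ c = 0" for c
    using assms[of "conj_index c"] double_sign_square[of p "conj_index c"]
    by (auto simp: double_inner_axis)
  then show ?thesis by (simp add: vec_eq_iff)
qed

lemma double_r_nth: "double_r p $ b $ c = (if b = conj_index c then
    (case c of Inl i \<Rightarrow> - (1/2) * (-1) ^ p i | Inr i \<Rightarrow> 1/2) else 0)"
proof -
  have sq: "(-1 :: real) ^ (n * n) = (-1) ^ n" for n :: nat
    by (cases "even n") simp_all
  show ?thesis
    by (cases b; cases c)
      (auto simp: double_r_def tensor_nth axis_def sq if_distrib[of "\<lambda>x. x * _"]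
        if_distrib[of "\<lambda>x. _ * x"] sum_subtractf sum_negf cong: if_cong)
qed

lemma ad_tensor_axis_nth:
  "ad_tensor p br (axis a 1) s $ b $ c
    = (\<Sum>i\<in>UNIV. s $ i $ c * br (axis a 1) (axis i 1) $ b)
      + (\<Sum>j\<in>UNIV. (-1) ^ (p a * p b) * s $ b $ j * br (axis a 1) (axis j 1) $ c)"
proof -
  have "ad_tensor p br (axis a 1) s = (\<Sum>a'\<in>UNIV. if a' = a then (\<Sum>i\<in>UNIV. \<Sum>j\<in>UNIV. (s $ i $ j) *\<^sub>R
     (tensor (br (axis a' 1) (axis i 1)) (axis j 1)
      + (-1) ^ (p a' * p i) *\<^sub>R tensor (axis i 1) (br (axis a' 1) (axis j 1)))) else 0)"
    unfolding ad_tensor_def by (rule sum.cong) (auto simp: axis_def)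
  then have "ad_tensor p br (axis a 1) s $ b $ c
    = (\<Sum>i\<in>UNIV. \<Sum>j\<in>UNIV. s $ i $ j * (br (axis a 1) (axis i 1) $ b * axis j 1 $ c))
      + (\<Sum>i\<in>UNIV. \<Sum>j\<in>UNIV. s $ i $ j * ((-1) ^ (p a * p i) * (axis i 1 $ b * br (axis a 1) (axis j 1) $ c)))"
    by (simp add: tensor_nth distrib_left sum.distrib)
  also have "(\<Sum>i\<in>UNIV. \<Sum>j\<in>UNIV. s $ i $ j * (br (axis a 1) (axis i 1) $ b * axis j 1 $ c))
    = (\<Sum>i\<in>UNIV. \<Sum>j\<in>UNIV. if j = c then s $ i $ j * br (axis a 1) (axis i 1) $ b else 0)"
    by (intro sum.cong refl) (auto simp: axis_def)
  also have "(\<Sum>i\<in>UNIV. \<Sum>j\<in>UNIV. s $ i $ j * ((-1) ^ (p a * p i) * (axis i 1 $ b * br (axis a 1) (axis j 1) $ c)))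
    = (\<Sum>j\<in>UNIV. \<Sum>i\<in>UNIV. if i = b then (-1) ^ (p a * p i) * s $ i $ j * br (axis a 1) (axis j 1) $ c else 0)"
    by (subst sum.swap, intro sum.cong refl) (auto simp: axis_def)
  finally show ?thesis by simp
qed

text \<open>The tensor pairs each index only with its partner, so each sum has a single
  term.\<close>

lemma double_coboundary_nth:
  "ad_tensor (ct p) br (axis a 1) (double_r p) $ b $ c
    = double_r p $ conj_index c $ c * br (axis a 1) (axis (conj_index c) 1) $ b
      + (-1) ^ (ct p a * ct p b) * double_r p $ b $ conj_index b * br (axis a 1) (axis (conj_index b) 1) $ c"
proof -
  have "(\<Sum>i\<in>UNIV. double_r p $ i $ c * br (axis a 1) (axis i 1) $ b)
    = (\<Sum>i\<in>UNIV. if i = conj_index c then double_r p $ i $ c * br (axis a 1) (axis i 1) $ b else 0)"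
    by (rule sum.cong) (auto simp: double_r_nth)
  moreover have "(\<Sum>j\<in>UNIV. (-1) ^ (ct p a * ct p b) * double_r p $ b $ j * br (axis a 1) (axis j 1) $ c)
    = (\<Sum>j\<in>UNIV. if j = conj_index b then (-1) ^ (ct p a * ct p b) * double_r p $ b $ j * br (axis a 1) (axis j 1) $ c else 0)"
    by (rule sum.cong) (auto simp: double_r_nth)
  ultimately show ?thesis unfolding ad_tensor_axis_nth by simp
qed

lemma linear_dual_cobracket: "linear (dual_cobracket brs)"
  by (auto intro!: linearI simp: dual_cobracket_def vec_eq_iff inner_add_right inner_scaleR_right)

lemma dual_cobracket_axis: "dual_cobracket brs (axis a 1) $ b $ c = brs (axis c 1) (axis b 1) $ a"
  by (simp add: dual_cobracket_def inner_axis)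

text \<open>The difference of the brackets of two doubles vanishes on \<open>g\<close> and on \<open>g*\<close>; invariance
  then makes it vanish on mixed arguments.\<close>

lemma drinfeld_double_unique:
  assumes D: "drinfeld_double p br brs brD brDs" and D': "drinfeld_double p br brs brD' brDs'"
  shows "brD = brD'" "brDs = brDs'"
proof -
  let ?d = "\<lambda>a b. brD (axis a 1) (axis b 1) - brD' (axis a 1) (axis b 1)"
  have skew: "lie_super (ct p) brD" "lie_super (ct p) brD'"
    and lie: "lie_super (ct p) brDs" "lie_super (ct p) brDs'"
    using D D' unfolding drinfeld_double_def lie_bialgebra_def by blast+
  note bil = skew[THEN lie_superD(1)] lie[THEN lie_superD(1)]
  have skew_d: "?d a b = - ((-1) ^ (ct p a * ct p b) *\<^sub>R ?d b a)" for a b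
    using skew[THEN lie_superD(3), OF vec_parity_axis[of "ct p" a] vec_parity_axis[of "ct p" b]]
    by (simp add: scaleR_diff_right)
  have inv: "double_inner p (?d a b) Y = - ((-1) ^ (ct p a * ct p b) * double_inner p (axis b 1) (brD (axis a 1) Y - brD' (axis a 1) Y))"
    for a b Y
  proof -
    have "double_inner p (brE (axis a 1) (axis b 1)) Y + (-1) ^ (ct p a * ct p b) * double_inner p (axis b 1) (brE (axis a 1) Y) = 0"
      if "drinfeld_double p br brs brE brEs" for brE brEs
      using that vec_parity_axis[of "ct p"] unfolding drinfeld_double_def by blast
    from this[OF D] this[OF D'] show ?thesis
      by (simp add: linear_diff[OF linear_double_inner(1)] linear_diff[OF linear_double_inner(2)] right_diff_distrib)
  qed
  have LL: "?d (Inl i) (Inl j) = 0" and RR: "?d (Inr i) (Inr j) = 0" for i j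
    using D D' unfolding drinfeld_double_def incl_axis[symmetric] by simp_all
  have zero: "double_inner p 0 Y = 0" "double_inner p Y 0 = 0" for Y
    using linear_0[OF linear_double_inner(1)] linear_0[OF linear_double_inner(2)] by auto
  have LR: "?d (Inl i) (Inr j) = 0" for i j
  proof (rule double_inner_nondegenerate[of p])
    fix c
    show "double_inner p (?d (Inl i) (Inr j)) (axis c 1) = 0"
    proof (cases c)
      case (Inl k)
      then show ?thesis using inv[of "Inl i" "Inr j" "axis c 1"] LL[of i k] by (simp add: zero)
    next
      case (Inr k)
      \<comment> \<open>Tested against a dual vector, the arguments are exchanged first, so that
        invariance leads to a bracket of two dual vectors, where the difference is known to
        vanish.\<close>
      have "double_inner p (?d (Inr j) (Inl i)) (axis (Inr k) 1) = 0"
        using inv[of "Inr j" "Inl i" "axis (Inr k) 1"] RR[of j k] by (simp add: zero)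
      then show ?thesis
        unfolding Inr skew_d[of "Inl i"]
        by (simp add: linear_neg[OF linear_double_inner(2)] linear_scale[OF linear_double_inner(2)])
    qed
  qed
  have RL: "?d (Inr i) (Inl j) = 0" for i j
    using LR[of j i] skew_d[of "Inr i" "Inl j"] by simp
  have "brD (axis a 1) (axis b 1) = brD' (axis a 1) (axis b 1)" for a b
    using LL RR LR RL by (cases a; cases b) simp_all
  then show eq: "brD = brD'"
    using bilinear_eq_axisI[OF bil(1,2)] by blast
  \<comment> \<open>Both cobrackets are the coboundary of the same tensor, hence determined by the
    common bracket.\<close>
  have "dual_cobracket brDs X = dual_cobracket brDs' X" for X
    using D D' eq unfolding drinfeld_double_def by simp
  then have "brDs (axis c 1) (axis b 1) = brDs' (axis c 1) (axis b 1)" for b c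
    by (simp add: vec_eq_iff flip: dual_cobracket_axis)
  then show "brDs = brDs'"
    using bilinear_eq_axisI[OF bil(3,4)] by blast
qed

subsection \<open>The second bracket\<close>

text \<open>A bracket on the dual of the double, in the basis dual to that of the double:
  \<open>Inl i\<close> is the functional dual to e_i, so these components carry the bracket of the
  dual of g, with a minus sign, and the \<open>Inr\<close> components carry the bracket of
  g.\<close>

definition double_dual_bracket ::
    "(real ^ 'i \<Rightarrow> real ^ 'i \<Rightarrow> real ^ 'i) \<Rightarrow> (real ^ 'i \<Rightarrow> real ^ 'i \<Rightarrow> real ^ 'i) \<Rightarrow>
      real ^ ('i + 'i) \<Rightarrow> real ^ ('i + 'i) \<Rightarrow> real ^ ('i + 'i)" where
  "double_dual_bracket br brs U V =
    incl_dual (br (\<chi> i. U $ Inr i) (\<chi> i. V $ Inr i)) - incl (brs (\<chi> i. U $ Inl i) (\<chi> i. V $ Inl i))"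

lemma double_dual_bracket_nth:
  "double_dual_bracket br brs U V $ Inl k = - brs (\<chi> i. U $ Inl i) (\<chi> i. V $ Inl i) $ k"
  "double_dual_bracket br brs U V $ Inr k = br (\<chi> i. U $ Inr i) (\<chi> i. V $ Inr i) $ k"
  by (simp_all add: double_dual_bracket_def)

text \<open>A direct sum of two Lie brackets, one of them negated. The negative of a Lie bracket is
  again one, because the Jacobi identity is quadratic in the bracket.\<close>

lemma lie_super_double_dual_bracket:
  fixes br brs :: "real ^ 'i \<Rightarrow> real ^ 'i \<Rightarrow> real ^ 'i"
  assumes br: "lie_super p br" and brs: "lie_super p brs"
  shows "lie_super (ct p) (double_dual_bracket br brs)"
proof -
  let ?B = "double_dual_bracket br brs"
  let ?L = "\<lambda>U :: real ^ ('i + 'i). \<chi> i. U $ Inl i" and ?R = "\<lambda>U :: real ^ ('i + 'i). \<chi> i. U $ Inr i"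
  have par: "vec_parity (ct p) a U \<longleftrightarrow> vec_parity p a (?L U) \<and> vec_parity p a (?R U)" for a U
    unfolding vec_parity_def by (auto, (metis ct_simps sum.exhaust)+)
  have neg: "vec_parity p e (- X) \<longleftrightarrow> vec_parity p e X" for e X
    by (simp add: vec_parity_def)
  have lin: "linear ?L" "linear ?R"
    by (auto intro!: linearI simp: vec_eq_iff)
  have L: "?L (?B U V) = - brs (?L U) (?L V)" and R: "?R (?B U V) = br (?R U) (?R V)" for U V
    by (simp_all add: vec_eq_iff double_dual_bracket_nth)
  have eqI: "?L U = ?L V \<Longrightarrow> ?R U = ?R V \<Longrightarrow> U = V" for U V
    by (rule vec_sum_eqI) (simp_all add: vec_eq_iff)
  have l: "linear (br X)" "linear (\<lambda>X. br X Y)" "linear (brs X)" "linear (\<lambda>X. brs X Y)" for X Y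
    using lie_superD(1)[OF br] lie_superD(1)[OF brs] by (auto simp: bilinear_def)
  show ?thesis
    unfolding lie_super_def
  proof (intro conjI allI impI)
    show "bilinear ?B"
      unfolding bilinear_def
      by (intro conjI allI linearI eqI)
        (simp_all only: L R linear_add[OF lin(1)] linear_add[OF lin(2)] linear_scale[OF lin(1)] linear_scale[OF lin(2)]
          linear_add[OF l(1)] linear_add[OF l(2)] linear_add[OF l(3)] linear_add[OF l(4)]
          linear_scale[OF l(1)] linear_scale[OF l(2)] linear_scale[OF l(3)] linear_scale[OF l(4)]
          minus_add_distrib scaleR_minus_right)
  next
    fix a b and U V :: "real ^ ('i + 'i)"
    assume UV: "vec_parity (ct p) a U \<and> vec_parity (ct p) b V"
    show "vec_parity (ct p) (a + b) (?B U V)"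
      using UV lie_superD(2)[OF br, of a "?R U" b "?R V"] lie_superD(2)[OF brs, of a "?L U" b "?L V"]
      unfolding par L R neg by blast
    show "?B U V = - ((-1) ^ (a * b) *\<^sub>R ?B V U)"
      using UV lie_superD(3)[OF br, of a "?R U" b "?R V"] lie_superD(3)[OF brs, of a "?L U" b "?L V"]
      by (intro eqI) (simp_all only: L R par linear_neg[OF lin(1)] linear_neg[OF lin(2)] linear_scale[OF lin(1)] linear_scale[OF lin(2)]
          scaleR_minus_right minus_minus)
  next
    fix a b c and U V W :: "real ^ ('i + 'i)"
    assume UVW: "vec_parity (ct p) a U \<and> vec_parity (ct p) b V \<and> vec_parity (ct p) c W"
    show "?B U (?B V W) = ?B (?B U V) W + (-1) ^ (a * b) *\<^sub>R ?B V (?B U W)"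
      using UVW lie_superD(4)[OF br, of a "?R U" b "?R V" c "?R W"]
        lie_superD(4)[OF brs, of a "?L U" b "?L V" c "?L W"]
      by (intro eqI) (simp_all only: L R par linear_add[OF lin(1)] linear_add[OF lin(2)]
          linear_scale[OF lin(1)] linear_scale[OF lin(2)]
          linear_neg[OF l(3)] linear_neg[OF l(4)] minus_minus scaleR_minus_right)
  qed
qed

lemma double_dual_bracket_axis:
  assumes "bilinear br" "bilinear brs"
  shows "double_dual_bracket br brs (axis (Inl i) 1) (axis (Inl j) 1) = - incl (brs (axis i 1) (axis j 1))"
    and "double_dual_bracket br brs (axis (Inr i) 1) (axis (Inr j) 1) = incl_dual (br (axis i 1) (axis j 1))"
    and "double_dual_bracket br brs (axis (Inl i) 1) (axis (Inr j) 1) = 0"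
    and "double_dual_bracket br brs (axis (Inr i) 1) (axis (Inl j) 1) = 0"
proof -
  have ax: "(\<chi> k. (axis (Inl i) 1 :: real ^ ('a + 'a)) $ Inl k) = axis i 1"
    "(\<chi> k. (axis (Inr i) 1 :: real ^ ('a + 'a)) $ Inr k) = axis i 1"
    "(\<chi> k. (axis (Inl i) 1 :: real ^ ('a + 'a)) $ Inr k) = 0"
    "(\<chi> k. (axis (Inr i) 1 :: real ^ ('a + 'a)) $ Inl k) = 0" for i
    by (simp_all add: vec_eq_iff axis_def)
  have z: "br 0 Y = 0" "br X 0 = 0" "brs 0 Y = 0" "brs X 0 = 0" for X Y
    using assms bilinear_lzero bilinear_rzero by blast+
  show "double_dual_bracket br brs (axis (Inl i) 1) (axis (Inl j) 1) = - incl (brs (axis i 1) (axis j 1))"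
    and "double_dual_bracket br brs (axis (Inr i) 1) (axis (Inr j) 1) = incl_dual (br (axis i 1) (axis j 1))"
    and "double_dual_bracket br brs (axis (Inl i) 1) (axis (Inr j) 1) = 0"
    and "double_dual_bracket br brs (axis (Inr i) 1) (axis (Inl j) 1) = 0"
    unfolding double_dual_bracket_def ax z
    by (simp_all add: linear_0[OF linear_incl(1)] linear_0[OF linear_incl(2)])
qed

subsection \<open>The Hamiltonian of the double\<close>

lemma pd_Inl_ham:
  assumes X: "vector_field p e X"
  shows "pd (ct p) (Inl a) (ham p X) = ham p (\<lambda>b. pd p a (X b))"
proof -
  have "pd (ct p) (Inl a) (ham p X) = (\<Sum>b\<in>UNIV. pd (ct p) (Inl a) (pull (X b) * mom p b))"
    unfolding ham_def by (intro pd_sum cinf_mult cinf_pull vector_field_cinf[OF X] cinf_crd)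
  also have "\<dots> = ham p (\<lambda>b. pd p a (X b))"
    unfolding ham_def
    by (rule sum.cong)
      (simp_all add: pd_mult[OF has_parity_pull[OF vector_field_parity[OF X]]
          cinf_pull[OF vector_field_cinf[OF X]] cinf_crd] pd_crd pd_pull vector_field_cinf[OF X])
  finally show ?thesis .
qed

text \<open>For odd F with {F, F} = 0 the Jacobi identity says that {F, {F, g}} equals its own
  negative; this closes such arguments.\<close>

lemma eq_minus_self_imp_zero: "x = - x \<Longrightarrow> x = 0" for x :: "'a::real_vector"
proof -
  assume "x = - x"
  then have "2 *\<^sub>R x = 0" unfolding scaleR_2 by (metis add.right_inverse)
  then show ?thesis by simp
qed

lemma vector_field_pd: "vector_field p e X \<Longrightarrow> vector_field p (e + p a) (\<lambda>b. pd p a (X b))"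
  using has_parity_pd[of _ "X _" p a]
  by (auto simp: vector_field_def cinf_pd) (metis add.assoc add.commute)

text \<open>The brackets \<open>br\<close> and \<open>brs\<close> are given only through their
  correspondence with Q and S; their Lie axioms are derived in the locale.\<close>

locale lie_bialgebra_data =
  fixes p :: "'i::{finite,linorder} \<Rightarrow> nat"
    and Q S :: "'i \<Rightarrow> 'i \<Rightarrow> 'i \<Rightarrow> real"
    and br brs :: "(real, 'i) vec \<Rightarrow> (real, 'i) vec \<Rightarrow> (real, 'i) vec"
  assumes qs: "qs_structure (shift p) (Q_field p Q) (S_fun p S)"
    and br: "field_gives_lie p (\<lambda>_. 1) (Q_field p Q) br"
    and brs: "schouten_gives_lie p (\<lambda>_. 1) (S_fun p S) brs"
begin

abbreviation "q \<equiv> shift p"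
abbreviation "q2 \<equiv> ct (shift p)"
abbreviation "Qf \<equiv> Q_field p Q"
abbreviation "QH \<equiv> Q_fun p Q"
abbreviation "SH \<equiv> S_fun p S"
abbreviation "H \<equiv> QH + SH"
abbreviation "X \<equiv> QD_field p Q S"
abbreviation "\<beta> i j k \<equiv> br (axis i 1) (axis j 1) $ k"
abbreviation "\<gamma> i j k \<equiv> brs (axis i 1) (axis j 1) $ k"

lemma Qf: "vector_field q 1 Qf" "homological q Qf" "Qf k \<in> cinf q"
  using qs by (auto simp: qs_structure_def homological_def vector_field_def)

lemma SH: "has_parity 1 SH" "SH \<in> cinf q2" "SH \<in> fiber_hom q (Suc (Suc 0))" "poisson q SH SH = 0"
  using qs by (auto simp: qs_structure_def schouten_tensor_def fiberwise_quadratic_fiber_hom)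

lemma QH_eq: "QH = ham q Qf"
proof -
  have "pull (Qf k) = (1/2) *\<^sub>R (\<Sum>i\<in>UNIV. \<Sum>j\<in>UNIV. Q i j k *\<^sub>R (pos q j * pos q i))" for k
    by (simp add: Q_field_def pull_scaleR pull_sum pull_mult pull_crd)
  then have "ham q Qf = (1/2) *\<^sub>R (\<Sum>k\<in>UNIV. \<Sum>i\<in>UNIV. \<Sum>j\<in>UNIV. Q i j k *\<^sub>R (pos q j * pos q i * mom q k))"
    unfolding ham_def by (simp add: sum_distrib_right scaleR_sum_right)
  also have "(\<Sum>k\<in>UNIV. \<Sum>i\<in>UNIV. \<Sum>j\<in>UNIV. Q i j k *\<^sub>R (pos q j * pos q i * mom q k))
    = (\<Sum>i\<in>UNIV. \<Sum>k\<in>UNIV. \<Sum>j\<in>UNIV. Q i j k *\<^sub>R (pos q j * pos q i * mom q k))"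
    by (rule sum.swap)
  also have "\<dots> = (\<Sum>i\<in>UNIV. \<Sum>j\<in>UNIV. \<Sum>k\<in>UNIV. Q i j k *\<^sub>R (pos q j * pos q i * mom q k))"
    by (intro sum.cong refl sum.swap)
  finally show ?thesis by (simp add: Q_fun_def)
qed

lemma QH: "has_parity 1 QH" "QH \<in> cinf q2" "QH \<in> fiber_hom q (Suc 0)"
  unfolding QH_eq using Qf(1) by (intro has_parity_ham cinf_ham fiber_hom_ham; assumption)+

lemma H: "has_parity 1 H" "H \<in> cinf q2"
  using QH SH by (auto intro: has_parity_add cinf_add)

lemma poisson_QH_SH: "poisson q QH SH = 0"
  using qs unfolding QH_eq qs_structure_def schouten_tensor_def
  by (intro odd_derivationD Qf(1) SH) auto

text \<open>Each part of the hypothesis kills one component: {Q, Q} vanishes as the field is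
  homological, {Q, S} as it is a derivation, {S, S} as \<open>S\<close> is a Schouten
  tensor.\<close>

lemma poisson_H_H: "poisson q H H = 0"
proof -
  have "poisson q SH QH = 0"
    using poisson_antisym[OF SH(1) QH(1), of q] poisson_QH_SH by simp
  moreover have "poisson q QH QH = 0"
    unfolding QH_eq by (rule poisson_ham_self[OF Qf(2)])
  ultimately show ?thesis
    using poisson_QH_SH by (simp add: poisson_add_left poisson_add_right QH SH)
qed

lemma X: "vector_field q2 1 X" "X c \<in> cinf q2"
proof -
  show X: "vector_field q2 1 X"
    unfolding QD_field_def by (rule ham_field_vector_field[OF H])
  show "X c \<in> cinf q2" by (rule vector_field_cinf[OF X])
qed

text \<open>The sign of the Hamiltonian field of an odd function is exactly
  \<open>double_sign\<close>, the sign that identifies the cotangent bundle with the shifted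
  double.\<close>

lemma X_eq: "X c = double_sign p c *\<^sub>R pd q2 (conj_index c) H"
  unfolding QD_field_def
  by (cases c; cases "even (p (projr c))") (simp_all add: ham_field_Inl[OF H(1)] shift_apply)

lemma homological_X: "homological q2 X"
  unfolding homological_def
proof (intro conjI ballI X)
  fix f assume "f \<in> cinf q2"
  then show "vact q2 X (vact q2 X f) = 0"
    using poisson_jacobi[OF H H, of f]
    by (intro eq_minus_self_imp_zero) (simp add: poisson_vact[symmetric] QD_field_def poisson_H_H)
qed

subsection \<open>Third derivatives\<close>

lemma Qf_second: "pd q i (pd q j (Qf k)) = ((-1) ^ p j * \<beta> i j k) *\<^sub>R 1"
  and bilinear_br: "bilinear br"
  using br unfolding field_gives_lie_iff[of "Q_field p Q" p "\<lambda>_. 1", OF Qf(3), simplified] by auto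

lemma bilinear_brs: "bilinear brs"
  using brs by (simp add: schouten_gives_lie_def)

lemma SH_second: "pd q2 (Inr i) (pd q2 (Inr j) SH)
  = (-1) ^ p i *\<^sub>R pull (linear_function p (\<lambda>_. 1) (brs (axis i 1) (axis j 1)))"
proof -
  have "poisson q (pull (crd q i)) (poisson q SH (pull (crd q j)))
    = pull (linear_function p (\<lambda>_. 1) (brs (axis i 1) (axis j 1)))"
    using brs unfolding pull_schouten_bracket[OF SH(3) cinf_crd cinf_crd] schouten_gives_lie_def
    by (metis linear_function_axis scaleR_one)
  moreover have "poisson q SH (pos q j) = pd q2 (Inr j) SH"
    unfolding poisson_crd ham_field_Inl(1)[OF SH(1)] by simp
  ultimately show ?thesis
    by (cases "even (p i)") (simp_all add: pull_crd poisson_pos shift_apply minus_equation_iff[of "pd _ _ _"])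
qed

lemma pd_linear_function: "pd q k (linear_function p t u) = (u $ k * t k) *\<^sub>R 1"
proof -
  have "pd q k (linear_function p t u) = (\<Sum>i\<in>UNIV. (u $ i * t i) *\<^sub>R ((if k = i then 1 else 0) * 1))"
    unfolding linear_function_def by (simp add: pd_sum pd_scaleR cinf_scaleR pd_crd)
  then show ?thesis by (simp only: sum_delta_mult_scaleR)
qed

lemma QH_Inl_Inl_Inr: "pd q2 (Inl i) (pd q2 (Inl j) (pd q2 (Inr k) QH)) = ((-1) ^ p j * \<beta> i j k) *\<^sub>R 1"
proof -
  have "pd q2 (Inr k) QH = pull (Qf k)"
    unfolding QH_eq pd_Inr_ham[OF Qf(1)] by simp
  then show ?thesis by (simp add: pd_pull Qf(3) cinf_pd Qf_second pull_scaleR)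
qed

lemma QH_Inr_Inr: "pd q2 (Inr i) (pd q2 (Inr j) QH) = 0"
  by (intro pd_Inr_fiber_hom_0 fiber_hom_pd_Inr QH(3))

lemma QH_Inl_Inl: "pd q2 (Inl i) (pd q2 (Inl j) QH) = (-1) ^ p j *\<^sub>R (\<Sum>k\<in>UNIV. \<beta> i j k *\<^sub>R mom q k)"
  unfolding QH_eq pd_Inl_ham[OF Qf(1)] pd_Inl_ham[OF vector_field_pd[OF Qf(1)]] Qf_second
  by (simp add: ham_def pull_scaleR scaleR_sum_right)

lemma QH_Inl_Inl_Inl: "pd q2 (Inl i) (pd q2 (Inl j) (pd q2 (Inl k) QH)) = 0"
  unfolding QH_Inl_Inl by (simp add: pd_scaleR pd_sum cinf_sum cinf_scaleR pd_crd)

text \<open>By \<open>SH_second\<close> the second momentum derivatives of \<open>SH\<close> are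
  linear on the base and die under two base derivatives. As \<open>?F\<close> is quadratic in the
  momenta, this already forces it to be 0.\<close>

lemma SH_Inl_Inl: "pd q2 (Inl i) (pd q2 (Inl j) SH) = 0"
proof (rule fiber_hom_eq_0I)
  let ?F = "pd q2 (Inl i) (pd q2 (Inl j) SH)"
  show F: "?F \<in> fiber_hom q (Suc (Suc 0))"
    by (intro fiber_hom_pd_Inl SH)
  fix b
  have Fb: "pd q2 (Inr b) ?F = c *\<^sub>R pd q2 (Inl i) (pd q2 (Inl j) (pd q2 (Inr b) SH))"
    if "c = (-1) ^ (q b * q i + q b * q j)" for c
    using that pd_commute[OF SH(2), of "Inr b" "Inl j"]
      pd_commute[OF cinf_pd[OF SH(2)], of "Inr b" "Inl i" "Inl j"]
    by (simp add: pd_scaleR cinf_pd SH power_add)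
  show "pd q2 (Inr b) ?F = 0"
  proof (rule fiber_hom_eq_0I[OF fiber_hom_pd_Inr[OF F]])
    fix a
    let ?G = "pd q2 (Inr b) SH"
    have "pd q2 (Inl i) (pd q2 (Inl j) (pd q2 (Inr a) ?G)) = 0"
      unfolding SH_second
      by (simp add: pd_scaleR pd_pull cinf_pull cinf_linear_function cinf_pd pd_linear_function pull_scaleR)
    then have "pd q2 (Inr a) (pd q2 (Inl i) (pd q2 (Inl j) ?G)) = 0"
      using pd_commute[OF cinf_pd[OF SH(2)], of "Inr a" "Inl j" "Inr b"]
        pd_commute[OF cinf_pd[OF cinf_pd[OF SH(2)]], of "Inr a" "Inl i" "Inl j" "Inr b"]
      by (simp add: pd_scaleR cinf_pd SH)
    then show "pd q2 (Inr a) (pd q2 (Inr b) ?F) = 0"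
      by (simp add: Fb[OF refl] pd_scaleR cinf_pd SH)
  qed
qed

lemma SH_Inr_Inr_Inr: "pd q2 (Inr i) (pd q2 (Inr j) (pd q2 (Inr k) SH)) = 0"
  by (intro pd_Inr_fiber_hom_0 fiber_hom_pd_Inr SH(3))

lemma SH_Inl_Inr_Inr: "pd q2 (Inl k) (pd q2 (Inr i) (pd q2 (Inr j) SH)) = ((-1) ^ p i * \<gamma> i j k) *\<^sub>R 1"
  unfolding SH_second
  by (simp add: pd_scaleR cinf_pull cinf_linear_function pd_pull pd_linear_function pull_scaleR)

text \<open>The third derivatives of the cubic function \<open>H\<close> are constants, shown in
  \<open>third_derivative\<close>; the value is read off as the coefficient of the empty monomial at
  the origin.\<close>

definition h :: "'i + 'i \<Rightarrow> 'i + 'i \<Rightarrow> 'i + 'i \<Rightarrow> real" where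
  "h a b c = coef (pd q2 a (pd q2 b (pd q2 c H))) {} 0"

lemma pd_H: "pd q2 a (pd q2 b (pd q2 c H))
    = pd q2 a (pd q2 b (pd q2 c QH)) + pd q2 a (pd q2 b (pd q2 c SH))"
  by (simp add: pd_add QH SH cinf_pd)

lemma swap12: "pd q2 a (pd q2 b (pd q2 c H)) = (-1) ^ (q2 a * q2 b) *\<^sub>R pd q2 b (pd q2 a (pd q2 c H))"
  by (rule pd_commute) (intro cinf_pd H)

lemma swap23: "pd q2 a (pd q2 b (pd q2 c H)) = (-1) ^ (q2 b * q2 c) *\<^sub>R pd q2 a (pd q2 c (pd q2 b H))"
  unfolding pd_commute[OF H(2), of b c] by (simp add: pd_scaleR cinf_pd H)

lemma H_Inl_Inl_Inl: "pd q2 (Inl i) (pd q2 (Inl j) (pd q2 (Inl k) H)) = 0 *\<^sub>R 1"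
  by (simp add: pd_H QH_Inl_Inl_Inl SH_Inl_Inl)

lemma H_Inr_Inr_Inr: "pd q2 (Inr i) (pd q2 (Inr j) (pd q2 (Inr k) H)) = 0 *\<^sub>R 1"
  by (simp add: pd_H QH_Inr_Inr SH_Inr_Inr_Inr)

lemma H_Inl_Inl_Inr: "pd q2 (Inl i) (pd q2 (Inl j) (pd q2 (Inr k) H)) = ((-1) ^ p j * \<beta> i j k) *\<^sub>R 1"
proof -
  have "pd q2 (Inr k) (pd q2 (Inl i) (pd q2 (Inl j) SH)) = 0" by (simp add: SH_Inl_Inl)
  then have "pd q2 (Inl i) (pd q2 (Inl j) (pd q2 (Inr k) SH)) = 0"
    using pd_commute[OF SH(2), of "Inl j" "Inr k"] pd_commute[OF cinf_pd[OF SH(2)], of "Inl i" "Inr k" "Inl j"]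
    by (simp add: pd_scaleR cinf_pd SH)
  then show ?thesis by (simp add: pd_H QH_Inl_Inl_Inr)
qed

lemma H_Inl_Inr_Inr: "pd q2 (Inl k) (pd q2 (Inr i) (pd q2 (Inr j) H)) = ((-1) ^ p i * \<gamma> i j k) *\<^sub>R 1"
  by (simp add: pd_H QH_Inr_Inr SH_Inl_Inr_Inr)

text \<open>Graded symmetry brings every mixture of base and momentum derivatives into one of the
  four orders computed above, at the cost of a sign.\<close>

lemma third_derivative: "pd q2 a (pd q2 b (pd q2 c H)) = h a b c *\<^sub>R 1"
proof -
  have "\<exists>x. pd q2 a (pd q2 b (pd q2 c H)) = x *\<^sub>R 1"
  proof (cases a; cases b; cases c)
    fix i j k
    assume "a = Inl i" "b = Inr j" "c = Inl k"
    then show ?thesis using swap23[of a b c] by (auto simp: H_Inl_Inl_Inr)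
  next
    fix i j k
    assume *: "a = Inr i" "b = Inl j" "c = Inl k"
    show ?thesis using swap12[of a b c] swap23[of b a c] unfolding * by (auto simp: H_Inl_Inl_Inr)
  next
    fix i j k
    assume *: "a = Inr i" "b = Inl j" "c = Inr k"
    show ?thesis using swap12[of a b c] unfolding * by (auto simp: H_Inl_Inr_Inr)
  next
    fix i j k
    assume *: "a = Inr i" "b = Inr j" "c = Inl k"
    show ?thesis using swap23[of a b c] swap12[of a c b] unfolding * by (auto simp: H_Inl_Inr_Inr)
  qed (use H_Inl_Inl_Inl H_Inr_Inr_Inr H_Inl_Inl_Inr H_Inl_Inr_Inr in blast)+
  then show ?thesis by (auto simp: h_def coef_one)
qed

lemma h_swap12: "h a b c = (-1) ^ (q2 a * q2 b) * h b a c"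
  and h_swap23: "h a b c = (-1) ^ (q2 b * q2 c) * h a c b"
  using swap12[of a b c] swap23[of a b c] unfolding third_derivative by simp_all

lemma h_values:
  "h (Inl i) (Inl j) (Inl k) = 0" "h (Inr i) (Inr j) (Inr k) = 0"
  "h (Inl i) (Inl j) (Inr k) = (-1) ^ p j * \<beta> i j k"
  "h (Inl k) (Inr i) (Inr j) = (-1) ^ p i * \<gamma> i j k"
  using H_Inl_Inl_Inl H_Inr_Inr_Inr H_Inl_Inl_Inr H_Inl_Inr_Inr unfolding third_derivative by simp_all

lemma q2_eq: "q2 d = ct p d + 1"
  by (cases d) (simp_all add: shift_apply)

text \<open>\<open>H\<close> is odd and each of three derivatives shifts the parity once more; these
  four units cancel modulo 2, and a nonzero constant must be even.\<close>

lemma h_parity: "h a b c \<noteq> 0 \<Longrightarrow> even (ct p a + ct p b + ct p c)"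
proof -
  assume nz: "h a b c \<noteq> 0"
  have "has_parity (1 + q2 c + q2 b + q2 a) (h a b c *\<^sub>R (1 :: ('i + 'i) sfun))"
    unfolding third_derivative[symmetric] by (intro has_parity_pd H)
  then have "even (1 + q2 c + q2 b + q2 a)"
    using nz has_parity_coef[of _ "h a b c *\<^sub>R (1 :: ('i + 'i) sfun)" "{}"] by (force simp: coef_one)
  then show ?thesis by (simp add: q2_eq) argo
qed

text \<open>Moving the momentum index across both others costs no sign: where the value is nonzero,
  \<open>q i + q j\<close> has the parity of \<open>p k\<close>, and \<open>q k\<close> has the
  opposite one, so the exponent is even.\<close>

lemma h_Inr_Inl_Inl: "h (Inr k) (Inl i) (Inl j) = (-1) ^ p j * \<beta> i j k"
proof -
  have "h (Inr k) (Inl i) (Inl j) = (-1) ^ (q k * q i + q k * q j) * h (Inl i) (Inl j) (Inr k)"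
    using h_swap12[of "Inr k" "Inl i" "Inl j"] h_swap23[of "Inl i" "Inr k" "Inl j"] by (simp add: power_add)
  then show ?thesis
    using h_parity[of "Inl i" "Inl j" "Inr k"] unfolding h_values
    by (cases "\<beta> i j k = 0"; cases "even (p i)"; cases "even (p j)"; cases "even (p k)")
      (simp_all add: shift_apply)
qed

lemma h_Inr_Inr_Inl: "h (Inr i) (Inr j) (Inl k) = (-1) ^ p i * \<gamma> i j k"
proof -
  have "h (Inr i) (Inr j) (Inl k) = (-1) ^ (q k * q i + q k * q j) * h (Inl k) (Inr i) (Inr j)"
    using h_swap23[of "Inr i" "Inr j" "Inl k"] h_swap12[of "Inr i" "Inl k" "Inr j"] by (simp add: power_add mult_ac)
  then show ?thesis
    using h_parity[of "Inl k" "Inr i" "Inr j"] unfolding h_values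
    by (cases "\<gamma> i j k = 0"; cases "even (p i)"; cases "even (p j)"; cases "even (p k)")
      (simp_all add: shift_apply)
qed

subsection \<open>The bracket of the double\<close>

abbreviation "t \<equiv> double_sign p"

text \<open>Obtained by solving the relation of \<open>field_gives_lie_iff\<close> for the structure
  constants; the sign \<open>t c\<close> there cancels against the one in
  \<open>X_eq\<close>.\<close>

definition brD :: "real ^ ('i + 'i) \<Rightarrow> real ^ ('i + 'i) \<Rightarrow> real ^ ('i + 'i)" where
  "brD = structure_bracket (\<lambda>a b c. (-1) ^ ct p b * t a * t b * h a b (conj_index c))"

abbreviation "brDs \<equiv> double_dual_bracket br brs"

lemma bilinear_brD: "bilinear brD"
  unfolding brD_def by (rule bilinear_structure_bracket)

lemma brD_axis: "brD (axis a 1) (axis b 1) $ c = (-1) ^ ct p b * t a * t b * h a b (conj_index c)"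
  unfolding brD_def by (rule structure_bracket_axis)

lemma field_gives_brD: "field_gives_lie (ct p) t X brD"
proof -
  have "pd q2 a (pd q2 b (X c)) = ((-1) ^ ct p b * t a * t b * t c * brD (axis a 1) (axis b 1) $ c) *\<^sub>R 1" for a b c
  proof -
    have "pd q2 a (pd q2 b (X c)) = (t c * h a b (conj_index c)) *\<^sub>R 1"
      unfolding X_eq by (simp add: pd_scaleR cinf_pd H third_derivative)
    moreover have "(-1) ^ ct p b * t a * t b * t c * brD (axis a 1) (axis b 1) $ c
      = ((-1) ^ ct p b * (-1) ^ ct p b) * (t a * t a) * (t b * t b) * (t c * h a b (conj_index c))"
      unfolding brD_axis by (simp only: mult_ac)
    ultimately show ?thesis by (auto simp: double_sign_square simp flip: power_add)
  qed
  then show ?thesis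
    using field_gives_lie_iff[of X "ct p" t brD] X(2) double_sign_square bilinear_brD
    unfolding double_ct_shift by blast
qed

lemma lie_super_brD: "lie_super (ct p) brD"
  using homological_imp_lie_super[of "ct p" X t brD] homological_X field_gives_brD double_sign_square
  unfolding double_ct_shift by blast

lemma brD_incl: "brD (incl U) (incl V) = incl (br U V)"
  by (rule bilinear_eq_axisI[OF bilinear_compose_incl(1)[OF bilinear_brD] bilinear_incl_compose(1)[OF bilinear_br]])
    (rule vec_sum_eqI; simp add: incl_axis brD_axis h_values flip: power_add)

lemma brD_incl_dual: "brD (incl_dual u) (incl_dual v) = incl_dual (brs u v)"
proof (rule bilinear_eq_axisI[OF bilinear_compose_incl(2)[OF bilinear_brD] bilinear_incl_compose(2)[OF bilinear_brs]])
  fix i j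
  show "brD (incl_dual (axis i 1)) (incl_dual (axis j 1)) = incl_dual (brs (axis i 1) (axis j 1))"
    unfolding incl_axis
    by (rule vec_sum_eqI; cases "even (p i)"; cases "even (p j)")
      (simp_all add: brD_axis h_values h_Inr_Inr_Inl)
qed

lemma brD_invariant:
  assumes Z: "vec_parity (ct p) a Z" and U: "vec_parity (ct p) b U"
  shows "double_inner p (brD Z U) V + (-1) ^ (a * b) * double_inner p U (brD Z V) = 0"
proof -
  have l: "linear (brD W)" "linear (\<lambda>W. brD W Y)" for W Y
    using bilinear_brD by (auto simp: bilinear_def)
  note li = linear_double_inner
  have basis: "double_inner p (brD (axis x 1) (axis y 1)) (axis z 1)
    + (-1) ^ (ct p x * ct p y) * double_inner p (axis y 1) (brD (axis x 1) (axis z 1)) = 0" for x y z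
  proof -
    have 1: "double_inner p (brD (axis x 1) (axis y 1)) (axis z 1) = (t x * t y * t z) * ((-1) ^ ct p y * h x y z)"
      by (simp add: double_inner_axis brD_axis mult_ac)
    have 2: "double_inner p (axis y 1) (brD (axis x 1) (axis z 1)) = (t x * t y * t z) * ((-1) ^ ct p y * (-1) ^ ct p z * h x z y)"
    proof -
      \<comment> \<open>This is the supersymmetry of the pairing: exchanging a basis vector with its
        partner multiplies by the sign of their parity.\<close>
      have "t (conj_index y) = t y * (-1) ^ ct p y" by (cases y) (simp_all flip: power_add)
      then show ?thesis by (simp add: double_inner_axis brD_axis mult_ac)
    qed
    \<comment> \<open>The symmetry of \<open>h\<close> contributes the exponent (ct p y + 1)(ct p z
      + 1). Where \<open>h\<close> is nonzero, ct p x has the parity of ct p y + ct p z, and the two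
      terms come out with opposite signs.\<close>
    have 3: "(-1) ^ ct p y * h x y z + (-1) ^ (ct p x * ct p y) * ((-1) ^ ct p y * (-1) ^ ct p z * h x z y) = 0"
      using h_parity[of x y z] h_swap23[of x z y]
      by (cases "h x y z = 0"; cases "even (ct p x)"; cases "even (ct p y)"; cases "even (ct p z)")
        (simp_all add: q2_eq)
    have "double_inner p (brD (axis x 1) (axis y 1)) (axis z 1)
      + (-1) ^ (ct p x * ct p y) * double_inner p (axis y 1) (brD (axis x 1) (axis z 1))
      = (t x * t y * t z) * ((-1) ^ ct p y * h x y z + (-1) ^ (ct p x * ct p y) * ((-1) ^ ct p y * (-1) ^ ct p z * h x z y))"
      unfolding 1 2 by (simp only: distrib_left mult_ac)
    then show ?thesis unfolding 3 by simp
  qed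
  have "double_inner p (brD Z U) (axis z 1) + (-1) ^ (a * b) * double_inner p U (brD Z (axis z 1)) = 0" for z
  proof -
    let ?z = "axis z 1 :: real ^ ('i + 'i)"
    have "double_inner p (brD Z U) ?z
      = (\<Sum>x\<in>UNIV. \<Sum>y\<in>UNIV. Z $ x * U $ y * double_inner p (brD (axis x 1) (axis y 1)) ?z)"
      unfolding bilinear_sum_axis[OF bilinear_brD, of Z U]
      by (simp add: linear_sum[OF li(2)] linear_scale[OF li(2)])
    moreover have "double_inner p U (brD Z ?z)
      = (\<Sum>x\<in>UNIV. \<Sum>y\<in>UNIV. Z $ x * U $ y * double_inner p (axis y 1) (brD (axis x 1) ?z))"
    proof -
      have "brD Z ?z = (\<Sum>x\<in>UNIV. Z $ x *\<^sub>R brD (axis x 1) ?z)"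
        by (subst vec_axis_expansion[of Z]) (simp add: linear_sum[OF l(2)] linear_scale[OF l(2)])
      then have "double_inner p U (brD Z ?z) = (\<Sum>x\<in>UNIV. Z $ x * double_inner p U (brD (axis x 1) ?z))"
        by (simp add: linear_sum[OF li(1)] linear_scale[OF li(1)])
      also have "\<dots> = (\<Sum>x\<in>UNIV. Z $ x * (\<Sum>y\<in>UNIV. U $ y * double_inner p (axis y 1) (brD (axis x 1) ?z)))"
        by (subst vec_axis_expansion[of U]) (simp add: linear_sum[OF li(2)] linear_scale[OF li(2)])
      finally show ?thesis by (simp add: sum_distrib_left mult.assoc)
    qed
    moreover have "Z $ x * U $ y * double_inner p (brD (axis x 1) (axis y 1)) ?z
      + (-1) ^ (a * b) * (Z $ x * U $ y * double_inner p (axis y 1) (brD (axis x 1) ?z)) = 0" for x y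
    proof -
      have sign: "Z $ x * U $ y * (-1) ^ (ct p x * ct p y) = Z $ x * U $ y * (-1) ^ (a * b)"
        using Z U by (cases "Z $ x = 0"; cases "U $ y = 0")
          (fastforce simp: vec_parity_def minus_one_power_iff)+
      have "(-1) ^ (a * b) * (Z $ x * U $ y * double_inner p (axis y 1) (brD (axis x 1) ?z))
        = Z $ x * U $ y * (-1) ^ (ct p x * ct p y) * double_inner p (axis y 1) (brD (axis x 1) ?z)"
        unfolding sign by (simp only: mult_ac)
      then have "Z $ x * U $ y * double_inner p (brD (axis x 1) (axis y 1)) ?z
          + (-1) ^ (a * b) * (Z $ x * U $ y * double_inner p (axis y 1) (brD (axis x 1) ?z))
        = Z $ x * U $ y * (double_inner p (brD (axis x 1) (axis y 1)) ?z
          + (-1) ^ (ct p x * ct p y) * double_inner p (axis y 1) (brD (axis x 1) ?z))"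
        by (simp only: distrib_left mult.assoc)
      then show ?thesis unfolding basis by simp
    qed
    ultimately show ?thesis
      by (simp add: sum_distrib_left flip: sum.distrib)
  qed
  moreover have "linear (\<lambda>V. double_inner p (brD Z U) V + (-1) ^ (a * b) * double_inner p U (brD Z V))"
    using linear_compose_add[OF li(1)[of p "brD Z U"] linear_compose_scale_right[OF linear_compose[OF l(1)[of Z] li(1)[of p U]], of "(-1) ^ (a * b)"]]
    by (simp add: o_def)
  ultimately show ?thesis
    using linear_eq_axisI[OF _ linear_zero, of "\<lambda>V. double_inner p (brD Z U) V + (-1) ^ (a * b) * double_inner p U (brD Z V)" V]
    by simp
qed

lemma lie_super_br: "lie_super p br"
  by (rule homological_imp_lie_super[OF Qf(2) br]) simp

text \<open>The dual of g embeds by \<open>incl_dual\<close> as a subalgebra of the double, so it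
  inherits the axioms of \<open>brD\<close> by injectivity.\<close>

lemma lie_super_brs: "lie_super p brs"
proof -
  have par: "vec_parity (ct p) a (incl_dual u) \<longleftrightarrow> vec_parity p a u" for a and u :: "(real, 'i) vec"
    by (simp add: vec_parity_def split_sum_all)
  have inj: "incl_dual u = incl_dual v \<Longrightarrow> u = v" for u v :: "(real, 'i) vec"
    by (metis incl_nth(4) vec_eq_iff)
  note lin = linear_incl(2)
  show ?thesis
    unfolding lie_super_def
  proof (intro conjI allI impI)
    show "bilinear brs" by (rule bilinear_brs)
    fix a b u v
    assume uv: "vec_parity p a u \<and> vec_parity p b v"
    show "vec_parity p (a + b) (brs u v)"
      using uv lie_superD(2)[OF lie_super_brD, of a "incl_dual u" b "incl_dual v"]
      by (simp add: par brD_incl_dual)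
    show "brs u v = - ((-1) ^ (a * b) *\<^sub>R brs v u)"
      using uv lie_superD(3)[OF lie_super_brD, of a "incl_dual u" b "incl_dual v"]
      by (intro inj) (simp add: par brD_incl_dual linear_neg[OF lin] linear_scale[OF lin])
  next
    fix a b c u v w
    assume uvw: "vec_parity p a u \<and> vec_parity p b v \<and> vec_parity p c w"
    then show "brs u (brs v w) = brs (brs u v) w + (-1) ^ (a * b) *\<^sub>R brs v (brs u w)"
      using lie_superD(4)[OF lie_super_brD, of a "incl_dual u" b "incl_dual v" c "incl_dual w"]
      by (intro inj) (simp add: par brD_incl_dual linear_add[OF lin] linear_scale[OF lin])
  qed
qed

lemma lie_super_brDs: "lie_super (ct p) brDs"
  by (rule lie_super_double_dual_bracket[OF lie_super_br lie_super_brs])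

text \<open>Each entry of the coboundary is half a sum of two third derivatives of \<open>H\<close>
  that differ by exchanging two indices. The halves add up when the two tensor indices are of the
  same type and cancel when they are mixed, where \<open>brDs\<close> vanishes.\<close>

lemma brDs_coboundary: "dual_cobracket brDs U = ad_tensor (ct p) brD U (double_r p)"
proof (rule linear_eq_axisI[OF linear_dual_cobracket linear_ad_tensor(2)])
  fix a
  have "dual_cobracket brDs (axis a 1) $ b $ c = ad_tensor (ct p) brD (axis a 1) (double_r p) $ b $ c" for b c
  proof -
    note ax = double_dual_bracket_axis[OF bilinear_br bilinear_brs]
    note par = h_parity[of a "conj_index c" "conj_index b"]
    have sw: "h a (conj_index b) (conj_index c) = (-1) ^ (q2 b * q2 c) * h a (conj_index c) (conj_index b)"
      using h_swap23[of a "conj_index b" "conj_index c"] by (simp add: q2_eq)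
    show ?thesis
      unfolding dual_cobracket_axis double_coboundary_nth brD_axis sw
      using par
      by (cases "h a (conj_index c) (conj_index b) = 0"; cases b; cases c; cases a;
          cases "even (ct p a)"; cases "even (ct p b)"; cases "even (ct p c)")
        (simp_all add: ax double_r_nth h_values h_Inr_Inl_Inl shift_apply)
  qed
  then show "dual_cobracket brDs (axis a 1) = ad_tensor (ct p) brD (axis a 1) (double_r p)"
    by (simp add: vec_eq_iff)
qed

lemma double: "drinfeld_double p br brs brD brDs"
  unfolding drinfeld_double_def lie_bialgebra_def
proof (intro conjI allI impI lie_super_brD lie_super_brDs brD_incl brD_incl_dual brDs_coboundary)
  fix a b U V
  assume "vec_parity (ct p) a U \<and> vec_parity (ct p) b V"
  then show "dual_cobracket brDs (brD U V) = ad_tensor (ct p) brD U (dual_cobracket brDs V)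
    - (-1) ^ (a * b) *\<^sub>R ad_tensor (ct p) brD V (dual_cobracket brDs U)"
    unfolding brDs_coboundary by (intro ad_tensor_representation[OF lie_super_brD]) auto
next
  fix a b U V Z
  assume "vec_parity (ct p) a Z \<and> vec_parity (ct p) b U"
  then show "double_inner p (brD Z U) V + (-1) ^ (a * b) * double_inner p U (brD Z V) = 0"
    by (intro brD_invariant) auto
qed

subsection \<open>The Schouten tensor of the double\<close>

abbreviation "SD \<equiv> SD_fun p Q S"

lemma SD_eq: "SD = (1/2) *\<^sub>R poisson q2 (ham q2 X) (r_fun p)"
  by (simp add: SD_fun_def QD_fun_def)

lemma SD: "SD \<in> fiber_hom q2 (Suc (Suc 0))" "SD \<in> cinf (ct q2)" "has_parity 1 SD"
proof -
  show "SD \<in> fiber_hom q2 (Suc (Suc 0))"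
    using fiber_hom_poisson[OF fiber_hom_ham[OF X(1)] r_fun_properties(3)]
    unfolding SD_eq by (intro fiber_hom_scaleR) simp
  then show "SD \<in> cinf (ct q2)" by (rule cinf_fiber_hom)
  show "has_parity 1 SD"
    using has_parity_poisson[OF has_parity_ham[OF X(1)] cinf_ham[OF X(1)] r_fun_properties(1)]
    unfolding SD_eq by (intro has_parity_scaleR) simp
qed

text \<open>Because \<open>X\<close> is Hamiltonian, both terms of
  \<open>schouten_bracket_crd\<close> are multiples of the same second derivative of
  \<open>H\<close>. The coefficient is a sign when \<open>a\<close> and \<open>b\<close> are of the
  same type and 0 when they are mixed.\<close>

lemma schouten_SD_crd: "schouten_bracket q2 SD (crd q2 a) (crd q2 b)
  = ((r_sign p b * t a * (-1) ^ (q2 a + q2 b) + r_sign p a * t b) / 2) *\<^sub>R pd q2 (conj_index a) (pd q2 (conj_index b) H)"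
proof -
  have "pd q2 (conj_index b) (pd q2 (conj_index a) H)
    = (-1) ^ (q2 a * q2 b) *\<^sub>R pd q2 (conj_index a) (pd q2 (conj_index b) H)"
    using pd_commute[OF H(2), of "conj_index b" "conj_index a"] by (simp add: mult.commute)
  then have "2 *\<^sub>R schouten_bracket q2 SD (crd q2 a) (crd q2 b)
    = (r_sign p b * t a * (-1) ^ (q2 a + q2 b) + r_sign p a * t b) *\<^sub>R pd q2 (conj_index a) (pd q2 (conj_index b) H)"
    unfolding SD_eq schouten_bracket_crd[OF X(1)] X_eq
    by (cases "even (q2 a)"; cases "even (q2 b)")
      (simp_all add: pd_scaleR cinf_pd H scaleR_left_distrib scaleR_left_diff_distrib)
  then have "(1/2) *\<^sub>R 2 *\<^sub>R schouten_bracket q2 SD (crd q2 a) (crd q2 b)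
    = (1/2) *\<^sub>R (r_sign p b * t a * (-1) ^ (q2 a + q2 b) + r_sign p a * t b) *\<^sub>R pd q2 (conj_index a) (pd q2 (conj_index b) H)"
    by (rule arg_cong)
  then show ?thesis by simp
qed

section \<open>Comparison of the Schouten bracket with the cobracket of the double\<close>

lemma H_Inr_Inr: "pd q2 (Inr i) (pd q2 (Inr j) H)
    = (-1) ^ p i *\<^sub>R pull (linear_function p (\<lambda>_. 1) (brs (axis i 1) (axis j 1)))"
  by (simp add: pd_add QH SH cinf_pd QH_Inr_Inr SH_second)

lemma H_Inl_Inl: "pd q2 (Inl i) (pd q2 (Inl j) H) = (-1) ^ p j *\<^sub>R (\<Sum>k\<in>UNIV. \<beta> i j k *\<^sub>R mom q k)"
  by (simp add: pd_add QH SH cinf_pd QH_Inl_Inl SH_Inl_Inl)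

lemma linear_function_incl: "linear_function (ct p) t (incl u) = pull (linear_function p (\<lambda>_. 1) u)"
  "linear_function (ct p) t (incl_dual v) = (\<Sum>k\<in>UNIV. (v $ k * (-1) ^ p k) *\<^sub>R mom q k)"
  by (simp_all add: linear_function_def sum_UNIV_Plus double_ct_shift pull_sum pull_scaleR pull_crd)

lemma SD_gives_brDs: "schouten_gives_lie (ct p) t SD brDs"
proof (rule schouten_gives_lieI)
  show "SD \<in> cinf (ct (shift (ct p)))" by (simp add: double_ct_shift SD)
  show "bilinear brDs" by (rule lie_superD(1)[OF lie_super_brDs])
  note ax = double_dual_bracket_axis[OF bilinear_br bilinear_brs]
  note lin = linear_linear_function[of "ct p" t]
  fix a b
  have "(t a * t b) *\<^sub>R ((r_sign p b * t a * (-1) ^ (q2 a + q2 b) + r_sign p a * t b) / 2) *\<^sub>R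
      pd q2 (conj_index a) (pd q2 (conj_index b) H)
      = linear_function (ct p) t (brDs (axis a 1) (axis b 1))"
  proof (cases a; cases b)
    fix i j assume ab: "a = Inl i" "b = Inl j"
    show ?thesis
      unfolding ab by (cases "even (p i)"; cases "even (p j)")
        (simp_all add: ax linear_neg[OF lin] linear_function_incl H_Inr_Inr r_sign_def shift_apply)
  next
    fix i j assume ab: "a = Inr i" "b = Inr j"
    \<comment> \<open>The linear coordinate with index \<open>Inr k\<close> is xi_k up to the sign
      of \<open>p k\<close>; the parity constraint on the structure constants turns this factor into
      a common sign depending on \<open>i\<close> and \<open>j\<close> only.\<close>
    have sign: "\<beta> i j k * (-1) ^ p k = (-1) ^ p i * (-1) ^ p j * \<beta> i j k" for k
      using h_parity[of "Inl i" "Inl j" "Inr k"]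
      by (cases "\<beta> i j k = 0"; cases "even (p i)"; cases "even (p j)"; cases "even (p k)")
        (simp_all add: h_values)
    have "(\<Sum>k\<in>UNIV. (\<beta> i j k * (-1) ^ p k) *\<^sub>R mom q k)
      = ((-1) ^ p i * (-1) ^ p j) *\<^sub>R (\<Sum>k\<in>UNIV. \<beta> i j k *\<^sub>R mom q k)"
      by (simp add: sign scaleR_sum_right mult.assoc)
    then show ?thesis
      unfolding ab by (cases "even (p i)"; cases "even (p j)")
        (simp_all add: ax linear_function_incl H_Inl_Inl r_sign_def shift_apply)
  next
    fix i j assume ab: "a = Inl i" "b = Inr j"
    show ?thesis
      unfolding ab by (cases "even (p i)"; cases "even (p j)")
        (simp_all add: ax linear_0[OF lin] r_sign_def shift_apply)
  next
    fix i j assume ab: "a = Inr i" "b = Inl j"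
    show ?thesis
      unfolding ab by (cases "even (p i)"; cases "even (p j)")
        (simp_all add: ax linear_0[OF lin] r_sign_def shift_apply)
  qed
  then show "(t a * t b) *\<^sub>R schouten_bracket (shift (ct p)) SD (crd (shift (ct p)) a) (crd (shift (ct p)) b)
    = linear_function (ct p) t (brDs (axis a 1) (axis b 1))"
    unfolding double_ct_shift schouten_SD_crd .
qed

lemma schouten_tensor_SD: "schouten_tensor q2 SD"
proof -
  have "t c \<noteq> 0" for c using double_sign_square[of p c] by auto
  then have "poisson q2 SD SD = 0"
    using lie_super_imp_poisson_zero[of SD "ct p" t brDs] SD SD_gives_brDs lie_super_brDs
    unfolding double_ct_shift by blast
  then show ?thesis
    unfolding schouten_tensor_def fiberwise_quadratic_fiber_hom using SD by blast
qed

lemma qs_structure_SD: "qs_structure q2 X SD"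
proof -
  let ?h = "ham q2 X"
  note h = has_parity_ham[OF X(1)] cinf_ham[OF X(1)]
  have "poisson q2 ?h (poisson q2 ?h (r_fun p)) = 0"
    using poisson_jacobi[OF h h r_fun_properties(2)] poisson_ham_self[OF homological_X]
    by (intro eq_minus_self_imp_zero) simp
  then have "poisson q2 ?h SD = 0"
    unfolding SD_eq by (simp add: poisson_scaleR_right cinf_poisson h r_fun_properties)
  then show ?thesis
    unfolding qs_structure_def
    using homological_X schouten_tensor_SD odd_derivationI[OF X(1) SD(3,2)] by blast
qed

end

theorem theorem2p6:
  fixes p :: "'i::{finite,linorder} \<Rightarrow> nat"
    and Q S :: "'i \<Rightarrow> 'i \<Rightarrow> 'i \<Rightarrow> real"
    and br brs :: "(real, 'i) vec \<Rightarrow> (real, 'i) vec \<Rightarrow> (real, 'i) vec"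
  assumes "qs_structure (shift p) (Q_field p Q) (S_fun p S)"
    and "field_gives_lie p (\<lambda>_. 1) (Q_field p Q) br"
    and "schouten_gives_lie p (\<lambda>_. 1) (S_fun p S) brs"
  shows "schouten_tensor (ct (shift p)) (SD_fun p Q S)
    \<and> qs_structure (ct (shift p)) (QD_field p Q S) (SD_fun p Q S)
    \<and> (\<exists>brD brDs. drinfeld_double p br brs brD brDs)
    \<and> (\<forall>brD brDs. drinfeld_double p br brs brD brDs \<longrightarrow>
          field_gives_lie (ct p) (double_sign p) (QD_field p Q S) brD
          \<and> schouten_gives_lie (ct p) (double_sign p) (SD_fun p Q S) brDs)"
proof -
  interpret lie_bialgebra_data p Q S br brs
    using assms by unfold_locales
  \<comment> \<open>Any other double of the same bialgebra coincides with the constructed one by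
    uniqueness, so the two correspondences carry over.\<close>
  show ?thesis
    using schouten_tensor_SD qs_structure_SD double drinfeld_double_unique[OF _ double]
      field_gives_brD SD_gives_brDs by blast
qed

end
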